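(* Let $u$ solve $-\varepsilon\Delta u+cu=f$ in $\Omega=(0,1)\times(0,1)$, $u=0$ on $\partial\Omega$, let $\bar q=-\nabla u$, and assume that $u$ has a decomposition into a smooth part and layer parts satisfying the derivative bounds listed in the context. Let $(u^N,\bar q^N)\in W^N\times V^N$ be the solution of the mixed finite element method $$\varepsilon(\operatorname{div}\bar q^N,w)+c(u^N,w)=(f,w)\quad\text{for all }w\in W^N,$$ $$\varepsilon(\bar q^N,\bar v)-\varepsilon(\operatorname{div}\bar v,u^N)=0\quad\text{for all }\bar v\in V^N,$$ on the Shishkin mesh, where $W^N$ is the space of piecewise constants and $V^N$ the lowest order Raviart-Thomas space. Then there is a constant $C$ independent of $\varepsilon$ and $N$ such that $$\varepsilon^{1/4}\|\bar q-\bar q^N\|_0+\|u-u^N\|_0\le C N^{-1}\ln N.$$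
   Context: Here $0<\varepsilon\ll1$ is a small parameter, $c>0$ is a constant, $f$ is sufficiently smooth, and $(\cdot,\cdot)$, $\|\cdot\|_0$ are the $L_2(\Omega)$ inner product and norm (for scalar and vector functions). Decomposition: $u=S+\sum_{k=1}^4w_k+\sum_{k=1}^4z_k$, where $w_k$ are layer terms associated with the four sides and $z_k$ with the four corners. With a constant $C$ independent of $\varepsilon$, for all $(x,y)\in\overline\Omega$ and $0\le m+n\le4$: $|\partial_x^m\partial_y^nS|\le C(1+\varepsilon^{1-(m+n)/2})$; for the term $w_1$ associated with the side $y=0$, $|\partial_x^m\partial_y^nw_1|\le C(1+\varepsilon^{1-m/2})\varepsilon^{-n/2}e^{-y\sqrt{c/\varepsilon}}$; for the term $z_1$ associated with the corner $(0,0)$, $|\partial_x^m\partial_y^nz_1|\le C\varepsilon^{-(m+n)/2}e^{-(x+y)\sqrt{c/\varepsilon}}$; and the analogous bounds hold for the other sides and corners. Mesh: $N$ is a positive integer divisible by 4, and $\lambda=2\sqrt{\varepsilon}\,\ln N/\sqrt c$, assumed to satisfy $\lambda\le1/4$. The rectangular Shishkin mesh is the tensor product of two identical one-dimensional meshes on $[0,1]$, each dividing $[0,\lambda]$ and $[1-\lambda,1]$ uniformly into $N/4$ intervals each and $[\lambda,1-\lambda]$ uniformly into $N/2$ intervals. Spaces: $W^N\subset L^2(\Omega)$ is the space of functions constant on each mesh rectangle. $V^N\subset H(\operatorname{div},\Omega)$ is the lowest order Raviart-Thomas space $RT_0$: vector functions in $H(\operatorname{div},\Omega)$ whose restriction to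 each mesh rectangle has first component in $\operatorname{span}(1,x)$ and second component in $\operatorname{span}(1,y)$. *)

theory Defs
  imports "HOL-Analysis.Analysis"
begin

section \<open>The unit square, partial derivatives, smoothness up to the boundary\<close>

abbreviation Omega :: "(real \<times> real) set" where
  "Omega \<equiv> {0<..<1} \<times> {0<..<1}"

abbreviation Omega_bar :: "(real \<times> real) set" where
  "Omega_bar \<equiv> {0..1} \<times> {0..1}"

text \<open>Derivatives are taken within \<open>{0..1}\<close>: they are the usual partial derivatives at points of
  the open square and the one-sided ones at points of its boundary.\<close>

definition dx :: "(real \<times> real \<Rightarrow> real) \<Rightarrow> real \<times> real \<Rightarrow> real" where
  "dx g = (\<lambda>(x, y). vector_derivative (\<lambda>t. g (t, y)) (at x within {0..1}))"

definition dy :: "(real \<times> real \<Rightarrow> real) \<Rightarrow> real \<times> real \<Rightarrow> real" where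
  "dy g = (\<lambda>(x, y). vector_derivative (\<lambda>t. g (x, t)) (at y within {0..1}))"

definition pderivs :: "nat \<Rightarrow> nat \<Rightarrow> (real \<times> real \<Rightarrow> real) \<Rightarrow> real \<times> real \<Rightarrow> real" where
  "pderivs m n g = (dx ^^ m) ((dy ^^ n) g)"

definition grad :: "(real \<times> real \<Rightarrow> real) \<Rightarrow> real \<times> real \<Rightarrow> real \<times> real" where
  "grad g = (\<lambda>p. (dx g p, dy g p))"

definition laplacian :: "(real \<times> real \<Rightarrow> real) \<Rightarrow> real \<times> real \<Rightarrow> real" where
  "laplacian g = (\<lambda>p. dx (dx g) p + dy (dy g) p)"

text \<open>\<open>C_bar k g\<close>: \<open>g\<close> is of class \<open>C^k\<close> on the closed square.\<close>

fun C_bar :: "nat \<Rightarrow> (real \<times> real \<Rightarrow> real) \<Rightarrow> bool" where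
  "C_bar 0 g \<longleftrightarrow> continuous_on Omega_bar g"
| "C_bar (Suc k) g \<longleftrightarrow>
     continuous_on Omega_bar g \<and>
     (\<forall>x\<in>{0..1}. \<forall>y\<in>{0..1}.
        (\<lambda>t. g (t, y)) differentiable (at x within {0..1}) \<and>
        (\<lambda>t. g (x, t)) differentiable (at y within {0..1})) \<and>
     C_bar k (dx g) \<and> C_bar k (dy g)"

section \<open>\<open>L_2\<close> and \<open>H(div)\<close>\<close>

text \<open>Elements of \<open>L_2\<close> are represented by functions; only their values almost everywhere
  in \<open>Omega\<close> matter.  The type \<open>'a\<close> is \<open>real\<close> or \<open>real \<times> real\<close>, whose norm is Euclidean.\<close>

definition L2 :: "(real \<times> real \<Rightarrow> 'a::euclidean_space) \<Rightarrow> bool" where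
  "L2 g \<longleftrightarrow> g \<in> borel_measurable (lebesgue_on Omega) \<and>
           integrable (lebesgue_on Omega) (\<lambda>p. (norm (g p))\<^sup>2)"

definition L2_inner ::
  "(real \<times> real \<Rightarrow> 'a::euclidean_space) \<Rightarrow> (real \<times> real \<Rightarrow> 'a) \<Rightarrow> real" where
  "L2_inner g h = integral\<^sup>L (lebesgue_on Omega) (\<lambda>p. g p \<bullet> h p)"

definition L2_norm :: "(real \<times> real \<Rightarrow> 'a::euclidean_space) \<Rightarrow> real" where
  "L2_norm g = sqrt (L2_inner g g)"

definition test_function :: "(real \<times> real \<Rightarrow> real) \<Rightarrow> bool" where
  "test_function \<phi> \<longleftrightarrow> (\<forall>k. C_bar k \<phi>) \<and>
     (\<exists>K. compact K \<and> K \<subseteq> Omega \<and> (\<forall>p. p \<notin> K \<longrightarrow> \<phi> p = 0))"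

definition has_weak_div ::
  "(real \<times> real \<Rightarrow> real \<times> real) \<Rightarrow> (real \<times> real \<Rightarrow> real) \<Rightarrow> bool" where
  "has_weak_div v d \<longleftrightarrow> L2 d \<and>
     (\<forall>\<phi>. test_function \<phi> \<longrightarrow> L2_inner v (grad \<phi>) = - L2_inner d \<phi>)"

definition H_div :: "(real \<times> real \<Rightarrow> real \<times> real) set" where
  "H_div = {v. L2 v \<and> (\<exists>d. has_weak_div v d)}"

text \<open>The weak divergence is unique up to a null set; \<open>weak_div\<close> picks a representative.\<close>

definition weak_div :: "(real \<times> real \<Rightarrow> real \<times> real) \<Rightarrow> real \<times> real \<Rightarrow> real" where
  "weak_div v = (SOME d. has_weak_div v d)"

section \<open>The boundary value problem and the decomposition of its solution\<close>

definition bvp_solution ::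
  "real \<Rightarrow> (real \<times> real \<Rightarrow> real) \<Rightarrow> real \<Rightarrow> (real \<times> real \<Rightarrow> real) \<Rightarrow> bool" where
  "bvp_solution c f \<epsilon> u \<longleftrightarrow> C_bar 2 u \<and>
     (\<forall>p\<in>Omega. - \<epsilon> * laplacian u p + c * u p = f p) \<and>
     (\<forall>p\<in>Omega_bar - Omega. u p = 0)"

text \<open>Sides are numbered counterclockwise: 1 is \<open>y = 0\<close>, 2 is \<open>x = 1\<close>, 3 is \<open>y = 1\<close>,
  4 is \<open>x = 0\<close>.  Corners likewise: 1 is \<open>(0,0)\<close>, 2 is \<open>(1,0)\<close>, 3 is \<open>(1,1)\<close>, 4 is \<open>(0,1)\<close>.\<close>

definition side_dist :: "nat \<Rightarrow> real \<Rightarrow> real \<Rightarrow> real" where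
  "side_dist k x y =
     (if k = 1 then y else if k = 2 then 1 - x else if k = 3 then 1 - y else x)"

definition corner_dist :: "nat \<Rightarrow> real \<Rightarrow> real \<Rightarrow> real" where
  "corner_dist k x y =
     (if k = 1 then x + y else if k = 2 then (1 - x) + y
      else if k = 3 then (1 - x) + (1 - y) else x + (1 - y))"

definition side_factor :: "nat \<Rightarrow> real \<Rightarrow> nat \<Rightarrow> nat \<Rightarrow> real" where
  "side_factor k \<epsilon> m n =
     (if k = 1 \<or> k = 3
      then (1 + \<epsilon> powr (1 - real m / 2)) * \<epsilon> powr (- real n / 2)
      else (1 + \<epsilon> powr (1 - real n / 2)) * \<epsilon> powr (- real m / 2))"

definition layer_decomposition ::
  "real \<Rightarrow> real \<Rightarrow> real \<Rightarrow> (real \<times> real \<Rightarrow> real) \<Rightarrow> bool" where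
  "layer_decomposition C c \<epsilon> u \<longleftrightarrow>
     (\<exists>(S :: real \<times> real \<Rightarrow> real) (w :: nat \<Rightarrow> real \<times> real \<Rightarrow> real) (z :: nat \<Rightarrow> real \<times> real \<Rightarrow> real).
        (\<forall>p\<in>Omega_bar. u p = S p + (\<Sum>k=1..4. w k p) + (\<Sum>k=1..4. z k p)) \<and>
        C_bar 4 S \<and> (\<forall>k\<in>{1..4}. C_bar 4 (w k) \<and> C_bar 4 (z k)) \<and>
        (\<forall>x\<in>{0..1}. \<forall>y\<in>{0..1}. \<forall>m n. m + n \<le> 4 \<longrightarrow>
           \<bar>pderivs m n S (x, y)\<bar> \<le> C * (1 + \<epsilon> powr (1 - real (m + n) / 2)) \<and>
           (\<forall>k\<in>{1..4}.
              \<bar>pderivs m n (w k) (x, y)\<bar>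
                \<le> C * side_factor k \<epsilon> m n * exp (- side_dist k x y * sqrt (c / \<epsilon>)) \<and>
              \<bar>pderivs m n (z k) (x, y)\<bar>
                \<le> C * \<epsilon> powr (- real (m + n) / 2) * exp (- corner_dist k x y * sqrt (c / \<epsilon>)))))"

section \<open>Shishkin mesh and the mixed finite element discretization\<close>

definition shishkin_lam :: "real \<Rightarrow> real \<Rightarrow> nat \<Rightarrow> real" where
  "shishkin_lam c \<epsilon> N = 2 * sqrt \<epsilon> * ln (real N) / sqrt c"

text \<open>Points of the one-dimensional mesh, for \<open>i = 0, \<dots>, N\<close> and transition parameter \<open>l\<close>.\<close>

definition mesh_pt :: "real \<Rightarrow> nat \<Rightarrow> nat \<Rightarrow> real" where
  "mesh_pt l N i =
     (if i \<le> N div 4 then real i * (4 * l / real N)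
      else if i \<le> 3 * (N div 4) then l + (real i - real N / 4) * (2 * (1 - 2 * l) / real N)
      else 1 - l + (real i - 3 * real N / 4) * (4 * l / real N))"

text \<open>Open mesh rectangles: the mesh lines form a null set, on which the
  representatives of discrete functions are left unconstrained.\<close>

definition mesh_cell :: "real \<Rightarrow> nat \<Rightarrow> nat \<Rightarrow> nat \<Rightarrow> (real \<times> real) set" where
  "mesh_cell l N i j =
     {mesh_pt l N i <..< mesh_pt l N (Suc i)} \<times> {mesh_pt l N j <..< mesh_pt l N (Suc j)}"

definition W_space :: "real \<Rightarrow> nat \<Rightarrow> (real \<times> real \<Rightarrow> real) set" where
  "W_space l N =
     {w. L2 w \<and> (\<forall>i<N. \<forall>j<N. \<exists>a. \<forall>p\<in>mesh_cell l N i j. w p = a)}"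

definition V_space :: "real \<Rightarrow> nat \<Rightarrow> (real \<times> real \<Rightarrow> real \<times> real) set" where
  "V_space l N =
     {v \<in> H_div. \<forall>i<N. \<forall>j<N. \<exists>a1 b1 a2 b2. \<forall>(x, y)\<in>mesh_cell l N i j.
        v (x, y) = (a1 + b1 * x, a2 + b2 * y)}"

definition mixed_fem_solution ::
  "real \<Rightarrow> (real \<times> real \<Rightarrow> real) \<Rightarrow> real \<Rightarrow> nat \<Rightarrow>
   (real \<times> real \<Rightarrow> real) \<Rightarrow> (real \<times> real \<Rightarrow> real \<times> real) \<Rightarrow> bool" where
  "mixed_fem_solution c f \<epsilon> N uN qN \<longleftrightarrow>
     uN \<in> W_space (shishkin_lam c \<epsilon> N) N \<and> qN \<in> V_space (shishkin_lam c \<epsilon> N) N \<and>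
     (\<forall>w\<in>W_space (shishkin_lam c \<epsilon> N) N.
        \<epsilon> * L2_inner (weak_div qN) w + c * L2_inner uN w = L2_inner f w) \<and>
     (\<forall>v\<in>V_space (shishkin_lam c \<epsilon> N) N.
        \<epsilon> * L2_inner qN v - \<epsilon> * L2_inner (weak_div v) uN = 0)"

end

theory Submission
  imports Defs "HOL-Computational_Algebra.Polynomial"
begin

text \<open>
  The discrete divergences lie in \<open>W\<^sup>N\<close>, so the scalar unknown can be eliminated: the discrete flux is
  the best approximation of \<open>q = - grad u\<close> in \<open>V\<^sup>N\<close> for the norm belonging to
  \<open>(p, v) + (\<epsilon> / c) (div p, div v)\<close>, and \<open>c (u - u\<^sup>N) = (f - g) - \<epsilon> div (q - q\<^sup>N)\<close>, where \<open>g\<close> is the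
  \<open>L_2\<close> projection of \<open>f\<close> onto piecewise constants (\<open>mixed_fem_quasi_optimal\<close>). It remains to find a
  single \<open>v\<close> in \<open>V\<^sup>N\<close> such that \<open>\<epsilon> powr (1 / 4) * \<parallel>q - v\<parallel>\<close> and \<open>\<epsilon> powr (3 / 4) * \<parallel>div (q - v)\<parallel>\<close> are
  \<open>O (ln N / N)\<close>.

  Each component of \<open>v\<close> is continuous and piecewise linear in its normal variable, with the tangential
  variable frozen at a node. Its nodal values are chosen separately for the nine pieces of the
  decomposition. Pieces that do not decay in the normal direction are interpolated
  (\<open>approximates_smooth\<close>). A piece that does is first shifted by its value at the transition point and
  then extended by \<open>0\<close> into the coarse region (\<open>approximates_layer\<close>). The Raviart--Thomas interpolant
  of the layer would instead produce a term of order \<open>\<epsilon> powr (- 1 / 4) * N powr (- 5 / 2)\<close> in the first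
  coarse cells, while best approximation leaves the choice of \<open>v\<close> free. The pointwise errors are
  \<open>ln N / N\<close> times weights whose integrals carry the right power of \<open>\<epsilon>\<close> (\<open>integral_error_weight\<close>).

  As \<open>V\<^sup>N\<close> and the discrete divergence are defined through test functions, the elements of \<open>V\<^sup>N\<close> must
  first be identified: their weak divergence is the cellwise one (\<open>weak_div_AE_cell_div\<close>) and their
  normal components do not jump (\<open>normal_continuous_if_weak_div\<close>). Both follow by inserting smooth
  bumps into Green's formula on the mesh (\<open>Green_mesh\<close>), and then the same formula extends the weak
  divergence identity from test functions to \<open>u\<close> (\<open>Green_normal_continuous\<close>).\<close>

section \<open>Partial derivatives on the closed square\<close>

lemma MVT_within:
  fixes f f' :: "real \<Rightarrow> real"
  assumes "a < b" "{a..b} \<subseteq> S"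
    and "\<And>x. x \<in> {a..b} \<Longrightarrow> (f has_real_derivative f' x) (at x within S)"
  obtains \<xi> where "a < \<xi>" "\<xi> < b" "f b - f a = f' \<xi> * (b - a)"
proof -
  have "\<exists>x\<in>{a<..<b}. f b - f a = (\<lambda>h. f' x * h) (b - a)"
  proof (rule mvt_simple [OF \<open>a < b\<close>])
    fix x assume "a \<le> x" "x \<le> b"
    then have "(f has_real_derivative f' x) (at x within {a..b})"
      using assms(2,3) by (meson DERIV_subset atLeastAtMost_iff)
    then show "(f has_derivative (\<lambda>h. f' x * h)) (at x within {a..b})"
      by (simp add: has_field_derivative_def)
  qed
  then show ?thesis using that by auto
qed

lemma Lipschitz_within:
  fixes f f' :: "real \<Rightarrow> real"
  assumes "\<And>x. x \<in> {a..b} \<Longrightarrow> (f has_real_derivative f' x) (at x within S)" "{a..b} \<subseteq> S"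
    and "\<And>x. x \<in> {a..b} \<Longrightarrow> \<bar>f' x\<bar> \<le> M" and "x \<in> {a..b}" "y \<in> {a..b}"
  shows "\<bar>f x - f y\<bar> \<le> M * \<bar>x - y\<bar>"
proof -
  have *: "\<bar>f y - f x\<bar> \<le> M * \<bar>y - x\<bar>" if xy: "x < y" "x \<in> {a..b}" "y \<in> {a..b}" for x y
  proof -
    obtain \<xi> where "x < \<xi>" "\<xi> < y" "f y - f x = f' \<xi> * (y - x)"
    proof (rule MVT_within[of x y S f f'])
      fix t assume "t \<in> {x..y}"
      then have "t \<in> {a..b}" using xy by auto
      then show "(f has_real_derivative f' t) (at t within S)" by (rule assms(1))
    qed (use xy assms(2) in auto)
    then show ?thesis
      using assms(3)[of \<xi>] xy by (simp add: abs_mult mult_right_mono)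
  qed
  show ?thesis
    using *[of x y] *[of y x] assms(4,5)
    by (cases x y rule: linorder_cases) (auto simp: abs_minus_commute)
qed

lemma dx_eqI:
  assumes "x \<in> {0..1}" "((\<lambda>t. g (t, y)) has_real_derivative D) (at x within {0..1})"
  shows "dx g (x, y) = D"
  using assms unfolding dx_def
  by (auto intro!: vector_derivative_within_closed_interval
      simp: has_real_derivative_iff_has_vector_derivative)

lemma dy_eqI:
  assumes "y \<in> {0..1}" "((\<lambda>t. g (x, t)) has_real_derivative D) (at y within {0..1})"
  shows "dy g (x, y) = D"
  using assms unfolding dy_def
  by (auto intro!: vector_derivative_within_closed_interval
      simp: has_real_derivative_iff_has_vector_derivative)

lemma C_bar_dx:
  assumes "C_bar (Suc k) g" "x \<in> {0..1}" "y \<in> {0..1}"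
  shows "((\<lambda>t. g (t, y)) has_real_derivative dx g (x, y)) (at x within {0..1})"
proof -
  have "(\<lambda>t. g (t, y)) differentiable (at x within {0..1})"
    using assms by auto
  then show ?thesis
    unfolding has_real_derivative_iff_has_vector_derivative dx_def
    by (simp add: vector_derivative_works)
qed

lemma C_bar_dy:
  assumes "C_bar (Suc k) g" "x \<in> {0..1}" "y \<in> {0..1}"
  shows "((\<lambda>t. g (x, t)) has_real_derivative dy g (x, y)) (at y within {0..1})"
proof -
  have "(\<lambda>t. g (x, t)) differentiable (at y within {0..1})"
    using assms by auto
  then show ?thesis
    unfolding has_real_derivative_iff_has_vector_derivative dy_def
    by (simp add: vector_derivative_works)
qed

lemma C_bar_SucI:
  assumes "continuous_on Omega_bar g"
    and "\<And>x y. x \<in> {0..1} \<Longrightarrow> y \<in> {0..1} \<Longrightarrow>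
           ((\<lambda>t. g (t, y)) has_real_derivative gx (x, y)) (at x within {0..1})"
    and "\<And>x y. x \<in> {0..1} \<Longrightarrow> y \<in> {0..1} \<Longrightarrow>
           ((\<lambda>t. g (x, t)) has_real_derivative gy (x, y)) (at y within {0..1})"
    and "C_bar k (dx g)" "C_bar k (dy g)"
  shows "C_bar (Suc k) g"
  unfolding C_bar.simps real_differentiable_def
  by (intro conjI ballI exI) (rule assms; assumption)+

lemma C_bar_continuous: "C_bar k g \<Longrightarrow> continuous_on Omega_bar g"
  by (cases k) auto

lemma dx_cong:
  assumes "\<And>p. p \<in> Omega_bar \<Longrightarrow> g p = h p" "p \<in> Omega_bar"
  shows "dx g p = dx h p"
proof -
  obtain x y where p: "p = (x, y)" by force
  have "vector_derivative (\<lambda>t. g (t, y)) (at x within {0..1}) =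
        vector_derivative (\<lambda>t. h (t, y)) (at x within {0..1})"
    by (rule vector_derivative_cong_eq) (use assms p in \<open>auto simp: eventually_at_filter\<close>)
  then show ?thesis by (simp add: p dx_def)
qed

lemma dy_cong:
  assumes "\<And>p. p \<in> Omega_bar \<Longrightarrow> g p = h p" "p \<in> Omega_bar"
  shows "dy g p = dy h p"
proof -
  obtain x y where p: "p = (x, y)" by force
  have "vector_derivative (\<lambda>t. g (x, t)) (at y within {0..1}) =
        vector_derivative (\<lambda>t. h (x, t)) (at y within {0..1})"
    by (rule vector_derivative_cong_eq) (use assms p in \<open>auto simp: eventually_at_filter\<close>)
  then show ?thesis by (simp add: p dy_def)
qed

lemma C_bar_cong:
  assumes "\<And>p. p \<in> Omega_bar \<Longrightarrow> g p = h p" "C_bar k g"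
  shows "C_bar k h"
  using assms
proof (induction k arbitrary: g h)
  case 0
  then show ?case by (simp cong: continuous_on_cong)
next
  case (Suc k)
  have "((\<lambda>t. h (t, y)) has_real_derivative dx g (x, y)) (at x within {0..1})"
    if "x \<in> {0..1}" "y \<in> {0..1}" for x y
    using C_bar_dx[OF Suc.prems(2) that]
    by (rule has_field_derivative_transform_within[where d = 1]) (use that Suc.prems(1) in auto)
  moreover have "((\<lambda>t. h (x, t)) has_real_derivative dy g (x, y)) (at y within {0..1})"
    if "x \<in> {0..1}" "y \<in> {0..1}" for x y
    using C_bar_dy[OF Suc.prems(2) that]
    by (rule has_field_derivative_transform_within[where d = 1]) (use that Suc.prems(1) in auto)
  moreover have "C_bar k (dx h)" "C_bar k (dy h)"
    using Suc.IH[of "dx g" "dx h"] Suc.IH[of "dy g" "dy h"] dx_cong[of g h] dy_cong[of g h]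
      Suc.prems by auto
  moreover have "continuous_on Omega_bar h"
    using Suc.prems by (simp cong: continuous_on_cong)
  ultimately show ?case
    by (intro C_bar_SucI)
qed

text \<open>Both second differences over a small rectangle at \<open>p\<close> equal its area times a mixed
  derivative at some point of it, and the two orders of differencing agree.\<close>

lemma mixed_partials_commute:
  assumes g: "C_bar 2 g" and p: "p \<in> Omega_bar"
  shows "dx (dy g) p = dy (dx g) p"
proof (rule ccontr)
  assume ne: "dx (dy g) p \<noteq> dy (dx g) p"
  define e where "e = \<bar>dx (dy g) p - dy (dx g) p\<bar> / 2"
  have e: "e > 0" using ne by (simp add: e_def)
  have g1: "C_bar (Suc 0) (dx g)" "C_bar (Suc 0) (dy g)" "C_bar (Suc (Suc 0)) g"
    using g by (simp_all add: numeral_2_eq_2)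
  obtain x0 y0 where p0: "p = (x0, y0)" "x0 \<in> {0..1}" "y0 \<in> {0..1}"
    using p by auto
  have "continuous_on Omega_bar (dx (dy g))" "continuous_on Omega_bar (dy (dx g))"
    using g1 by auto
  then have "\<exists>d1>0. \<forall>q\<in>Omega_bar. dist q p < d1 \<longrightarrow> dist (dx (dy g) q) (dx (dy g) p) < e"
    "\<exists>d2>0. \<forall>q\<in>Omega_bar. dist q p < d2 \<longrightarrow> dist (dy (dx g) q) (dy (dx g) p) < e"
    using p e unfolding continuous_on_iff by blast+
  then obtain d1 d2 where d: "d1 > 0" "d2 > 0"
    "\<And>q. q \<in> Omega_bar \<Longrightarrow> dist q p < d1 \<Longrightarrow> dist (dx (dy g) q) (dx (dy g) p) < e"
    "\<And>q. q \<in> Omega_bar \<Longrightarrow> dist q p < d2 \<Longrightarrow> dist (dy (dx g) q) (dy (dx g) p) < e"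
    by blast
  define \<delta> where "\<delta> = min (min d1 d2) 1 / 4"
  have \<delta>: "\<delta> > 0" "4 * \<delta> \<le> d1" "4 * \<delta> \<le> d2" "\<delta> \<le> 1/4" using d by (auto simp: \<delta>_def)
  have I: "\<exists>a b. a < b \<and> {a..b} \<subseteq> {0..1} \<and> {a..b} \<subseteq> {t - \<delta>..t + \<delta>}" if "t \<in> {0..1}" for t :: real
  proof (cases "t \<le> 1/2")
    case True
    then show ?thesis using \<delta> that by (intro exI[of _ t] exI[of _ "t + \<delta>"]) auto
  next
    case False
    then show ?thesis using \<delta> that by (intro exI[of _ "t - \<delta>"] exI[of _ t]) auto
  qed
  obtain a a' where a: "a < a'" "{a..a'} \<subseteq> {0..1}" "{a..a'} \<subseteq> {x0 - \<delta>..x0 + \<delta>}"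
    using I p0 by meson
  obtain b b' where b: "b < b'" "{b..b'} \<subseteq> {0..1}" "{b..b'} \<subseteq> {y0 - \<delta>..y0 + \<delta>}"
    using I p0 by meson
  have near: "dist (s, t) p < 4 * \<delta>" if "s \<in> {a..a'}" "t \<in> {b..b'}" for s t
  proof -
    have "s \<in> {x0 - \<delta>..x0 + \<delta>}" "t \<in> {y0 - \<delta>..y0 + \<delta>}" using that a b by blast+
    then have "dist s x0 \<le> \<delta>" "dist t y0 \<le> \<delta>" by (auto simp: dist_real_def)
    then have "dist (s, t) p \<le> \<delta> + \<delta>"
      unfolding p0 dist_Pair_Pair by (intro order_trans[OF sqrt_sum_squares_le_sum]) auto
    then show ?thesis using \<delta> by simp
  qed
  have ends: "a \<in> {0..1}" "a' \<in> {0..1}" "b \<in> {0..1}" "b' \<in> {0..1}"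
    using a b by auto
  let ?D = "(g (a', b') - g (a', b)) - (g (a, b') - g (a, b))"
  obtain \<xi> where \<xi>: "a < \<xi>" "\<xi> < a'" "?D = (dx g (\<xi>, b') - dx g (\<xi>, b)) * (a' - a)"
  proof (rule MVT_within[of a a' "{0..1}" "\<lambda>t. g (t, b') - g (t, b)"
        "\<lambda>t. dx g (t, b') - dx g (t, b)"])
    fix x assume "x \<in> {a..a'}"
    then have "x \<in> {0..1}" using a by blast
    then show "((\<lambda>t. g (t, b') - g (t, b)) has_real_derivative dx g (x, b') - dx g (x, b))
        (at x within {0..1})"
      using C_bar_dx[OF g1(3)] ends by (intro DERIV_diff) auto
  qed (use a in auto)
  have \<xi>01: "\<xi> \<in> {0..1}" using \<xi> a by (meson atLeastAtMost_iff less_imp_le subsetD)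
  obtain \<eta> where \<eta>: "b < \<eta>" "\<eta> < b'" "dx g (\<xi>, b') - dx g (\<xi>, b) = dy (dx g) (\<xi>, \<eta>) * (b' - b)"
  proof (rule MVT_within[of b b' "{0..1}" "\<lambda>t. dx g (\<xi>, t)" "\<lambda>t. dy (dx g) (\<xi>, t)"])
    fix y assume "y \<in> {b..b'}"
    then have "y \<in> {0..1}" using b by blast
    then show "((\<lambda>t. dx g (\<xi>, t)) has_real_derivative dy (dx g) (\<xi>, y)) (at y within {0..1})"
      using C_bar_dy[OF g1(1)] \<xi>01 by auto
  qed (use b in auto)
  obtain \<eta>' where \<eta>': "b < \<eta>'" "\<eta>' < b'" "?D = (dy g (a', \<eta>') - dy g (a, \<eta>')) * (b' - b)"
  proof (rule MVT_within[of b b' "{0..1}" "\<lambda>t. g (a', t) - g (a, t)"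
        "\<lambda>t. dy g (a', t) - dy g (a, t)"])
    fix y assume "y \<in> {b..b'}"
    then have "y \<in> {0..1}" using b by blast
    then show "((\<lambda>t. g (a', t) - g (a, t)) has_real_derivative dy g (a', y) - dy g (a, y))
        (at y within {0..1})"
      using C_bar_dy[OF g1(3)] ends by (intro DERIV_diff) auto
  qed (use b in \<open>auto simp: algebra_simps\<close>)
  have \<eta>'01: "\<eta>' \<in> {0..1}" using \<eta>' b by (meson atLeastAtMost_iff less_imp_le subsetD)
  obtain \<xi>' where \<xi>': "a < \<xi>'" "\<xi>' < a'" "dy g (a', \<eta>') - dy g (a, \<eta>') = dx (dy g) (\<xi>', \<eta>') * (a' - a)"
  proof (rule MVT_within[of a a' "{0..1}" "\<lambda>t. dy g (t, \<eta>')" "\<lambda>t. dx (dy g) (t, \<eta>')"])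
    fix x assume "x \<in> {a..a'}"
    then have "x \<in> {0..1}" using a by blast
    then show "((\<lambda>t. dy g (t, \<eta>')) has_real_derivative dx (dy g) (x, \<eta>')) (at x within {0..1})"
      using C_bar_dx[OF g1(2)] \<eta>'01 by auto
  qed (use a in auto)
  have "dy (dx g) (\<xi>, \<eta>) = dx (dy g) (\<xi>', \<eta>')"
    using \<xi>(3) \<eta>(3) \<eta>'(3) \<xi>'(3) a(1) b(1) by simp
  moreover have "dist (\<xi>, \<eta>) p < 4 * \<delta>" "dist (\<xi>', \<eta>') p < 4 * \<delta>"
    using near \<xi> \<eta> \<xi>' \<eta>' by auto
  moreover have "(\<xi>, \<eta>) \<in> Omega_bar" "(\<xi>', \<eta>') \<in> Omega_bar"
    using \<xi> \<eta> \<xi>' \<eta>' a b ends by auto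
  ultimately have "dist (dx (dy g) (\<xi>', \<eta>')) (dx (dy g) p) < e"
      "dist (dx (dy g) (\<xi>', \<eta>')) (dy (dx g) p) < e"
    using d(3)[of "(\<xi>', \<eta>')"] d(4)[of "(\<xi>, \<eta>)"] \<delta> by auto
  moreover have "\<bar>s - t\<bar> \<le> \<bar>a - s\<bar> + \<bar>a - t\<bar>" for a s t :: real by arith
  ultimately show False
    unfolding e_def dist_real_def by (smt (verit, best) field_sum_of_halves)
qed

lemma C_bar_Suc_imp: "C_bar (Suc k) g \<Longrightarrow> C_bar k g"
proof (induction k arbitrary: g)
  case (Suc k)
  note g = Suc.prems[unfolded C_bar.simps(2)[of "Suc k" g]]
  then have "C_bar k (dx g)" "C_bar k (dy g)" using Suc.IH[of "dx g"] Suc.IH[of "dy g"] by blast+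
  with g show ?case unfolding C_bar.simps(2)[of k g] by blast
qed simp

lemma C_bar_partials: "C_bar (Suc k) g \<Longrightarrow> C_bar k (dx g)" "C_bar (Suc k) g \<Longrightarrow> C_bar k (dy g)"
  unfolding C_bar.simps(2)[of k] by blast+

lemma C_bar_4: "C_bar 4 g \<longleftrightarrow> C_bar (Suc (Suc (Suc (Suc 0)))) g"
proof -
  have "4 = Suc (Suc (Suc (Suc 0)))" by simp
  then show ?thesis by metis
qed

lemma C_bar_4_imp:
  assumes "C_bar 4 g"
  shows "C_bar (Suc 0) g" "C_bar (Suc 0) (dx g)" "C_bar (Suc 0) (dy g)"
proof -
  have g: "C_bar (Suc (Suc 0)) g"
    using assms unfolding C_bar_4 by (rule C_bar_Suc_imp[OF C_bar_Suc_imp])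
  then show "C_bar (Suc 0) g" "C_bar (Suc 0) (dx g)" "C_bar (Suc 0) (dy g)"
    by (rule C_bar_Suc_imp, rule C_bar_partials, rule C_bar_partials)
qed

section \<open>Smooth bumps\<close>

text \<open>Functions of one variable of class \<open>C^k\<close>. Asking for derivatives on the whole line makes
  products and affine substitutions work by induction on \<open>k\<close>.\<close>

fun C_line :: "nat \<Rightarrow> (real \<Rightarrow> real) \<Rightarrow> bool" where
  "C_line 0 f \<longleftrightarrow> continuous_on UNIV f"
| "C_line (Suc k) f \<longleftrightarrow> (\<exists>f'. (\<forall>t. (f has_real_derivative f' t) (at t)) \<and> C_line k f')"

lemma C_line_SucI:
  "(\<And>t. (f has_real_derivative f' t) (at t)) \<Longrightarrow> C_line k f' \<Longrightarrow> C_line (Suc k) f"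
  by auto

lemma C_line_continuous: "C_line k f \<Longrightarrow> continuous_on UNIV f"
  by (cases k) (auto intro: DERIV_isCont simp: continuous_on_eq_continuous_at)

lemma C_line_Suc_imp: "C_line (Suc k) f \<Longrightarrow> C_line k f"
proof (induction k arbitrary: f)
  case 0
  then show ?case using C_line_continuous[OF 0] by simp
next
  case (Suc k)
  then obtain f' where "\<forall>t. (f has_real_derivative f' t) (at t)" "C_line (Suc k) f'"
    by (subst (asm) C_line.simps(2)) blast
  then show ?case using Suc.IH by (subst C_line.simps(2)) blast
qed

lemma C_line_add: "C_line k f \<Longrightarrow> C_line k g \<Longrightarrow> C_line k (\<lambda>t. f t + g t)"
proof (induction k arbitrary: f g)
  case (Suc k)
  obtain f' g' where "\<forall>t. (f has_real_derivative f' t) (at t)" "C_line k f'"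
    "\<forall>t. (g has_real_derivative g' t) (at t)" "C_line k g'"
    using Suc.prems by auto
  then show ?case
    using Suc.IH[of f' g'] by (auto intro!: exI[of _ "\<lambda>t. f' t + g' t"] DERIV_add)
qed (auto intro: continuous_on_add)

lemma C_line_mult: "C_line k f \<Longrightarrow> C_line k g \<Longrightarrow> C_line k (\<lambda>t. f t * g t)"
proof (induction k arbitrary: f g)
  case (Suc k)
  obtain f' g' where fg: "\<forall>t. (f has_real_derivative f' t) (at t)" "C_line k f'"
    "\<forall>t. (g has_real_derivative g' t) (at t)" "C_line k g'"
    using Suc.prems by auto
  have "C_line k (\<lambda>t. f' t * g t + g' t * f t)"
    using Suc.IH C_line_Suc_imp[OF Suc.prems(1)] C_line_Suc_imp[OF Suc.prems(2)] fg
    by (intro C_line_add) auto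
  moreover have "((\<lambda>t. f t * g t) has_real_derivative f' t * g t + g' t * f t) (at t)" for t
    using fg by (intro DERIV_mult) auto
  ultimately show ?case by (intro C_line_SucI)
qed (auto intro: continuous_on_mult)

lemma C_line_const: "C_line k (\<lambda>t. r)"
proof (induction k arbitrary: r)
  case (Suc k)
  then show ?case by (auto intro!: exI[of _ "\<lambda>t. 0"])
qed auto

lemma C_line_affine: "C_line k f \<Longrightarrow> C_line k (\<lambda>t. f (m * t + q))"
proof (induction k arbitrary: f)
  case 0
  then have "continuous_on UNIV f" by simp
  then have "continuous_on UNIV (\<lambda>t. f (m * t + q))"
    by (rule continuous_on_compose2) (intro continuous_intros, simp)
  then show ?case by simp
next
  case (Suc k)
  then obtain f' where f': "\<forall>t. (f has_real_derivative f' t) (at t)" "C_line k f'"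
    by auto
  have "((\<lambda>t. f (m * t + q)) has_real_derivative f' (m * t + q) * m) (at t)" for t
    by (rule DERIV_chain2[of f]) (use f' in \<open>auto intro!: derivative_eq_intros\<close>)
  moreover have "C_line k (\<lambda>t. f' (m * t + q) * m)"
    using Suc.IH[OF f'(2)] by (intro C_line_mult C_line_const)
  ultimately show ?case by (intro C_line_SucI)
qed

lemma C_bar_tensor:
  "C_line k X \<Longrightarrow> C_line k Y \<Longrightarrow> C_bar k (\<lambda>(x, y). X x * Y y)"
proof (induction k arbitrary: X Y)
  case 0
  then have "continuous_on (fst ` Omega_bar) X" "continuous_on (snd ` Omega_bar) Y"
    by (auto intro: continuous_on_subset)
  then have "continuous_on Omega_bar (\<lambda>p. X (fst p))" "continuous_on Omega_bar (\<lambda>p. Y (snd p))"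
    by (auto intro: continuous_on_compose2[OF _ continuous_on_fst] continuous_on_compose2[OF _ continuous_on_snd]
      continuous_on_id)
  then show ?case by (simp add: case_prod_unfold continuous_on_mult)
next
  case (Suc k)
  obtain X' Y' where XY: "\<forall>t. (X has_real_derivative X' t) (at t)" "C_line k X'"
    "\<forall>t. (Y has_real_derivative Y' t) (at t)" "C_line k Y'"
    using Suc.prems by auto
  let ?g = "\<lambda>(x, y). X x * Y y"
  have 1: "((\<lambda>t. ?g (t, y)) has_real_derivative X' x * Y y) (at x within {0..1})" for x y
    using DERIV_cmult_right[of X "X' x" x UNIV "Y y"] XY(1) by (auto intro: has_field_derivative_at_within)
  have 2: "((\<lambda>t. ?g (x, t)) has_real_derivative X x * Y' y) (at y within {0..1})" for x y
    using DERIV_cmult[of Y "Y' y" y UNIV "X x"] XY(3) by (auto intro: has_field_derivative_at_within)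
  have C: "C_line k X" "C_line k Y"
    using Suc.prems by (auto intro: C_line_Suc_imp simp del: C_line.simps)
  have x: "C_bar k (dx ?g)"
    by (rule C_bar_cong[OF _ Suc.IH[OF XY(2) C(2)]]) (use dx_eqI[OF _ 1] in auto)
  have y: "C_bar k (dy ?g)"
    by (rule C_bar_cong[OF _ Suc.IH[OF C(1) XY(4)]]) (use dy_eqI[OF _ 2] in auto)
  have "continuous_on Omega_bar ?g"
    using Suc.IH[OF C] C_bar_continuous by blast
  then show ?case
    using 1 2 x y by (intro C_bar_SucI[where gx = "\<lambda>(x, y). X' x * Y y" and gy = "\<lambda>(x, y). X x * Y' y"]) auto
qed

text \<open>For \<open>P = 1\<close> this is Cauchy's flat function \<open>exp (- 1 / t)\<close>. The factor \<open>P (1 / t)\<close> makes the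
  family closed under differentiation, so that smoothness is an induction over the family.\<close>

definition flat :: "real poly \<Rightarrow> real \<Rightarrow> real" where
  "flat P t = (if t > 0 then poly P (1 / t) * exp (- 1 / t) else 0)"

lemma poly_mult_exp_tendsto_0: "((\<lambda>s::real. poly Q s * exp (- s)) \<longlongrightarrow> 0) at_top"
proof -
  have "((\<lambda>s. \<Sum>i\<le>degree Q. coeff Q i * (s ^ i / exp s)) \<longlongrightarrow> (\<Sum>i\<le>degree Q. coeff Q i * 0)) at_top"
    by (intro tendsto_sum tendsto_mult tendsto_const tendsto_power_div_exp_0)
  then show ?thesis
    by (simp add: poly_altdef exp_minus divide_inverse sum_distrib_right mult.assoc)
qed

lemma flat_tendsto_0: "((\<lambda>t. flat P t) \<longlongrightarrow> 0) (at_right 0)"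
proof -
  have "((\<lambda>t. poly P (inverse t) * exp (- inverse t)) \<longlongrightarrow> 0) (at_right (0::real))"
    by (rule filterlim_compose[OF poly_mult_exp_tendsto_0 filterlim_inverse_at_top_right])
  then show ?thesis
    by (rule Lim_transform_eventually)
      (auto simp: flat_def eventually_at_right_less inverse_eq_divide intro!: eventually_at_rightI[of 0 1])
qed

lemma flat_has_derivative:
  "(flat P has_real_derivative flat (pCons 0 (pCons 0 (P - pderiv P))) t) (at t)"
proof (cases t "0 :: real" rule: linorder_cases)
  case less
  have "(flat P has_real_derivative 0) (at t)"
    by (rule has_field_derivative_transform_within_open[where S = "{..<0}" and f = "\<lambda>_. 0"])
      (use less in \<open>auto simp: flat_def\<close>)
  then show ?thesis using less by (simp add: flat_def)
next
  case greater
  have "((\<lambda>t. poly P (1 / t) * exp (- 1 / t)) has_real_derivative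
      poly (pderiv P) (1 / t) * (- 1 / t\<^sup>2) * exp (- 1 / t) + exp (- 1 / t) * (1 / t\<^sup>2) * poly P (1 / t)) (at t)"
    using greater
    by (auto intro!: derivative_eq_intros DERIV_chain2[OF poly_DERIV] simp: power2_eq_square divide_simps)
  also have "poly (pderiv P) (1 / t) * (- 1 / t\<^sup>2) * exp (- 1 / t) + exp (- 1 / t) * (1 / t\<^sup>2) * poly P (1 / t)
      = flat (pCons 0 (pCons 0 (P - pderiv P))) t"
    using greater by (simp add: flat_def power2_eq_square field_simps)
  finally show ?thesis
    by (rule has_field_derivative_transform_within_open[where S = "{0<..}"])
      (use greater in \<open>auto simp: flat_def\<close>)
next
  case equal
  have "((\<lambda>t. (flat P t - flat P 0) / (t - 0)) \<longlongrightarrow> 0) (at_right 0)"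
    by (rule Lim_transform_eventually[OF flat_tendsto_0[of "pCons 0 P"]])
      (auto simp: flat_def intro!: eventually_at_rightI[of 0 1])
  moreover have "((\<lambda>t. (flat P t - flat P 0) / (t - 0)) \<longlongrightarrow> 0) (at_left 0)"
    by (rule Lim_transform_eventually[OF tendsto_const])
      (auto simp: flat_def intro!: eventually_at_leftI[of "-1" 0])
  ultimately have "(flat P has_real_derivative 0) (at 0)"
    unfolding has_field_derivative_iff by (simp add: filterlim_split_at)
  then show ?thesis using equal by (simp add: flat_def)
qed

lemma C_line_flat: "C_line k (flat P)"
proof (induction k arbitrary: P)
  case 0
  show ?case
    using DERIV_isCont[OF flat_has_derivative] by (simp add: continuous_on_eq_continuous_at)
next
  case (Suc k)
  then show ?case using flat_has_derivative by (intro C_line_SucI)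
qed

text \<open>The parameter \<open>n\<close> does two things at once: the shift by \<open>- 1\<close> keeps the support a distance \<open>1 / n\<close>
  inside \<open>(a, b)\<close>, which makes it compact in the open square even when \<open>a\<close> or \<open>b\<close> lies on the boundary,
  and the factor \<open>n\<close> drives the values to \<open>1\<close>.\<close>

definition bump :: "real \<Rightarrow> real \<Rightarrow> nat \<Rightarrow> real \<Rightarrow> real" where
  "bump a b n t = flat 1 (n * (t - a) - 1) * flat 1 (n * (b - t) - 1)"

lemma C_line_bump: "C_line k (bump a b n)"
proof -
  have "C_line k (\<lambda>t. flat 1 (real n * t + (- real n * a - 1)) * flat 1 (- real n * t + (real n * b - 1)))"
    by (intro C_line_mult C_line_affine C_line_flat)
  then show ?thesis
    unfolding bump_def by (simp add: algebra_simps)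
qed

lemma flat_1_bounds: "0 \<le> flat 1 t" "flat 1 t \<le> 1"
  by (auto simp: flat_def)

lemma bump_bounds: "0 \<le> bump a b n t" "bump a b n t \<le> 1"
  by (auto simp: bump_def flat_1_bounds mult_le_one)

lemma bump_outside:
  assumes "n > 0" "t \<notin> {a + 1 / n..b - 1 / n}"
  shows "bump a b n t = 0"
  using assms by (auto simp: bump_def flat_def field_simps)

lemma bump_pos:
  assumes "n > 0" "a + 1 / n < t" "t < b - 1 / n"
  shows "bump a b n t > 0"
  using assms by (auto simp: bump_def flat_def field_simps)

lemma flat_tendsto_indicator: "(\<lambda>n. flat 1 (real n * t - 1)) \<longlonglongrightarrow> indicator {0<..} t"
proof (cases "t > 0")
  case True
  have lin: "filterlim (\<lambda>n. real n * t - 1) at_top sequentially"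
    using True filterlim_tendsto_add_at_top[OF tendsto_const[of "-1"]
      filterlim_tendsto_pos_mult_at_top[OF tendsto_const True filterlim_real_sequentially]]
    by (simp add: mult.commute)
  then have "(\<lambda>n. exp (- 1 / (real n * t - 1))) \<longlonglongrightarrow> exp 0"
    by (intro tendsto_exp real_tendsto_divide_at_top[OF tendsto_const])
  moreover have "\<forall>\<^sub>F n in sequentially. real n * t - 1 > 0"
    using lin unfolding filterlim_at_top_dense by blast
  ultimately have "(\<lambda>n. flat 1 (real n * t - 1)) \<longlonglongrightarrow> exp 0"
    by (elim Lim_transform_eventually) (auto simp: flat_def elim!: eventually_mono)
  then show ?thesis using True by simp
next
  case False
  then have "real n * t - 1 \<le> 0" for n
    by (smt (verit) mult_nonneg_nonpos of_nat_0_le_iff)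
  then have "flat 1 (real n * t - 1) = 0" for n
    unfolding flat_def by (simp add: not_less)
  then show ?thesis using False by simp
qed

lemma bump_tendsto_indicator: "(\<lambda>n. bump a b n t) \<longlonglongrightarrow> indicator {a<..<b} t"
proof -
  have "(\<lambda>n. bump a b n t) \<longlonglongrightarrow> indicator {0<..} (t - a) * indicator {0<..} (b - t)"
    unfolding bump_def by (intro tendsto_mult flat_tendsto_indicator)
  also have "indicator {0<..} (t - a) * indicator {0<..} (b - t) = (indicator {a<..<b} t :: real)"
    by (simp add: indicator_def)
  finally show ?thesis .
qed

lemma test_function_bump:
  assumes "{a..b} \<subseteq> {0..1}" "{c..d} \<subseteq> {0..1}" "n > 0" "m > 0" "a \<le> b" "c \<le> d"
  shows "test_function (\<lambda>(x, y). bump a b n x * bump c d m y)"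
  unfolding test_function_def
proof (intro conjI allI exI)
  let ?K = "{a + 1 / n..b - 1 / n} \<times> {c + 1 / m..d - 1 / m}"
  show "compact ?K" by (intro compact_Times compact_Icc)
  have *: "{a + 1 / n..b - 1 / n} \<subseteq> {0<..<1}" if "{a..b} \<subseteq> {0..1}" "a \<le> b" "n > 0" for a b :: real and n :: nat
  proof
    fix t assume t: "t \<in> {a + 1 / n..b - 1 / n}"
    have "a \<in> {0..1}" "b \<in> {0..1}" using that by auto
    moreover have "1 / real n > 0" using \<open>n > 0\<close> by simp
    ultimately show "t \<in> {0<..<1}" using t unfolding atLeastAtMost_iff greaterThanLessThan_iff by linarith
  qed
  show "?K \<subseteq> Omega"
    using *[of a b n] *[of c d m] assms by blast
  show "p \<notin> ?K \<longrightarrow> (case p of (x, y) \<Rightarrow> bump a b n x * bump c d m y) = 0" for p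
    using bump_outside[OF \<open>n > 0\<close>] bump_outside[OF \<open>m > 0\<close>] by (cases p) fastforce
qed (intro C_bar_tensor C_line_bump)

section \<open>Square-integrable functions on the unit square\<close>

lemma rectangle_box: "{a<..<b} \<times> {c<..<d} = box (a, c) (b, d)" for a b c d :: real
  by (auto simp: box_def Basis_prod_def)

lemma Omega_box: "Omega = box (0, 0) (1, 1)"
  by (rule rectangle_box)

lemma Omega_bar_cbox: "Omega_bar = cbox (0, 0) (1, 1)"
  by (auto simp: cbox_Pair_eq)

lemma Omega_sets [measurable, simp]: "Omega \<in> sets lebesgue"
  by (simp add: Omega_box lmeasurable_box fmeasurableD)

lemma finite_measure_Omega: "finite_measure (lebesgue_on Omega)"
  by (rule finite_measure_lebesgue_on) (simp add: Omega_box)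

lemma continuous_imp_measurable_Omega:
  fixes g :: "real \<times> real \<Rightarrow> 'a::euclidean_space"
  assumes "continuous_on Omega_bar g"
  shows "g \<in> borel_measurable (lebesgue_on Omega)"
  by (rule continuous_imp_measurable_on_sets_lebesgue)
    (use assms in \<open>auto intro: continuous_on_subset\<close>)

lemma bounded_imp_integrable_Omega:
  fixes g :: "real \<times> real \<Rightarrow> 'a::euclidean_space"
  assumes "g \<in> borel_measurable (lebesgue_on Omega)"
    and "\<And>p. p \<in> Omega \<Longrightarrow> norm (g p) \<le> B"
  shows "integrable (lebesgue_on Omega) g"
  using finite_measure.integrable_const_bound[OF finite_measure_Omega _ assms(1), of B] assms(2)
  by (simp add: AE_restrict_space_iff)

lemma bounded_imp_L2:
  fixes g :: "real \<times> real \<Rightarrow> 'a::euclidean_space"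
  assumes [measurable]: "g \<in> borel_measurable (lebesgue_on Omega)"
    and "\<And>p. p \<in> Omega \<Longrightarrow> norm (g p) \<le> B"
  shows "L2 g"
  unfolding L2_def
proof
  show "integrable (lebesgue_on Omega) (\<lambda>p. (norm (g p))\<^sup>2)"
    by (rule bounded_imp_integrable_Omega[where B = "B\<^sup>2"]) (use assms in \<open>auto intro: power_mono\<close>)
qed (fact assms)

lemma continuous_imp_bounded_Omega:
  fixes g :: "real \<times> real \<Rightarrow> 'a::euclidean_space"
  assumes "continuous_on Omega_bar g"
  obtains B where "\<And>p. p \<in> Omega_bar \<Longrightarrow> norm (g p) \<le> B"
proof -
  have "compact (g ` Omega_bar)"
    by (rule compact_continuous_image[OF assms]) (simp add: Omega_bar_cbox)
  then show ?thesis
    using that compact_imp_bounded[of "g ` Omega_bar"] unfolding bounded_iff by auto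
qed

lemma continuous_imp_L2:
  fixes g :: "real \<times> real \<Rightarrow> 'a::euclidean_space"
  assumes "continuous_on Omega_bar g"
  shows "L2 g"
proof -
  obtain B where "\<And>p. p \<in> Omega_bar \<Longrightarrow> norm (g p) \<le> B"
    using continuous_imp_bounded_Omega[OF assms] by blast
  then show ?thesis
    using continuous_imp_measurable_Omega[OF assms] by (intro bounded_imp_L2[of _ B]) auto
qed

lemma L2_integrable_inner:
  assumes "L2 g" "L2 h"
  shows "integrable (lebesgue_on Omega) (\<lambda>p. g p \<bullet> h p)"
proof (rule Bochner_Integration.integrable_bound)
  show "integrable (lebesgue_on Omega) (\<lambda>p. (norm (g p))\<^sup>2 + (norm (h p))\<^sup>2)"
    using assms by (auto simp: L2_def)
  show "(\<lambda>p. g p \<bullet> h p) \<in> borel_measurable (lebesgue_on Omega)"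
    using assms by (auto simp: L2_def)
  have "\<bar>g p \<bullet> h p\<bar> \<le> (norm (g p))\<^sup>2 + (norm (h p))\<^sup>2" for p
  proof -
    have "0 \<le> norm (g p) * norm (h p)" by simp
    then have "norm (g p) * norm (h p) \<le> (norm (g p))\<^sup>2 + (norm (h p))\<^sup>2"
      using sum_squares_bound[of "norm (g p)" "norm (h p)"] by linarith
    then show ?thesis using Cauchy_Schwarz_ineq2[of "g p" "h p"] by linarith
  qed
  then show "AE p in lebesgue_on Omega. norm (g p \<bullet> h p) \<le> norm ((norm (g p))\<^sup>2 + (norm (h p))\<^sup>2)"
    by simp
qed

lemma L2_add:
  assumes "L2 g" "L2 h"
  shows "L2 (\<lambda>p. g p + h p)"
  unfolding L2_def
proof
  show "(\<lambda>p. g p + h p) \<in> borel_measurable (lebesgue_on Omega)"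
    using assms by (auto simp: L2_def)
  have "(\<lambda>p. (norm (g p + h p))\<^sup>2) = (\<lambda>p. g p \<bullet> g p + 2 * (g p \<bullet> h p) + h p \<bullet> h p)"
    by (simp add: power2_norm_eq_inner algebra_simps inner_commute)
  then show "integrable (lebesgue_on Omega) (\<lambda>p. (norm (g p + h p))\<^sup>2)"
    using L2_integrable_inner[OF assms(1) assms(1)] L2_integrable_inner[OF assms]
      L2_integrable_inner[OF assms(2) assms(2)] by auto
qed

lemma L2_scaleR: "L2 g \<Longrightarrow> L2 (\<lambda>p. k *\<^sub>R g p)"
  by (auto simp: L2_def power_mult_distrib)

lemma L2_diff: "L2 g \<Longrightarrow> L2 h \<Longrightarrow> L2 (\<lambda>p. g p - h p)"
  using L2_add[of g "\<lambda>p. (-1) *\<^sub>R h p"] L2_scaleR[of h "-1"] by simp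

lemma L2_mult: "L2 g \<Longrightarrow> L2 (\<lambda>p. k * g p :: real)"
  using L2_scaleR[of g k] by simp

lemma L2_uminus: "L2 g \<Longrightarrow> L2 (\<lambda>p. - g p)"
  using L2_scaleR[of g "-1"] by simp

lemma L2_imp_integrable:
  fixes g :: "real \<times> real \<Rightarrow> real"
  assumes "L2 g"
  shows "integrable (lebesgue_on Omega) g"
  using L2_integrable_inner[OF assms continuous_imp_L2[of "\<lambda>_. 1"]] by simp

lemma L2_inner_commute: "L2_inner g h = L2_inner h g"
  by (simp add: L2_inner_def inner_commute)

lemma L2_inner_add_left:
  "L2 g \<Longrightarrow> L2 g' \<Longrightarrow> L2 h \<Longrightarrow> L2_inner (\<lambda>p. g p + g' p) h = L2_inner g h + L2_inner g' h"
  by (simp add: L2_inner_def inner_add_left L2_integrable_inner)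

lemma L2_inner_diff_left:
  "L2 g \<Longrightarrow> L2 g' \<Longrightarrow> L2 h \<Longrightarrow> L2_inner (\<lambda>p. g p - g' p) h = L2_inner g h - L2_inner g' h"
  by (simp add: L2_inner_def inner_diff_left L2_integrable_inner)

lemma L2_inner_diff_right:
  "L2 g \<Longrightarrow> L2 h \<Longrightarrow> L2 h' \<Longrightarrow> L2_inner g (\<lambda>p. h p - h' p) = L2_inner g h - L2_inner g h'"
  by (simp add: L2_inner_def inner_diff_right L2_integrable_inner)

lemma L2_inner_add_right:
  "L2 g \<Longrightarrow> L2 h \<Longrightarrow> L2 h' \<Longrightarrow> L2_inner g (\<lambda>p. h p + h' p) = L2_inner g h + L2_inner g h'"
  by (simp add: L2_inner_def inner_add_right L2_integrable_inner)

lemma L2_inner_mult_right: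
  fixes g :: "real \<times> real \<Rightarrow> real"
  shows "L2_inner h (\<lambda>p. k * g p) = k * L2_inner h g"
  by (simp add: L2_inner_def mult.assoc mult.left_commute)

lemma L2_inner_mult_left:
  fixes g :: "real \<times> real \<Rightarrow> real"
  shows "L2_inner (\<lambda>p. k * g p) h = k * L2_inner g h"
  by (simp add: L2_inner_def mult.assoc mult.left_commute)

lemma L2_inner_uminus_left: "L2_inner (\<lambda>p. - g p) h = - L2_inner g h"
  by (simp add: L2_inner_def)

lemma L2_inner_self_nonneg: "0 \<le> L2_inner g g"
  by (simp add: L2_inner_def)

lemma L2_inner_cong_AE:
  assumes "AE p in lebesgue_on Omega. g p = g' p" "L2 g" "L2 g'" "L2 h"
  shows "L2_inner g h = L2_inner g' h"
  unfolding L2_inner_def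
  by (rule integral_cong_AE) (use assms L2_integrable_inner in \<open>auto dest: borel_measurable_integrable\<close>)

lemma L2_inner_cong_Omega:
  assumes "\<And>p. p \<in> Omega \<Longrightarrow> g p = g' p" "\<And>p. p \<in> Omega \<Longrightarrow> h p = h' p"
  shows "L2_inner g h = L2_inner g' h'"
  unfolding L2_inner_def by (rule Bochner_Integration.integral_cong) (use assms in auto)

section \<open>The fundamental lemma of the calculus of variations\<close>

text \<open>Boxes form an intersection-stable generator of the Borel sets, so the integrals over all Borel
  sets vanish by Dynkin's lemma; Lebesgue sets differ from Borel sets by null sets.\<close>

lemma AE_zero_if_box_integrals_zero:
  fixes h :: "'a::euclidean_space \<Rightarrow> real"
  assumes h: "integrable lebesgue h"
    and box: "\<And>l u. set_lebesgue_integral lebesgue (box l u) h = 0"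
    and total: "integral\<^sup>L lebesgue h = 0"
  shows "AE x in lebesgue. h x = 0"
proof -
  have si: "set_integrable lebesgue A h" if "A \<in> sets lebesgue" for A
    unfolding set_integrable_def using integrable_mult_indicator[OF that h] .
  have borel: "set_lebesgue_integral lebesgue A h = 0" if "A \<in> sets borel" for A
  proof -
    have "A \<in> sigma_sets UNIV (range (\<lambda>(a, b). box a b :: 'a set))"
      using that by (simp add: borel_eq_box)
    have meas: "B \<in> sets lebesgue" if "B \<in> sigma_sets UNIV (range (\<lambda>(a, b). box a b :: 'a set))" for B
    proof -
      have "B \<in> sets borel" using that by (subst borel_eq_box) simp
      then show ?thesis by simp
    qed
    have stable: "Int_stable (range (\<lambda>(a, b). box a b :: 'a set))"
      "range (\<lambda>(a, b). box a b :: 'a set) \<subseteq> Pow UNIV"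
      by (auto simp: Int_stable_def box_Int_box)
    from stable \<open>A \<in> sigma_sets UNIV _\<close> show ?thesis
    proof (induction rule: sigma_sets_induct_disjoint)
      case (basic A)
      then show ?case using box by auto
    next
      case (compl A)
      then have A: "A \<in> sets lebesgue" by (intro meas)
      have "set_lebesgue_integral lebesgue (UNIV - A) h
          = set_lebesgue_integral lebesgue UNIV h - set_lebesgue_integral lebesgue A h"
      proof -
        have "indicator (UNIV - A) x *\<^sub>R h x = indicator UNIV x *\<^sub>R h x - indicator A x *\<^sub>R h x" for x
          by (simp add: indicator_def)
        then show ?thesis
          using si[OF A] si[of UNIV] by (simp add: set_lebesgue_integral_def set_integrable_def)
      qed
      then show ?case using compl total by (simp add: set_lebesgue_integral_def)
    next
      case (union A)
      then have A: "A i \<in> sets lebesgue" for i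
        using union(2) by (intro meas) auto
      then have "set_lebesgue_integral lebesgue (\<Union>i. A i) h = (\<Sum>i. set_lebesgue_integral lebesgue (A i) h)"
        using union by (intro lebesgue_integral_countable_add si sets.countable_UN')
          (auto simp: disjoint_family_on_def)
      then show ?case using union by simp
    qed (auto simp: set_lebesgue_integral_def)
  qed
  have "set_lebesgue_integral lebesgue A h = 0" if A: "A \<in> sets lebesgue" for A
  proof -
    obtain S N N' where S: "A = S \<union> N" "N \<subseteq> N'" "N' \<in> null_sets lborel" "S \<in> sets lborel"
      using sets_completionE[OF A] .
    have "N' \<in> null_sets lebesgue" using S(3) by (simp add: null_sets_completionI)
    then have "AE x in lebesgue. x \<notin> N'" by (rule AE_not_in)
    then have "AE x in lebesgue. indicator A x *\<^sub>R h x = indicator S x *\<^sub>R h x"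
      by eventually_elim (use S in \<open>auto simp: indicator_def\<close>)
    then have "set_lebesgue_integral lebesgue A h = set_lebesgue_integral lebesgue S h"
      unfolding set_lebesgue_integral_def
      using si[OF A] si[of S] S
      by (intro integral_cong_AE) (auto simp: set_integrable_def dest: borel_measurable_integrable)
    then show ?thesis using borel[of S] S by simp
  qed
  then show ?thesis
    using density_unique_real[OF h integrable_zero] by (simp add: set_lebesgue_integral_def)
qed

lemma integral_rectangle_zero_if_bumps_zero:
  fixes g :: "real \<times> real \<Rightarrow> real"
  assumes g: "integrable (lebesgue_on Omega) g"
    and zero: "\<And>n. n > 0 \<Longrightarrow>
      integral\<^sup>L (lebesgue_on Omega) (\<lambda>(x, y). g (x, y) * (bump a b n x * bump c d n y)) = 0"
  shows "integral\<^sup>L (lebesgue_on Omega) (\<lambda>p. g p * indicator ({a<..<b} \<times> {c<..<d}) p) = 0"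
proof -
  let ?M = "lebesgue_on Omega"
  let ?b = "\<lambda>n p. bump a b n (fst p) * bump c d n (snd p)"
  have "(\<lambda>n. integral\<^sup>L ?M (\<lambda>p. g p * ?b (Suc n) p))
      \<longlonglongrightarrow> integral\<^sup>L ?M (\<lambda>p. g p * indicator ({a<..<b} \<times> {c<..<d}) p)"
  proof (rule integral_dominated_convergence[where w = "\<lambda>p. \<bar>g p\<bar>"])
    show "(\<lambda>p. g p * indicator ({a<..<b} \<times> {c<..<d}) p) \<in> borel_measurable ?M"
    proof -
      have "{a<..<b} \<times> {c<..<d} \<in> sets lebesgue" by (simp add: rectangle_box fmeasurableD)
      then have "indicator ({a<..<b} \<times> {c<..<d}) \<in> borel_measurable ?M"
        by (intro measurable_restrict_space1 borel_measurable_indicator)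
      then show ?thesis using g by (intro borel_measurable_times) auto
    qed
    show "(\<lambda>p. g p * ?b (Suc n) p) \<in> borel_measurable ?M" for n
    proof -
      have "continuous_on UNIV (bump a b (Suc n))" "continuous_on UNIV (bump c d (Suc n))"
        using C_line_bump[of 0] by auto
      then have "continuous_on Omega_bar (\<lambda>p. bump a b (Suc n) (fst p))"
          "continuous_on Omega_bar (\<lambda>p. bump c d (Suc n) (snd p))"
        by (auto intro: continuous_on_compose2[OF _ continuous_on_fst]
            continuous_on_compose2[OF _ continuous_on_snd] continuous_on_id)
      then have "?b (Suc n) \<in> borel_measurable ?M"
        by (intro continuous_imp_measurable_Omega continuous_on_mult)
      then show ?thesis using borel_measurable_times[OF borel_measurable_integrable[OF g]] by blast
    qed
    show "integrable ?M (\<lambda>p. \<bar>g p\<bar>)" using g by simp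
    have "(\<lambda>n. g p * ?b (Suc n) p) \<longlonglongrightarrow> g p * indicator ({a<..<b} \<times> {c<..<d}) p" for p
    proof -
      have "(\<lambda>n. ?b (Suc n) p) \<longlonglongrightarrow> indicator {a<..<b} (fst p) * indicator {c<..<d} (snd p)"
        by (intro tendsto_mult LIMSEQ_Suc[OF bump_tendsto_indicator])
      also have "indicator {a<..<b} (fst p) * indicator {c<..<d} (snd p)
          = (indicator ({a<..<b} \<times> {c<..<d}) p :: real)"
        by (cases p) (simp add: indicator_times)
      finally show ?thesis by (intro tendsto_mult tendsto_const)
    qed
    then show "AE p in ?M. (\<lambda>n. g p * ?b (Suc n) p)
        \<longlonglongrightarrow> g p * indicator ({a<..<b} \<times> {c<..<d}) p" by simp
    have "norm (g p * ?b (Suc n) p) \<le> \<bar>g p\<bar>" for p n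
    proof -
      have "0 \<le> ?b (Suc n) p" "?b (Suc n) p \<le> 1"
        by (intro mult_nonneg_nonneg bump_bounds, intro mult_le_one bump_bounds)
      then have "\<bar>g p\<bar> * \<bar>?b (Suc n) p\<bar> \<le> \<bar>g p\<bar>"
        by (intro mult_left_le) auto
      then show ?thesis by (simp add: abs_mult)
    qed
    then show "AE p in ?M. norm (g p * ?b (Suc n) p) \<le> \<bar>g p\<bar>" for n by simp
  qed
  moreover have "integral\<^sup>L ?M (\<lambda>p. g p * ?b (Suc n) p) = 0" for n
    using zero[of "Suc n"] by (simp add: case_prod_unfold)
  ultimately show ?thesis by (simp add: LIMSEQ_const_iff)
qed

text \<open>Bumps converge boundedly to the indicator of their rectangle. Testing only with bumps inside
  \<open>(a, b) \<times> (c, d)\<close> localizes the conclusion to that rectangle.\<close>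

lemma AE_zero_if_bumps_zero:
  fixes g :: "real \<times> real \<Rightarrow> real"
  assumes g: "integrable (lebesgue_on Omega) g"
    and K: "{a<..<b} \<times> {c<..<d} \<subseteq> Omega"
    and zero: "\<And>a' b' c' d' n. a \<le> a' \<Longrightarrow> a' \<le> b' \<Longrightarrow> b' \<le> b \<Longrightarrow> c \<le> c' \<Longrightarrow> c' \<le> d' \<Longrightarrow> d' \<le> d \<Longrightarrow>
      n > 0 \<Longrightarrow> integral\<^sup>L (lebesgue_on Omega)
        (\<lambda>(x, y). g (x, y) * (bump a' b' n x * bump c' d' n y)) = 0"
  shows "AE p in lebesgue_on Omega. p \<in> {a<..<b} \<times> {c<..<d} \<longrightarrow> g p = 0"
proof -
  let ?K = "{a<..<b} \<times> {c<..<d}"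
  define h where "h = (\<lambda>p. indicator ?K p * g p)"
  have hO: "h = (\<lambda>p. indicator ?K p *\<^sub>R (indicator Omega p *\<^sub>R g p))"
  proof
    fix p show "h p = indicator ?K p *\<^sub>R (indicator Omega p *\<^sub>R g p)"
      using subsetD[OF K, of p] by (cases "p \<in> ?K") (simp_all add: h_def)
  qed
  have "integrable lebesgue (\<lambda>p. indicator Omega p *\<^sub>R g p)"
    using g by (simp add: integrable_restrict_space)
  then have hi: "integrable lebesgue h"
    unfolding hO
    by (rule integrable_mult_indicator[of ?K, rotated]) (simp add: rectangle_box fmeasurableD)
  have rect: "integral\<^sup>L lebesgue (\<lambda>p. indicator ({s<..<t} \<times> {v<..<w}) p * h p) = 0" for s t v w
  proof -
    define a' b' c' d' where "a' = max a s" "b' = min b t" "c' = max c v" "d' = min d w"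
    note defs = this
    have eq: "indicator ({s<..<t} \<times> {v<..<w}) p * h p
        = indicator Omega p *\<^sub>R (g p * indicator ({a'<..<b'} \<times> {c'<..<d'}) p)" for p
    proof (cases "p \<in> ?K")
      case True
      then show ?thesis using subsetD[OF K, of p] by (simp add: defs h_def indicator_def mem_Times_iff)
    next
      case False
      then have "p \<notin> {a'<..<b'} \<times> {c'<..<d'}" by (auto simp: defs)
      then show ?thesis using False by (simp add: h_def)
    qed
    show ?thesis
    proof (cases "a' \<le> b' \<and> c' \<le> d'")
      case True
      then have "integral\<^sup>L (lebesgue_on Omega) (\<lambda>p. g p * indicator ({a'<..<b'} \<times> {c'<..<d'}) p) = 0"
        by (intro integral_rectangle_zero_if_bumps_zero[OF g] zero) (auto simp: defs)
      then show ?thesis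
        unfolding eq by (subst integral_restrict_space[symmetric]) auto
    next
      case False
      then have empty: "{a'<..<b'} \<times> {c'<..<d'} = {}" by auto
      show ?thesis unfolding eq empty by simp
    qed
  qed
  have "AE p in lebesgue. h p = 0"
  proof (rule AE_zero_if_box_integrals_zero[OF hi])
    fix l u :: "real \<times> real"
    obtain s v t w where "l = (s, v)" "u = (t, w)" by (cases l; cases u) auto
    then show "set_lebesgue_integral lebesgue (box l u) h = 0"
      using rect[of s t v w] by (simp add: set_lebesgue_integral_def rectangle_box)
    have "(\<lambda>p. indicator ?K p * h p) = h" by (auto simp: h_def indicator_def fun_eq_iff)
    then show "integral\<^sup>L lebesgue h = 0" using rect[of a b c d] by simp
  qed
  then show ?thesis
    by (subst AE_restrict_space_iff) (auto simp: h_def elim!: eventually_mono)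
qed

section \<open>The mesh\<close>

locale shishkin_mesh =
  fixes l :: real and N :: nat
  assumes l: "0 < l" "l \<le> 1 / 4" and N: "0 < N" "4 dvd N"
begin

abbreviation xs :: "nat \<Rightarrow> real" where "xs \<equiv> mesh_pt l N"
abbreviation cell :: "nat \<Rightarrow> nat \<Rightarrow> (real \<times> real) set" where "cell \<equiv> mesh_cell l N"

lemma xs_Suc_diff:
  assumes "i < N"
  shows "xs (Suc i) - xs i = (if i < N div 4 \<or> 3 * (N div 4) \<le> i then 4 * l / N else 2 * (1 - 2 * l) / N)"
proof -
  obtain M where M: "N = 4 * M" using N by (elim dvdE)
  have M0: "M > 0" using N M by simp
  consider "i < M" | "i = M" | "M < i" "i < 3 * M" | "i = 3 * M" | "3 * M < i" by linarith
  then show ?thesis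
    by cases (use M0 in \<open>simp_all add: mesh_pt_def M field_simps\<close>)
qed

lemma xs_0: "xs 0 = 0"
  by (simp add: mesh_pt_def)

lemma xs_transition: "xs (N div 4) = l"
proof -
  obtain M where M: "N = 4 * M" using N by (elim dvdE)
  then show ?thesis using N by (simp add: mesh_pt_def field_simps)
qed

lemma xs_transition': "xs (3 * (N div 4)) = 1 - l"
proof -
  obtain M where M: "N = 4 * M" using N by (elim dvdE)
  then show ?thesis using N by (simp add: mesh_pt_def field_simps)
qed

lemma xs_N: "xs N = 1"
proof -
  obtain M where M: "N = 4 * M" using N by (elim dvdE)
  then show ?thesis using N by (simp add: mesh_pt_def field_simps)
qed

lemma xs_less_Suc: "i < N \<Longrightarrow> xs i < xs (Suc i)"
  using xs_Suc_diff[of i] l N by (auto split: if_splits simp: field_simps)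

lemma xs_width_le: "i < N \<Longrightarrow> xs (Suc i) - xs i \<le> 2 / N"
  using xs_Suc_diff[of i] l N by (auto split: if_splits simp: field_simps)

lemma xs_less: "i < j \<Longrightarrow> j \<le> N \<Longrightarrow> xs i < xs j"
proof (induction j)
  case (Suc j)
  then show ?case using xs_less_Suc[of j] by (cases "i = j") auto
qed simp

lemma xs_le: "i \<le> j \<Longrightarrow> j \<le> N \<Longrightarrow> xs i \<le> xs j"
  using xs_less[of i j] by (cases "i = j") auto

lemma xs_01: "i \<le> N \<Longrightarrow> xs i \<in> {0..1}"
  using xs_le[of 0 i] xs_le[of i N] xs_0 xs_N by auto

lemma interval_unique:
  assumes "t \<in> {xs i<..<xs (Suc i)}" "t \<in> {xs i'..xs (Suc i')}" "i < N" "i' < N"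
  shows "i' = i"
proof (rule ccontr)
  assume "i' \<noteq> i"
  then consider "Suc i' \<le> i" | "Suc i \<le> i'" by linarith
  then show False
    using xs_le[of "Suc i'" i] xs_le[of "Suc i" i'] assms by cases auto
qed

lemma interval_exists:
  assumes "0 \<le> t" "t < 1"
  shows "\<exists>i<N. xs i \<le> t \<and> t < xs (Suc i)"
proof -
  have "\<exists>i<n. xs i \<le> t \<and> t < xs (Suc i)" if "n \<le> N" "t < xs n" for n
    using that
  proof (induction n)
    case 0
    then show ?case using assms xs_0 by auto
  next
    case (Suc n)
    then show ?case by (cases "t < xs n") (auto intro: less_SucI)
  qed
  then show ?thesis using assms xs_N by auto
qed

lemma cell_mem: "(x, y) \<in> cell i j \<longleftrightarrow> x \<in> {xs i<..<xs (Suc i)} \<and> y \<in> {xs j<..<xs (Suc j)}"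
  by (simp add: mesh_cell_def)

lemma cell_unique:
  assumes "p \<in> cell i j" "p \<in> cell i' j'" "i < N" "j < N" "i' < N" "j' < N"
  shows "i' = i \<and> j' = j"
  using assms interval_unique[of "fst p" i i'] interval_unique[of "snd p" j j']
  by (auto simp: mesh_cell_def)

lemma cell_subset_Omega:
  assumes "i < N" "j < N"
  shows "cell i j \<subseteq> Omega"
  using xs_01[of i] xs_01[of j] xs_01[of "Suc i"] xs_01[of "Suc j"] assms
  by (auto simp: mesh_cell_def)

lemma cell_sets: "cell i j \<in> sets lebesgue"
  by (simp add: mesh_cell_def rectangle_box fmeasurableD)

lemma indicator_cell_measurable:
  "(\<lambda>p. indicator (cell i j) p :: real) \<in> borel_measurable (lebesgue_on Omega)"
  by (intro measurable_restrict_space1 borel_measurable_indicator cell_sets)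

lemma AE_cell: "AE p in lebesgue_on Omega. \<exists>i<N. \<exists>j<N. p \<in> cell i j"
proof -
  let ?L = "\<lambda>i. {p :: real \<times> real. p \<bullet> (1, 0) = xs i} \<union> {p. p \<bullet> (0, 1) = xs i}"
  have "negligible (?L i)" for i
    by (intro negligible_Un negligible_standard_hyperplane) (auto simp: Basis_prod_def)
  then have "negligible (\<Union>i\<in>{..N}. ?L i)"
    by (intro negligible_Union) auto
  then have "AE p in lebesgue. p \<notin> (\<Union>i\<in>{..N}. ?L i)"
    by (intro AE_not_in) (simp add: negligible_iff_null_sets)
  then show ?thesis
  proof (subst AE_restrict_space_iff, simp, elim eventually_mono, intro impI)
    fix p :: "real \<times> real" assume p: "p \<notin> (\<Union>i\<in>{..N}. ?L i)" "p \<in> Omega"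
    obtain x y where xy: "p = (x, y)" by force
    obtain i where i: "i < N" "xs i \<le> x" "x < xs (Suc i)"
      using interval_exists[of x] p xy by auto
    obtain j where j: "j < N" "xs j \<le> y" "y < xs (Suc j)"
      using interval_exists[of y] p xy by auto
    have "x \<noteq> xs i" "y \<noteq> xs j" using p xy i j by auto
    then show "\<exists>i<N. \<exists>j<N. p \<in> cell i j"
      using i j xy by (intro exI[of _ i] exI[of _ j] conjI) (auto simp: cell_mem)
  qed
qed

text \<open>The value on the mesh lines is \<open>0\<close>; they form a null set.\<close>

definition piecewise :: "(nat \<Rightarrow> nat \<Rightarrow> real \<times> real \<Rightarrow> 'a::real_vector) \<Rightarrow> real \<times> real \<Rightarrow> 'a" where
  "piecewise F p = (\<Sum>i<N. \<Sum>j<N. indicator (cell i j) p *\<^sub>R F i j p)"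

lemma piecewise_cell:
  assumes "p \<in> cell i j" "i < N" "j < N"
  shows "piecewise F p = F i j p"
proof -
  have *: "indicator (cell i' j') p *\<^sub>R F i' j' p = (if i' = i then if j' = j then F i j p else 0 else 0)"
    if "i' < N" "j' < N" for i' j'
  proof (cases "i' = i \<and> j' = j")
    case True
    then show ?thesis using assms(1) by simp
  next
    case False
    then have "p \<notin> cell i' j'" using cell_unique[OF assms(1) _ assms(2,3) that] by blast
    then show ?thesis using False by auto
  qed
  have "piecewise F p = (\<Sum>i'<N. \<Sum>j'<N. if i' = i then if j' = j then F i j p else 0 else 0)"
    unfolding piecewise_def by (intro sum.cong refl *) auto
  also have "\<dots> = (\<Sum>i'<N. if i' = i then F i j p else 0)"
    by (rule sum.cong) (use assms in \<open>auto simp: sum.delta\<close>)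
  also have "\<dots> = F i j p"
    using assms by (simp add: sum.delta)
  finally show ?thesis .
qed

lemma L2_piecewise:
  fixes F :: "nat \<Rightarrow> nat \<Rightarrow> real \<times> real \<Rightarrow> 'a::euclidean_space"
  assumes F: "\<And>i j. continuous_on Omega_bar (F i j)"
  shows "L2 (piecewise F)"
proof -
  have "L2 (\<lambda>p. \<Sum>j<m. indicator (cell i j) p *\<^sub>R F i j p)" for i m
  proof (induction m)
    case 0
    then show ?case using continuous_imp_L2[of "\<lambda>_. 0"] by simp
  next
    case (Suc m)
    obtain B where B: "\<And>p. p \<in> Omega_bar \<Longrightarrow> norm (F i m p) \<le> B"
      using continuous_imp_bounded_Omega[OF F] by blast
    have "norm (indicator (cell i m) p *\<^sub>R F i m p) \<le> \<bar>B\<bar>" if "p \<in> Omega" for p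
    proof -
      have "norm (F i m p) \<le> B" using that by (intro B) auto
      then show ?thesis using abs_ge_self[of B] by (simp add: indicator_def)
    qed
    then have "L2 (\<lambda>p. indicator (cell i m) p *\<^sub>R F i m p)"
      by (intro bounded_imp_L2 borel_measurable_scaleR indicator_cell_measurable
          continuous_imp_measurable_Omega F)
    then show ?case using Suc L2_add by auto
  qed
  then have "L2 (\<lambda>p. \<Sum>i<m. \<Sum>j<N. indicator (cell i j) p *\<^sub>R F i j p)" for m
  proof (induction m)
    case 0
    then show ?case using continuous_imp_L2[of "\<lambda>_. 0"] by simp
  next
    case (Suc m)
    then show ?case using L2_add by auto
  qed
  then show ?thesis by (simp add: piecewise_def[abs_def])
qed

lemma integral_cells:
  fixes g :: "real \<times> real \<Rightarrow> real"
  assumes g: "integrable (lebesgue_on Omega) g"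
    and h: "\<And>i j p. i < N \<Longrightarrow> j < N \<Longrightarrow> p \<in> cell i j \<Longrightarrow> g p = h i j p"
    and cont: "\<And>i j. i < N \<Longrightarrow> j < N \<Longrightarrow> continuous_on (cbox (xs i, xs j) (xs (Suc i), xs (Suc j))) (h i j)"
  shows "integral\<^sup>L (lebesgue_on Omega) g =
    (\<Sum>i<N. \<Sum>j<N. integral (cbox (xs i, xs j) (xs (Suc i), xs (Suc j))) (h i j))"
proof -
  let ?M = "lebesgue_on Omega"
  have gi: "integrable ?M (\<lambda>p. indicator (cell i j) p * g p)" for i j
  proof (rule Bochner_Integration.integrable_bound[OF g])
    show "(\<lambda>p. indicator (cell i j) p * g p) \<in> borel_measurable ?M"
      by (intro borel_measurable_times indicator_cell_measurable borel_measurable_integrable[OF g])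
  qed (simp add: indicator_def)
  have "AE p in ?M. g p = (\<Sum>i<N. \<Sum>j<N. indicator (cell i j) p * g p)"
    using AE_cell
  proof eventually_elim
    case (elim p)
    then obtain i j where "i < N" "j < N" "p \<in> cell i j" by blast
    then have "piecewise (\<lambda>_ _. g) p = g p" by (intro piecewise_cell)
    then show ?case by (simp add: piecewise_def)
  qed
  then have "integral\<^sup>L ?M g = integral\<^sup>L ?M (\<lambda>p. \<Sum>i<N. \<Sum>j<N. indicator (cell i j) p * g p)"
    by (intro integral_cong_AE borel_measurable_sum borel_measurable_integrable[OF g]
        borel_measurable_integrable[OF gi])
  also have "\<dots> = (\<Sum>i<N. \<Sum>j<N. integral\<^sup>L ?M (\<lambda>p. indicator (cell i j) p * g p))"
    by (simp only: Bochner_Integration.integral_sum Bochner_Integration.integrable_sum gi)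
  also have "\<dots> = (\<Sum>i<N. \<Sum>j<N. integral (cbox (xs i, xs j) (xs (Suc i), xs (Suc j))) (h i j))"
  proof (intro sum.cong refl)
    fix i j assume "i \<in> {..<N}" "j \<in> {..<N}"
    then have ij: "i < N" "j < N" by auto
    have "integral\<^sup>L ?M (\<lambda>p. indicator (cell i j) p * g p)
        = integral\<^sup>L lebesgue (\<lambda>p. indicator Omega p *\<^sub>R (indicator (cell i j) p * g p))"
      by (rule integral_restrict_space) simp
    also have "(\<lambda>p. indicator Omega p *\<^sub>R (indicator (cell i j) p * g p)) = (\<lambda>p. indicator (cell i j) p *\<^sub>R h i j p)"
    proof
      fix p show "indicator Omega p *\<^sub>R (indicator (cell i j) p * g p) = indicator (cell i j) p *\<^sub>R h i j p"
        using subsetD[OF cell_subset_Omega[OF ij], of p] h[OF ij, of p]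
        by (cases "p \<in> cell i j") simp_all
    qed
    also have "integral\<^sup>L lebesgue \<dots> = set_lebesgue_integral lebesgue (cell i j) (h i j)"
      by (simp add: set_lebesgue_integral_def)
    also have "\<dots> = integral (cell i j) (h i j)"
    proof (rule set_lebesgue_integral_eq_integral)
      have "h i j absolutely_integrable_on cbox (xs i, xs j) (xs (Suc i), xs (Suc j))"
        by (rule absolutely_integrable_continuous[OF cont[OF ij]])
      then show "h i j absolutely_integrable_on cell i j"
        by (rule set_integrable_subset[OF _ cell_sets])
          (auto simp: mesh_cell_def rectangle_box box_subset_cbox)
    qed
    also have "\<dots> = integral (cbox (xs i, xs j) (xs (Suc i), xs (Suc j))) (h i j)"
      by (simp add: mesh_cell_def rectangle_box integral_open_interval)
    finally show "integral\<^sup>L ?M (\<lambda>p. indicator (cell i j) p * g p)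
      = integral (cbox (xs i, xs j) (xs (Suc i), xs (Suc j))) (h i j)" .
  qed
  finally show ?thesis .
qed

end

section \<open>Piecewise Raviart--Thomas fields\<close>

lemma integral_x_affine_mult:
  assumes \<phi>: "C_bar (Suc 0) \<phi>" and ab: "a \<le> b" "{a..b} \<subseteq> {0..1}" and y: "y \<in> {0..1}"
  shows "integral {a..b} (\<lambda>x. (A + B * x) * dx \<phi> (x, y) + B * \<phi> (x, y))
    = (A + B * b) * \<phi> (b, y) - (A + B * a) * \<phi> (a, y)"
proof (rule integral_unique, rule fundamental_theorem_of_calculus[OF ab(1)])
  fix x assume "x \<in> {a..b}"
  then have "x \<in> {0..1}" using ab by blast
  then have "((\<lambda>x. \<phi> (x, y)) has_real_derivative dx \<phi> (x, y)) (at x within {a..b})"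
    using C_bar_dx[OF \<phi> _ y] ab(2) by (blast intro: DERIV_subset)
  then have "((\<lambda>x. (A + B * x) * \<phi> (x, y)) has_real_derivative (A + B * x) * dx \<phi> (x, y) + B * \<phi> (x, y))
      (at x within {a..b})"
    by (auto intro!: derivative_eq_intros)
  then show "((\<lambda>x. (A + B * x) * \<phi> (x, y)) has_vector_derivative (A + B * x) * dx \<phi> (x, y) + B * \<phi> (x, y))
      (at x within {a..b})"
    by (simp add: has_real_derivative_iff_has_vector_derivative)
qed

lemma integral_y_affine_mult:
  assumes \<phi>: "C_bar (Suc 0) \<phi>" and ab: "a \<le> b" "{a..b} \<subseteq> {0..1}" and x: "x \<in> {0..1}"
  shows "integral {a..b} (\<lambda>y. (A + B * y) * dy \<phi> (x, y) + B * \<phi> (x, y))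
    = (A + B * b) * \<phi> (x, b) - (A + B * a) * \<phi> (x, a)"
proof (rule integral_unique, rule fundamental_theorem_of_calculus[OF ab(1)])
  fix y assume "y \<in> {a..b}"
  then have "y \<in> {0..1}" using ab by blast
  then have "((\<lambda>y. \<phi> (x, y)) has_real_derivative dy \<phi> (x, y)) (at y within {a..b})"
    using C_bar_dy[OF \<phi> x] ab(2) by (blast intro: DERIV_subset)
  then have "((\<lambda>y. (A + B * y) * \<phi> (x, y)) has_real_derivative (A + B * y) * dy \<phi> (x, y) + B * \<phi> (x, y))
      (at y within {a..b})"
    by (auto intro!: derivative_eq_intros)
  then show "((\<lambda>y. (A + B * y) * \<phi> (x, y)) has_vector_derivative (A + B * y) * dy \<phi> (x, y) + B * \<phi> (x, y))
      (at y within {a..b})"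
    by (simp add: has_real_derivative_iff_has_vector_derivative)
qed

lemma continuous_on_slice:
  fixes \<phi> :: "real \<times> real \<Rightarrow> real"
  assumes "continuous_on Omega_bar \<phi>" "{a..b} \<subseteq> {0..1}"
  shows "t \<in> {0..1} \<Longrightarrow> continuous_on {a..b} (\<lambda>y. \<phi> (t, y))"
    and "t \<in> {0..1} \<Longrightarrow> continuous_on {a..b} (\<lambda>x. \<phi> (x, t))"
  by (rule continuous_on_compose2[OF assms(1)]; use assms(2) in \<open>auto intro!: continuous_intros\<close>)+

text \<open>Green's formula on one rectangle; the normal components of the field are constant on the
  edges, so only the edge integrals of \<open>\<phi>\<close> enter.\<close>

lemma Green_rectangle:
  assumes \<phi>: "C_bar (Suc 0) \<phi>"
    and ab: "a \<le> b" "{a..b} \<subseteq> {0..1}" and cd: "c \<le> d" "{c..d} \<subseteq> {0..1}"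
  shows "integral (cbox (a, c) (b, d)) (\<lambda>(x, y). (A1 + B1 * x, A2 + B2 * y) \<bullet> grad \<phi> (x, y) + (B1 + B2) * \<phi> (x, y))
    = (A1 + B1 * b) * integral {c..d} (\<lambda>y. \<phi> (b, y)) - (A1 + B1 * a) * integral {c..d} (\<lambda>y. \<phi> (a, y))
    + ((A2 + B2 * d) * integral {a..b} (\<lambda>x. \<phi> (x, d)) - (A2 + B2 * c) * integral {a..b} (\<lambda>x. \<phi> (x, c)))"
proof -
  let ?R = "cbox (a, c) (b, d)"
  let ?g1 = "\<lambda>x y. (A1 + B1 * x) * dx \<phi> (x, y) + B1 * \<phi> (x, y)"
  let ?g2 = "\<lambda>x y. (A2 + B2 * y) * dy \<phi> (x, y) + B2 * \<phi> (x, y)"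
  have R: "?R \<subseteq> Omega_bar" using ab cd by (auto simp: cbox_Pair_eq)
  have cont: "continuous_on Omega_bar \<phi>" "continuous_on Omega_bar (dx \<phi>)" "continuous_on Omega_bar (dy \<phi>)"
    using \<phi> by auto
  note contR = cont[THEN continuous_on_subset, OF R]
  have c1: "continuous_on ?R (\<lambda>(x, y). ?g1 x y)" and c2: "continuous_on ?R (\<lambda>(x, y). ?g2 x y)"
    using contR by (auto simp: case_prod_unfold intro!: continuous_intros)
  have ends: "a \<in> {0..1}" "b \<in> {0..1}" "c \<in> {0..1}" "d \<in> {0..1}" using ab cd by auto
  have int: "(\<lambda>y. \<phi> (t, y)) integrable_on {c..d}" "(\<lambda>x. \<phi> (x, t)) integrable_on {a..b}" if "t \<in> {0..1}" for t
    using continuous_on_slice[OF cont(1)] ab cd that by (auto intro!: integrable_continuous_interval)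
  have "integral ?R (\<lambda>(x, y). ?g1 x y) = integral {c..d} (\<lambda>y. integral {a..b} (\<lambda>x. ?g1 x y))"
    using integral_prod_continuous[OF c1] integral_swap_continuous[OF c1] by (simp add: cbox_interval)
  also have "\<dots> = integral {c..d} (\<lambda>y. (A1 + B1 * b) * \<phi> (b, y) - (A1 + B1 * a) * \<phi> (a, y))"
    by (intro integral_cong integral_x_affine_mult[OF \<phi> ab]) (use cd in auto)
  also have "\<dots> = (A1 + B1 * b) * integral {c..d} (\<lambda>y. \<phi> (b, y)) - (A1 + B1 * a) * integral {c..d} (\<lambda>y. \<phi> (a, y))"
    using int ends by (subst integral_diff) (auto intro!: integrable_on_mult_right)
  finally have i1: "integral ?R (\<lambda>(x, y). ?g1 x y) = \<dots>" .
  have "integral ?R (\<lambda>(x, y). ?g2 x y) = integral {a..b} (\<lambda>x. integral {c..d} (\<lambda>y. ?g2 x y))"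
    using integral_prod_continuous[OF c2] by (simp add: cbox_interval)
  also have "\<dots> = integral {a..b} (\<lambda>x. (A2 + B2 * d) * \<phi> (x, d) - (A2 + B2 * c) * \<phi> (x, c))"
    by (intro integral_cong integral_y_affine_mult[OF \<phi> cd]) (use ab in auto)
  also have "\<dots> = (A2 + B2 * d) * integral {a..b} (\<lambda>x. \<phi> (x, d)) - (A2 + B2 * c) * integral {a..b} (\<lambda>x. \<phi> (x, c))"
    using int ends by (subst integral_diff) (auto intro!: integrable_on_mult_right)
  finally have i2: "integral ?R (\<lambda>(x, y). ?g2 x y) = \<dots>" .
  have "(\<lambda>(x, y). (A1 + B1 * x, A2 + B2 * y) \<bullet> grad \<phi> (x, y) + (B1 + B2) * \<phi> (x, y))
      = (\<lambda>p. (\<lambda>(x, y). ?g1 x y) p + (\<lambda>(x, y). ?g2 x y) p)"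
    by (auto simp: grad_def algebra_simps)
  then show ?thesis
    using i1 i2 integral_add[OF integrable_continuous[OF c1] integrable_continuous[OF c2]] by simp
qed

lemma telescoping_sum_zero:
  fixes a b f :: "nat \<Rightarrow> real"
  assumes "\<And>i. Suc i < N \<Longrightarrow> a i = b (Suc i)" "f 0 = 0" "f N = 0"
  shows "(\<Sum>i<N. a i * f (Suc i) - b i * f i) = 0"
proof -
  define e where "e i = (if i < N then b i * f i else 0)" for i
  have "(\<Sum>i<N. a i * f (Suc i) - b i * f i) = (\<Sum>i<N. e (Suc i) - e i)"
  proof (intro sum.cong refl)
    fix i assume "i \<in> {..<N}"
    then show "a i * f (Suc i) - b i * f i = e (Suc i) - e i"
      using assms by (cases "Suc i < N") (auto simp: e_def less_Suc_eq not_less dest: le_antisym)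
  qed
  also have "\<dots> = e N - e 0" by (rule sum_lessThan_telescope)
  also have "\<dots> = 0" using assms by (simp add: e_def)
  finally show ?thesis .
qed

lemma sum_jump:
  fixes a b f :: "nat \<Rightarrow> real"
  assumes "\<And>k. k \<noteq> Suc i \<Longrightarrow> k \<le> N \<Longrightarrow> f k = 0" "Suc i < N"
  shows "(\<Sum>k<N. a k * f (Suc k) - b k * f k) = (a i - b (Suc i)) * f (Suc i)"
proof -
  have "(\<Sum>k<N. a k * f (Suc k) - b k * f k)
      = (\<Sum>k<N. (if k = i then a i * f (Suc i) else 0) - (if k = Suc i then b (Suc i) * f (Suc i) else 0))"
    by (intro sum.cong refl) (use assms in auto)
  also have "\<dots> = (a i - b (Suc i)) * f (Suc i)"
    using assms(2) by (simp add: sum_subtractf sum.delta algebra_simps)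
  finally show ?thesis .
qed

lemma test_function_C_bar: "test_function \<phi> \<Longrightarrow> C_bar k \<phi>"
  unfolding test_function_def by blast

context shishkin_mesh
begin

definition rt_field ::
  "(real \<times> real \<Rightarrow> real \<times> real) \<Rightarrow> (nat \<Rightarrow> nat \<Rightarrow> real) \<Rightarrow> (nat \<Rightarrow> nat \<Rightarrow> real) \<Rightarrow>
   (nat \<Rightarrow> nat \<Rightarrow> real) \<Rightarrow> (nat \<Rightarrow> nat \<Rightarrow> real) \<Rightarrow> bool" where
  "rt_field v A1 B1 A2 B2 \<longleftrightarrow> L2 v \<and>
     (\<forall>i<N. \<forall>j<N. \<forall>(x, y)\<in>cell i j. v (x, y) = (A1 i j + B1 i j * x, A2 i j + B2 i j * y))"

lemma rt_fieldD:
  assumes "rt_field v A1 B1 A2 B2" "i < N" "j < N" "p \<in> cell i j"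
  shows "v p = (A1 i j + B1 i j * fst p, A2 i j + B2 i j * snd p)"
  using assms unfolding rt_field_def by fastforce

definition normal_continuous ::
  "(nat \<Rightarrow> nat \<Rightarrow> real) \<Rightarrow> (nat \<Rightarrow> nat \<Rightarrow> real) \<Rightarrow> (nat \<Rightarrow> nat \<Rightarrow> real) \<Rightarrow> (nat \<Rightarrow> nat \<Rightarrow> real) \<Rightarrow> bool" where
  "normal_continuous A1 B1 A2 B2 \<longleftrightarrow>
     (\<forall>i j. Suc i < N \<longrightarrow> j < N \<longrightarrow>
        A1 i j + B1 i j * xs (Suc i) = A1 (Suc i) j + B1 (Suc i) j * xs (Suc i)) \<and>
     (\<forall>i j. i < N \<longrightarrow> Suc j < N \<longrightarrow>
        A2 i j + B2 i j * xs (Suc j) = A2 i (Suc j) + B2 i (Suc j) * xs (Suc j))"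

abbreviation cell_div :: "(nat \<Rightarrow> nat \<Rightarrow> real) \<Rightarrow> (nat \<Rightarrow> nat \<Rightarrow> real) \<Rightarrow> real \<times> real \<Rightarrow> real" where
  "cell_div B1 B2 \<equiv> piecewise (\<lambda>i j _. B1 i j + B2 i j)"

definition edge_x :: "(real \<times> real \<Rightarrow> real) \<Rightarrow> nat \<Rightarrow> nat \<Rightarrow> real" where
  "edge_x \<phi> i j = integral {xs j..xs (Suc j)} (\<lambda>y. \<phi> (xs i, y))"

definition edge_y :: "(real \<times> real \<Rightarrow> real) \<Rightarrow> nat \<Rightarrow> nat \<Rightarrow> real" where
  "edge_y \<phi> i j = integral {xs i..xs (Suc i)} (\<lambda>x. \<phi> (x, xs j))"

lemma L2_cell_div: "L2 (cell_div B1 B2)"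
  by (rule L2_piecewise) simp

lemma C_bar_L2:
  assumes "C_bar (Suc 0) \<phi>"
  shows "L2 \<phi>" "L2 (grad \<phi>)"
  using assms by (auto simp: grad_def intro!: continuous_imp_L2 continuous_on_Pair)

text \<open>With the weak divergence identity on the left, the right-hand side collects, for each mesh line,
  the jumps of the normal component; it is kept unsimplified to serve both the case of no jumps and
  the detection of a single one.\<close>

lemma Green_mesh:
  assumes v: "rt_field v A1 B1 A2 B2" and \<phi>: "C_bar (Suc 0) \<phi>"
  shows "L2_inner v (grad \<phi>) + L2_inner (cell_div B1 B2) \<phi>
    = (\<Sum>j<N. \<Sum>i<N. (A1 i j + B1 i j * xs (Suc i)) * edge_x \<phi> (Suc i) j - (A1 i j + B1 i j * xs i) * edge_x \<phi> i j)
    + (\<Sum>i<N. \<Sum>j<N. (A2 i j + B2 i j * xs (Suc j)) * edge_y \<phi> i (Suc j) - (A2 i j + B2 i j * xs j) * edge_y \<phi> i j)"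
proof -
  let ?h = "\<lambda>i j. \<lambda>(x, y). (A1 i j + B1 i j * x, A2 i j + B2 i j * y) \<bullet> grad \<phi> (x, y) + (B1 i j + B2 i j) * \<phi> (x, y)"
  have L: "L2 v" "L2 \<phi>" "L2 (grad \<phi>)" using v C_bar_L2[OF \<phi>] by (auto simp: rt_field_def)
  have int: "integrable (lebesgue_on Omega) (\<lambda>p. v p \<bullet> grad \<phi> p)"
    "integrable (lebesgue_on Omega) (\<lambda>p. cell_div B1 B2 p \<bullet> \<phi> p)"
    by (intro L2_integrable_inner L L2_cell_div)+
  have "L2_inner v (grad \<phi>) + L2_inner (cell_div B1 B2) \<phi>
      = integral\<^sup>L (lebesgue_on Omega) (\<lambda>p. v p \<bullet> grad \<phi> p + cell_div B1 B2 p \<bullet> \<phi> p)"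
    unfolding L2_inner_def by (rule Bochner_Integration.integral_add[OF int, symmetric])
  also have "\<dots> = (\<Sum>i<N. \<Sum>j<N. integral (cbox (xs i, xs j) (xs (Suc i), xs (Suc j))) (?h i j))"
  proof (rule integral_cells)
    fix i j assume ij: "i < N" "j < N"
    have "cbox (xs i, xs j) (xs (Suc i), xs (Suc j)) \<subseteq> Omega_bar"
      using xs_01[of i] xs_01[of j] xs_01[of "Suc i"] xs_01[of "Suc j"] ij by (auto simp: cbox_Pair_eq)
    moreover have "continuous_on Omega_bar \<phi>" "continuous_on Omega_bar (dx \<phi>)" "continuous_on Omega_bar (dy \<phi>)"
      using \<phi> by auto
    ultimately have c: "continuous_on (cbox (xs i, xs j) (xs (Suc i), xs (Suc j))) \<phi>"
      "continuous_on (cbox (xs i, xs j) (xs (Suc i), xs (Suc j))) (dx \<phi>)"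
      "continuous_on (cbox (xs i, xs j) (xs (Suc i), xs (Suc j))) (dy \<phi>)"
      by (blast intro: continuous_on_subset)+
    then show "continuous_on (cbox (xs i, xs j) (xs (Suc i), xs (Suc j))) (?h i j)"
      by (auto simp: case_prod_unfold grad_def intro!: continuous_intros)
    fix p assume p: "p \<in> cell i j"
    then have "v p = (A1 i j + B1 i j * fst p, A2 i j + B2 i j * snd p)"
      by (rule rt_fieldD[OF v ij])
    then show "v p \<bullet> grad \<phi> p + cell_div B1 B2 p \<bullet> \<phi> p = ?h i j p"
      using piecewise_cell[OF p ij, of "\<lambda>i j _. B1 i j + B2 i j"] by (simp add: case_prod_unfold)
  qed (use int in auto)
  also have "\<dots> = (\<Sum>i<N. \<Sum>j<N.
      (A1 i j + B1 i j * xs (Suc i)) * edge_x \<phi> (Suc i) j - (A1 i j + B1 i j * xs i) * edge_x \<phi> i j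
      + ((A2 i j + B2 i j * xs (Suc j)) * edge_y \<phi> i (Suc j) - (A2 i j + B2 i j * xs j) * edge_y \<phi> i j))"
  proof (intro sum.cong refl)
    fix i j assume "i \<in> {..<N}" "j \<in> {..<N}"
    then have ij: "i < N" "j < N" by auto
    show "integral (cbox (xs i, xs j) (xs (Suc i), xs (Suc j))) (?h i j) =
      (A1 i j + B1 i j * xs (Suc i)) * edge_x \<phi> (Suc i) j - (A1 i j + B1 i j * xs i) * edge_x \<phi> i j
      + ((A2 i j + B2 i j * xs (Suc j)) * edge_y \<phi> i (Suc j) - (A2 i j + B2 i j * xs j) * edge_y \<phi> i j)"
      unfolding edge_x_def edge_y_def
      by (rule Green_rectangle[OF \<phi>])
        (use xs_01[of i] xs_01[of j] xs_01[of "Suc i"] xs_01[of "Suc j"] xs_less_Suc[of i] xs_less_Suc[of j] ij in auto)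
  qed
  also have "\<dots> = (\<Sum>i<N. \<Sum>j<N. (A1 i j + B1 i j * xs (Suc i)) * edge_x \<phi> (Suc i) j - (A1 i j + B1 i j * xs i) * edge_x \<phi> i j)
    + (\<Sum>i<N. \<Sum>j<N. (A2 i j + B2 i j * xs (Suc j)) * edge_y \<phi> i (Suc j) - (A2 i j + B2 i j * xs j) * edge_y \<phi> i j)"
    by (simp only: sum.distrib)
  finally show ?thesis
    by (subst sum.swap) simp
qed

text \<open>The edge sums telescope. Zero boundary values suffice in place of compact support, so that the
  solution \<open>u\<close> itself may be inserted for \<open>\<phi>\<close>.\<close>

lemma Green_normal_continuous:
  assumes v: "rt_field v A1 B1 A2 B2" and nc: "normal_continuous A1 B1 A2 B2"
    and \<phi>: "C_bar (Suc 0) \<phi>" and zero: "\<And>p. p \<in> Omega_bar - Omega \<Longrightarrow> \<phi> p = 0"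
  shows "L2_inner v (grad \<phi>) = - L2_inner (cell_div B1 B2) \<phi>"
proof -
  have interval: "{xs j..xs (Suc j)} \<subseteq> {0..1}" if "j < N" for j
    using xs_01[of j] xs_01[of "Suc j"] that by auto
  have z: "edge_x \<phi> i j = 0" "edge_y \<phi> j i = 0" if "i = 0 \<or> i = N" "j < N" for i j
  proof -
    have "\<phi> (xs i, t) = 0" "\<phi> (t, xs i) = 0" if "t \<in> {xs j..xs (Suc j)}" for t
      using zero[of "(xs i, t)"] zero[of "(t, xs i)"] \<open>i = 0 \<or> i = N\<close> subsetD[OF interval[OF \<open>j < N\<close>] that] xs_0 xs_N
      by auto
    then show "edge_x \<phi> i j = 0" "edge_y \<phi> j i = 0"
      unfolding edge_x_def edge_y_def by (intro integral_unique has_integral_is_0, simp)+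
  qed
  have "(\<Sum>i<N. (A1 i j + B1 i j * xs (Suc i)) * edge_x \<phi> (Suc i) j - (A1 i j + B1 i j * xs i) * edge_x \<phi> i j) = 0"
    if "j < N" for j
    by (rule telescoping_sum_zero[of N _ "\<lambda>i. A1 i j + B1 i j * xs i" "\<lambda>i. edge_x \<phi> i j"])
      (use nc z that in \<open>auto simp: normal_continuous_def\<close>)
  moreover have "(\<Sum>j<N. (A2 i j + B2 i j * xs (Suc j)) * edge_y \<phi> i (Suc j) - (A2 i j + B2 i j * xs j) * edge_y \<phi> i j) = 0"
    if "i < N" for i
    by (rule telescoping_sum_zero[of N _ "\<lambda>j. A2 i j + B2 i j * xs j" "\<lambda>j. edge_y \<phi> i j"])
      (use nc z that in \<open>auto simp: normal_continuous_def\<close>)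
  ultimately show ?thesis
    using Green_mesh[OF v \<phi>] by simp
qed

lemma rt_has_weak_div:
  assumes v: "rt_field v A1 B1 A2 B2" and nc: "normal_continuous A1 B1 A2 B2"
  shows "has_weak_div v (cell_div B1 B2)"
  unfolding has_weak_div_def
proof (intro conjI allI impI L2_cell_div)
  fix \<phi> assume "test_function \<phi>"
  then obtain K where "C_bar (Suc 0) \<phi>" "K \<subseteq> Omega" "\<And>p. p \<notin> K \<Longrightarrow> \<phi> p = 0"
    unfolding test_function_def by blast
  then show "L2_inner v (grad \<phi>) = - L2_inner (cell_div B1 B2) \<phi>"
    by (intro Green_normal_continuous[OF v nc]) auto
qed

lemma rt_in_V_space:
  assumes "rt_field v A1 B1 A2 B2" "has_weak_div v d"
  shows "v \<in> V_space l N"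
proof -
  have "\<exists>a1 b1 a2 b2. \<forall>(x, y)\<in>cell i j. v (x, y) = (a1 + b1 * x, a2 + b2 * y)" if "i < N" "j < N" for i j
    using assms that unfolding rt_field_def by blast
  then show ?thesis
    using assms unfolding V_space_def H_div_def rt_field_def by blast
qed

lemma V_space_rt:
  assumes "v \<in> V_space l N"
  obtains A1 B1 A2 B2 where "rt_field v A1 B1 A2 B2"
proof -
  have "\<forall>ij. \<exists>t. fst ij < N \<and> snd ij < N \<longrightarrow> (\<forall>(x, y)\<in>cell (fst ij) (snd ij).
      v (x, y) = (fst t + fst (snd t) * x, fst (snd (snd t)) + snd (snd (snd t)) * y))"
  proof
    fix ij :: "nat \<times> nat"
    show "\<exists>t. fst ij < N \<and> snd ij < N \<longrightarrow> (\<forall>(x, y)\<in>cell (fst ij) (snd ij).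
      v (x, y) = (fst t + fst (snd t) * x, fst (snd (snd t)) + snd (snd (snd t)) * y))"
    proof (cases "fst ij < N \<and> snd ij < N")
      case True
      then obtain a1 b1 a2 b2 where "\<forall>(x, y)\<in>cell (fst ij) (snd ij). v (x, y) = (a1 + b1 * x, a2 + b2 * y)"
        using assms unfolding V_space_def by blast
      then show ?thesis by (intro exI[of _ "(a1, b1, a2, b2)"]) simp
    next
      case False
      then show ?thesis by (intro exI[of _ "(0, 0, 0, 0)"] impI) (use False in blast)
    qed
  qed
  from choice[OF this] obtain T where T: "\<And>ij. fst ij < N \<and> snd ij < N \<Longrightarrow> (\<forall>(x, y)\<in>cell (fst ij) (snd ij).
      v (x, y) = (fst (T ij) + fst (snd (T ij)) * x, fst (snd (snd (T ij))) + snd (snd (snd (T ij))) * y))"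
    by blast
  have "rt_field v (\<lambda>i j. fst (T (i, j))) (\<lambda>i j. fst (snd (T (i, j))))
      (\<lambda>i j. fst (snd (snd (T (i, j))))) (\<lambda>i j. snd (snd (snd (T (i, j)))))"
    unfolding rt_field_def using T[of "(_, _)"] assms by (simp add: V_space_def H_div_def)
  then show ?thesis using that by blast
qed

lemma edge_x_tensor: "edge_x (\<lambda>(x, y). X x * Y y) i j = X (xs i) * integral {xs j..xs (Suc j)} Y"
  by (simp add: edge_x_def)

lemma edge_y_tensor: "edge_y (\<lambda>(x, y). X x * Y y) i j = integral {xs i..xs (Suc i)} X * Y (xs j)"
  by (simp add: edge_y_def)

lemma bump_eq_0: "n > 0 \<Longrightarrow> t \<le> a \<or> b \<le> t \<Longrightarrow> bump a b n t = 0"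
proof (rule bump_outside)
  assume n: "n > 0" and t: "t \<le> a \<or> b \<le> t"
  have "1 / real n > 0" using n by simp
  then show "t \<notin> {a + 1 / n..b - 1 / n}" using t unfolding atLeastAtMost_iff by linarith
qed

lemma bump_node_eq_0:
  assumes "n > 0" "k \<le> N" "i < N" "xs i \<le> a" "b \<le> xs (Suc i)"
  shows "bump a b n (xs k) = 0"
proof (rule bump_eq_0)
  have "k \<le> i \<or> Suc i \<le> k" by linarith
  then show "xs k \<le> a \<or> b \<le> xs k"
    using xs_le[of k i] xs_le[of "Suc i" k] assms by force
qed fact

text \<open>The weak divergence of a cellwise affine field is forced to be the cellwise one: test with
  bumps supported in a single cell, for which Green's formula has no edge terms.\<close>

lemma weak_div_AE_cell_div:
  assumes v: "rt_field v A1 B1 A2 B2" and d: "has_weak_div v d"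
  shows "AE p in lebesgue_on Omega. d p = cell_div B1 B2 p"
proof -
  have L: "L2 d" "L2 (\<lambda>p. d p - cell_div B1 B2 p)"
    using d L2_cell_div by (auto simp: has_weak_div_def intro: L2_diff)
  have "AE p in lebesgue_on Omega. p \<in> cell i j \<longrightarrow> d p - cell_div B1 B2 p = 0" if ij: "i < N" "j < N" for i j
    unfolding mesh_cell_def
  proof (rule AE_zero_if_bumps_zero)
    show "integrable (lebesgue_on Omega) (\<lambda>p. d p - cell_div B1 B2 p)"
      using L by (intro L2_imp_integrable)
    show "{xs i<..<xs (Suc i)} \<times> {xs j<..<xs (Suc j)} \<subseteq> Omega"
      using cell_subset_Omega[OF ij] by (simp add: mesh_cell_def)
    fix a b a' b' and n :: nat
    assume ab: "xs i \<le> a" "a \<le> b" "b \<le> xs (Suc i)" "xs j \<le> a'" "a' \<le> b'" "b' \<le> xs (Suc j)" and n: "n > 0"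
    define \<phi> where "\<phi> = (\<lambda>(x, y). bump a b n x * bump a' b' n y)"
    have \<phi>: "test_function \<phi>"
      unfolding \<phi>_def
      by (rule test_function_bump)
        (use ab n xs_01[of i] xs_01[of j] xs_01[of "Suc i"] xs_01[of "Suc j"] ij in auto)
    then have C: "C_bar (Suc 0) \<phi>" by (rule test_function_C_bar)
    have e: "edge_x \<phi> k m = 0" "edge_y \<phi> m k = 0" if "k \<le> N" for k m
      using bump_node_eq_0[OF n that ij(1), of a b] bump_node_eq_0[OF n that ij(2), of a' b'] ab
      by (auto simp: \<phi>_def edge_x_tensor edge_y_tensor)
    then have "L2_inner v (grad \<phi>) + L2_inner (cell_div B1 B2) \<phi> = 0"
      unfolding Green_mesh[OF v C] by simp
    moreover have "L2_inner v (grad \<phi>) = - L2_inner d \<phi>"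
      using d \<phi> by (simp add: has_weak_div_def)
    ultimately have "L2_inner (\<lambda>p. d p - cell_div B1 B2 p) \<phi> = 0"
      using L2_inner_diff_left[OF L(1) L2_cell_div C_bar_L2(1)[OF C], of B1 B2] by simp
    then show "integral\<^sup>L (lebesgue_on Omega)
        (\<lambda>(x, y). (d (x, y) - cell_div B1 B2 (x, y)) * (bump a b n x * bump a' b' n y)) = 0"
      by (simp add: L2_inner_def \<phi>_def case_prod_unfold)
  qed
  then have "AE p in lebesgue_on Omega. \<forall>i\<in>{..<N}. \<forall>j\<in>{..<N}. p \<in> cell i j \<longrightarrow> d p - cell_div B1 B2 p = 0"
    by (intro AE_finite_allI) auto
  with AE_cell show ?thesis
    by eventually_elim auto
qed

text \<open>A jump of the normal component across an interior edge is detected by a bump whose support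
  meets no other mesh line inside the two cells at that edge.\<close>

lemma normal_continuous_if_weak_div:
  assumes v: "rt_field v A1 B1 A2 B2" and d: "has_weak_div v d"
  shows "normal_continuous A1 B1 A2 B2"
proof -
  have Green: "L2_inner v (grad \<phi>) + L2_inner (cell_div B1 B2) \<phi> = 0" if "test_function \<phi>" for \<phi>
  proof -
    have "L2 \<phi>" by (rule C_bar_L2(1)[OF test_function_C_bar[OF that]])
    then have "L2_inner d \<phi> = L2_inner (cell_div B1 B2) \<phi>"
      using d weak_div_AE_cell_div[OF v d] L2_cell_div
      by (intro L2_inner_cong_AE) (auto simp: has_weak_div_def)
    then show ?thesis using d that by (simp add: has_weak_div_def)
  qed
  have interior: "\<exists>n>0. bump (xs i) (xs (Suc (Suc i))) n (xs (Suc i)) > 0" if "Suc i < N" for i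
  proof -
    have "xs i < xs (Suc i)" "xs (Suc i) < xs (Suc (Suc i))" using xs_less_Suc that by auto
    then have "0 < min (xs (Suc i) - xs i) (xs (Suc (Suc i)) - xs (Suc i))" by simp
    from reals_Archimedean[OF this] obtain n
      where "inverse (real (Suc n)) < min (xs (Suc i) - xs i) (xs (Suc (Suc i)) - xs (Suc i))" by blast
    then show ?thesis
      by (intro exI[of _ "Suc n"] conjI bump_pos) (auto simp: inverse_eq_divide)
  qed
  have off: "bump (xs i) (xs (Suc (Suc i))) n (xs k) = 0" if "k \<noteq> Suc i" "k \<le> N" "Suc i < N" "n > 0" for i k n
  proof (rule bump_eq_0)
    have "k \<le> i \<or> Suc (Suc i) \<le> k" using that by linarith
    then show "xs k \<le> xs i \<or> xs (Suc (Suc i)) \<le> xs k"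
      using xs_le[of k i] xs_le[of "Suc (Suc i)" k] that by auto
  qed (use that in auto)
  have pos: "\<exists>n>0. integral {xs j..xs (Suc j)} (bump (xs j) (xs (Suc j)) n) > 0" if j: "j < N" for j
  proof -
    have "0 < (xs (Suc j) - xs j) / 2" using xs_less_Suc[OF j] by simp
    from reals_Archimedean[OF this] obtain n where n: "inverse (real (Suc n)) < (xs (Suc j) - xs j) / 2" by blast
    let ?b = "bump (xs j) (xs (Suc j)) (Suc n)" and ?m = "(xs j + xs (Suc j)) / 2"
    have cont: "continuous_on {xs j..xs (Suc j)} ?b"
      using C_line_bump[of 0] by (auto intro: continuous_on_subset)
    have "?b ?m > 0"
      using n by (intro bump_pos) (auto simp: inverse_eq_divide field_simps)
    moreover have "?m \<in> {xs j..xs (Suc j)}" using xs_less_Suc[OF j] by (auto simp: field_simps)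
    ultimately have "integral {xs j..xs (Suc j)} ?b \<noteq> 0"
      using integral_eq_0_iff[OF cont xs_less_Suc[OF j] bump_bounds(1)] by auto
    moreover have "integral {xs j..xs (Suc j)} ?b \<ge> 0"
      using bump_bounds(1) by (intro integral_nonneg integrable_continuous_interval cont)
    ultimately show ?thesis by (intro exI[of _ "Suc n"]) auto
  qed
  have int0: "integral {xs m..xs (Suc m)} (bump (xs j) (xs (Suc j)) n) = 0"
    if "m < N" "j < N" "m \<noteq> j" "n > 0" for m j n
  proof (rule integral_unique, rule has_integral_is_0)
    fix t assume t: "t \<in> {xs m..xs (Suc m)}"
    have "Suc m \<le> j \<or> Suc j \<le> m" using that by linarith
    then show "bump (xs j) (xs (Suc j)) n t = 0"
      using xs_le[of "Suc m" j] xs_le[of "Suc j" m] t that by (intro bump_eq_0) auto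
  qed
  show ?thesis
    unfolding normal_continuous_def
  proof (intro conjI allI impI)
    fix i j assume ij: "Suc i < N" "j < N"
    obtain n where n: "n > 0" "bump (xs i) (xs (Suc (Suc i))) n (xs (Suc i)) > 0"
      using interior[OF ij(1)] by blast
    obtain n' where n': "n' > 0" "integral {xs j..xs (Suc j)} (bump (xs j) (xs (Suc j)) n') > 0"
      using pos[OF ij(2)] by blast
    define X where "X = bump (xs i) (xs (Suc (Suc i))) n"
    define Y where "Y = bump (xs j) (xs (Suc j)) n'"
    define \<phi> where "\<phi> = (\<lambda>(x, y). X x * Y y)"
    have \<phi>: "test_function \<phi>"
      unfolding \<phi>_def X_def Y_def
      by (rule test_function_bump)
        (use n n' ij xs_01[of i] xs_01[of j] xs_01[of "Suc (Suc i)"] xs_01[of "Suc j"]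
          xs_le[of i "Suc (Suc i)"] xs_le[of j "Suc j"] in auto)
    have y: "edge_y \<phi> m k = 0" if "k \<le> N" for k m
      using bump_node_eq_0[OF n'(1) that ij(2) order_refl order_refl] by (simp add: \<phi>_def edge_y_tensor Y_def)
    have x: "edge_x \<phi> k m = 0" if "k \<le> N" "m < N" "k \<noteq> Suc i \<or> m \<noteq> j" for k m
      using off[of k i n] int0[of m j n'] that ij n n' by (auto simp: \<phi>_def edge_x_tensor X_def Y_def)
    let ?a = "\<lambda>k m. A1 k m + B1 k m * xs (Suc k)" and ?b = "\<lambda>k m. A1 k m + B1 k m * xs k"
    have "0 = (\<Sum>m<N. \<Sum>k<N. ?a k m * edge_x \<phi> (Suc k) m - ?b k m * edge_x \<phi> k m)"
      using Green[OF \<phi>] y by (simp add: Green_mesh[OF v test_function_C_bar[OF \<phi>]])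
    also have "\<dots> = (\<Sum>m<N. if m = j then (?a i j - ?b (Suc i) j) * edge_x \<phi> (Suc i) j else 0)"
    proof (intro sum.cong refl)
      fix m assume "m \<in> {..<N}"
      then show "(\<Sum>k<N. ?a k m * edge_x \<phi> (Suc k) m - ?b k m * edge_x \<phi> k m)
          = (if m = j then (?a i j - ?b (Suc i) j) * edge_x \<phi> (Suc i) j else 0)"
        using x sum_jump[of i N "\<lambda>k. edge_x \<phi> k j" "\<lambda>k. ?a k j" "\<lambda>k. ?b k j"] ij by auto
    qed
    also have "\<dots> = (?a i j - ?b (Suc i) j) * edge_x \<phi> (Suc i) j"
      using ij by (simp add: sum.delta)
    finally show "?a i j = ?b (Suc i) j"
      using n n' by (simp add: \<phi>_def edge_x_tensor X_def Y_def)
  next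
    fix i j assume ij: "i < N" "Suc j < N"
    obtain n where n: "n > 0" "bump (xs j) (xs (Suc (Suc j))) n (xs (Suc j)) > 0"
      using interior[OF ij(2)] by blast
    obtain n' where n': "n' > 0" "integral {xs i..xs (Suc i)} (bump (xs i) (xs (Suc i)) n') > 0"
      using pos[OF ij(1)] by blast
    define X where "X = bump (xs i) (xs (Suc i)) n'"
    define Y where "Y = bump (xs j) (xs (Suc (Suc j))) n"
    define \<phi> where "\<phi> = (\<lambda>(x, y). X x * Y y)"
    have \<phi>: "test_function \<phi>"
      unfolding \<phi>_def X_def Y_def
      by (rule test_function_bump)
        (use n n' ij xs_01[of i] xs_01[of j] xs_01[of "Suc (Suc j)"] xs_01[of "Suc i"]
          xs_le[of j "Suc (Suc j)"] xs_le[of i "Suc i"] in auto)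
    have x: "edge_x \<phi> k m = 0" if "k \<le> N" for k m
      using bump_node_eq_0[OF n'(1) that ij(1) order_refl order_refl] by (simp add: \<phi>_def edge_x_tensor X_def)
    have y: "edge_y \<phi> m k = 0" if "k \<le> N" "m < N" "k \<noteq> Suc j \<or> m \<noteq> i" for k m
      using off[of k j n] int0[of m i n'] that ij n n' by (auto simp: \<phi>_def edge_y_tensor X_def Y_def)
    let ?a = "\<lambda>m k. A2 m k + B2 m k * xs (Suc k)" and ?b = "\<lambda>m k. A2 m k + B2 m k * xs k"
    have "0 = (\<Sum>m<N. \<Sum>k<N. ?a m k * edge_y \<phi> m (Suc k) - ?b m k * edge_y \<phi> m k)"
      using Green[OF \<phi>] x by (simp add: Green_mesh[OF v test_function_C_bar[OF \<phi>]])
    also have "\<dots> = (\<Sum>m<N. if m = i then (?a i j - ?b i (Suc j)) * edge_y \<phi> i (Suc j) else 0)"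
    proof (intro sum.cong refl)
      fix m assume "m \<in> {..<N}"
      then show "(\<Sum>k<N. ?a m k * edge_y \<phi> m (Suc k) - ?b m k * edge_y \<phi> m k)
          = (if m = i then (?a i j - ?b i (Suc j)) * edge_y \<phi> i (Suc j) else 0)"
        using y sum_jump[of j N "\<lambda>k. edge_y \<phi> i k" "\<lambda>k. ?a i k" "\<lambda>k. ?b i k"] ij by auto
    qed
    also have "\<dots> = (?a i j - ?b i (Suc j)) * edge_y \<phi> i (Suc j)"
      using ij by (simp add: sum.delta)
    finally show "?a i j = ?b i (Suc j)"
      using n n' by (simp add: \<phi>_def edge_y_tensor X_def Y_def)
  qed
qed

end

section \<open>Quasi-optimality of the mixed method\<close>

lemma L2_inner_diff_self:
  assumes "L2 g" "L2 h"
  shows "L2_inner (\<lambda>p. g p - h p) (\<lambda>p. g p - h p) = L2_inner g g - 2 * L2_inner g h + L2_inner h h"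
  using assms by (simp add: L2_inner_diff_left L2_inner_diff_right L2_diff L2_inner_commute[of h g])

lemma L2_inner_diff_self_le:
  assumes "L2 g" "L2 h"
  shows "L2_inner (\<lambda>p. g p - h p) (\<lambda>p. g p - h p) \<le> 2 * L2_inner g g + 2 * L2_inner h h"
proof -
  have "0 \<le> L2_inner (\<lambda>p. g p + h p) (\<lambda>p. g p + h p)" by (rule L2_inner_self_nonneg)
  also have "\<dots> = L2_inner g g + 2 * L2_inner g h + L2_inner h h"
    using assms by (simp add: L2_inner_add_left L2_inner_add_right L2_add L2_inner_commute[of h g])
  finally show ?thesis using L2_inner_diff_self[OF assms] by simp
qed

lemma L2_inner_self_cong_AE:
  assumes "AE p in lebesgue_on Omega. g p = h p" "L2 g" "L2 h"
  shows "L2_inner g g = L2_inner h h"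
  using L2_inner_cong_AE[OF assms assms(2)] L2_inner_cong_AE[OF assms assms(3)]
  by (simp add: L2_inner_commute)

context shishkin_mesh
begin

lemma cell_div_diff:
  "cell_div (\<lambda>i j. B1 i j - B1' i j) (\<lambda>i j. B2 i j - B2' i j) = (\<lambda>p. cell_div B1 B2 p - cell_div B1' B2' p)"
  unfolding piecewise_def
  by (simp add: fun_eq_iff algebra_simps flip: sum_subtractf)

lemma cell_div_in_W_space: "cell_div B1 B2 \<in> W_space l N"
  using piecewise_cell[where F = "\<lambda>i j _. B1 i j + B2 i j"] L2_cell_div unfolding W_space_def by blast

lemma W_space_combine:
  assumes "w \<in> W_space l N" "w' \<in> W_space l N"
  shows "(\<lambda>p. a * w p + b * w' p) \<in> W_space l N"
proof -
  have "\<exists>s. \<forall>p\<in>cell i j. a * w p + b * w' p = s" if "i < N" "j < N" for i j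
  proof -
    have "\<exists>s. \<forall>p\<in>cell i j. w p = s" "\<exists>s. \<forall>p\<in>cell i j. w' p = s"
      using assms that by (simp_all add: W_space_def)
    then obtain s s' where "\<forall>p\<in>cell i j. w p = s" "\<forall>p\<in>cell i j. w' p = s'" by blast
    then show ?thesis by (intro exI[of _ "a * s + b * s'"]) simp
  qed
  moreover have "L2 (\<lambda>p. a * w p + b * w' p)"
    using assms by (intro L2_add L2_mult) (simp_all add: W_space_def)
  ultimately show ?thesis by (simp add: W_space_def)
qed

lemma weak_div_has_weak_div:
  assumes "v \<in> V_space l N"
  shows "has_weak_div v (weak_div v)"
proof -
  have "\<exists>d. has_weak_div v d" using assms by (simp add: V_space_def H_div_def)
  then show ?thesis unfolding weak_div_def by (rule someI_ex)
qed

lemma rt_field_diff: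
  assumes "rt_field v A1 B1 A2 B2" "rt_field v' A1' B1' A2' B2'"
  shows "rt_field (\<lambda>p. v p - v' p) (\<lambda>i j. A1 i j - A1' i j) (\<lambda>i j. B1 i j - B1' i j)
    (\<lambda>i j. A2 i j - A2' i j) (\<lambda>i j. B2 i j - B2' i j)"
proof -
  have "(v (x, y) - v' (x, y)) = (A1 i j - A1' i j + (B1 i j - B1' i j) * x, A2 i j - A2' i j + (B2 i j - B2' i j) * y)"
    if "i < N" "j < N" "(x, y) \<in> cell i j" for i j x y
    unfolding rt_fieldD[OF assms(1) that] rt_fieldD[OF assms(2) that] by (simp add: left_diff_distrib)
  moreover have "L2 (\<lambda>p. v p - v' p)" using assms by (intro L2_diff) (simp_all add: rt_field_def)
  ultimately show ?thesis unfolding rt_field_def by blast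
qed

lemma normal_continuous_diff:
  assumes "normal_continuous A1 B1 A2 B2" "normal_continuous A1' B1' A2' B2'"
  shows "normal_continuous (\<lambda>i j. A1 i j - A1' i j) (\<lambda>i j. B1 i j - B1' i j)
    (\<lambda>i j. A2 i j - A2' i j) (\<lambda>i j. B2 i j - B2' i j)"
proof -
  have *: "(a - a') + (b - b') * x = (s - s') + (t - t') * x" if "a + b * x = s + t * x" "a' + b' * x = s' + t' * x"
    for a a' b b' s s' t t' x :: real
  proof -
    have "(a - a') + (b - b') * x = (a + b * x) - (a' + b' * x)" by (simp add: algebra_simps)
    then show ?thesis unfolding that by (simp add: algebra_simps)
  qed
  show ?thesis
    unfolding normal_continuous_def
    by (intro conjI allI impI; rule *) (use assms in \<open>simp_all add: normal_continuous_def\<close>)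
qed

text \<open>Testing the second equation with \<open>v\<close> and the first with its divergence makes the error
  orthogonal to the discrete space for the inner product
  \<open>(p, v) + (\<epsilon> / c) (div p, div v)\<close>.  The flux is therefore the best approximation in the
  associated norm; the scalar error is then read off the first equation.\<close>

lemma mixed_fem_quasi_optimal:
  assumes c: "c > 0" and \<epsilon>: "\<epsilon> > 0" and f: "C_bar 2 f" and u: "bvp_solution c f \<epsilon> u"
    and uN: "uN \<in> W_space l N" and qN: "qN \<in> V_space l N"
    and eq1: "\<And>w. w \<in> W_space l N \<Longrightarrow> \<epsilon> * L2_inner (weak_div qN) w + c * L2_inner uN w = L2_inner f w"
    and eq2: "\<And>v. v \<in> V_space l N \<Longrightarrow> \<epsilon> * L2_inner qN v - \<epsilon> * L2_inner (weak_div v) uN = 0"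
    and v: "rt_field v A1 B1 A2 B2" and nc: "normal_continuous A1 B1 A2 B2"
    and fN: "fN \<in> W_space l N"
  defines "e \<equiv> \<lambda>p. - grad u p - qN p" and "div_e \<equiv> \<lambda>p. - laplacian u p - weak_div qN p"
    and "\<eta> \<equiv> \<lambda>p. - grad u p - v p" and "div_\<eta> \<equiv> \<lambda>p. - laplacian u p - cell_div B1 B2 p"
  shows "L2_inner e e + \<epsilon> / c * L2_inner div_e div_e \<le> L2_inner \<eta> \<eta> + \<epsilon> / c * L2_inner div_\<eta> div_\<eta>"
    and "c\<^sup>2 * L2_inner (\<lambda>p. u p - uN p) (\<lambda>p. u p - uN p)
      \<le> 2 * L2_inner (\<lambda>p. f p - fN p) (\<lambda>p. f p - fN p) + 2 * \<epsilon>\<^sup>2 * L2_inner div_e div_e"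
proof -
  define dN where "dN = weak_div qN"
  obtain a1 b1 a2 b2 where q: "rt_field qN a1 b1 a2 b2" using V_space_rt[OF qN] .
  have dN: "has_weak_div qN dN" unfolding dN_def by (rule weak_div_has_weak_div[OF qN])
  have dN_AE: "AE p in lebesgue_on Omega. dN p = cell_div b1 b2 p"
    by (rule weak_div_AE_cell_div[OF q dN])
  \<comment> \<open>The discrete part of the error; its cellwise divergence \<open>D\<close> may be used to test the first equation.\<close>
  define \<theta> where "\<theta> = (\<lambda>p. v p - qN p)"
  define D where "D = (\<lambda>p. cell_div B1 B2 p - cell_div b1 b2 p)"
  have D_eq: "D = cell_div (\<lambda>i j. B1 i j - b1 i j) (\<lambda>i j. B2 i j - b2 i j)"
    unfolding D_def cell_div_diff ..
  have rt\<theta>: "rt_field \<theta> (\<lambda>i j. A1 i j - a1 i j) (\<lambda>i j. B1 i j - b1 i j) (\<lambda>i j. A2 i j - a2 i j) (\<lambda>i j. B2 i j - b2 i j)"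
    unfolding \<theta>_def by (rule rt_field_diff[OF v q])
  have nc\<theta>: "normal_continuous (\<lambda>i j. A1 i j - a1 i j) (\<lambda>i j. B1 i j - b1 i j) (\<lambda>i j. A2 i j - a2 i j) (\<lambda>i j. B2 i j - b2 i j)"
    by (rule normal_continuous_diff[OF nc normal_continuous_if_weak_div[OF q dN]])
  have \<theta>V: "\<theta> \<in> V_space l N"
    by (rule rt_in_V_space[OF rt\<theta> rt_has_weak_div[OF rt\<theta> nc\<theta>]])
  have D_W: "D \<in> W_space l N" unfolding D_eq by (rule cell_div_in_W_space)
  have u2: "C_bar 2 u" and u_eq: "\<And>p. p \<in> Omega \<Longrightarrow> - \<epsilon> * laplacian u p + c * u p = f p"
    and u_bd: "\<And>p. p \<in> Omega_bar - Omega \<Longrightarrow> u p = 0"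
    using u unfolding bvp_solution_def by blast+
  have u1: "C_bar (Suc 0) u" "C_bar (Suc 0) (dx u)" "C_bar (Suc 0) (dy u)"
    using u2 by (auto simp: numeral_2_eq_2)
  have LAP: "L2 (laplacian u)"
    unfolding laplacian_def using u1 by (auto intro!: continuous_imp_L2 continuous_on_add)
  note U = C_bar_L2[OF u1(1)]
  have F: "L2 f" by (rule continuous_imp_L2) (rule C_bar_continuous[OF f])
  have L: "L2 \<theta>" "L2 D" "L2 qN" "L2 dN" "L2 uN" "L2 v" "L2 fN" "L2 e" "L2 div_e"
    using rt\<theta> q dN uN fN U LAP v L2_cell_div
    unfolding e_def div_e_def D_eq rt_field_def has_weak_div_def W_space_def dN_def
    by (auto intro!: L2_diff L2_uminus)
  note div_e_dN = div_e_def[folded dN_def]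

  have "L2_inner (weak_div \<theta>) uN = L2_inner D uN"
    using weak_div_AE_cell_div[OF rt\<theta> weak_div_has_weak_div[OF \<theta>V]] weak_div_has_weak_div[OF \<theta>V] L
    unfolding D_eq[symmetric] by (intro L2_inner_cong_AE) (auto simp: has_weak_div_def)
  then have E1: "L2_inner qN \<theta> = L2_inner D uN"
    using eq2[OF \<theta>V] \<epsilon> by (simp flip: right_diff_distrib)
  have E2: "L2_inner \<theta> (grad u) = - L2_inner D u"
    unfolding D_eq by (rule Green_normal_continuous[OF rt\<theta> nc\<theta> u1(1) u_bd])
  have fD: "L2_inner f D = - \<epsilon> * L2_inner (laplacian u) D + c * L2_inner u D"
  proof -
    have "L2_inner f D = L2_inner (\<lambda>p. - \<epsilon> * laplacian u p + c * u p) D"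
      by (rule L2_inner_cong_Omega) (use u_eq in auto)
    also have "\<dots> = L2_inner (\<lambda>p. - \<epsilon> * laplacian u p) D + L2_inner (\<lambda>p. c * u p) D"
      by (intro L2_inner_add_left L2_mult LAP U L)
    finally show ?thesis by (simp only: L2_inner_mult_left)
  qed
  have e\<theta>: "L2_inner e \<theta> = L2_inner D u - L2_inner D uN"
    unfolding e_def using L U E1 E2
    by (subst L2_inner_diff_left) (auto intro: L2_uminus simp: L2_inner_uminus_left L2_inner_commute)
  have "L2_inner div_e D = - L2_inner (laplacian u) D - L2_inner dN D"
    unfolding div_e_dN using L LAP
    by (subst L2_inner_diff_left) (auto intro: L2_uminus simp: L2_inner_uminus_left)
  then have "\<epsilon> * L2_inner div_e D = - \<epsilon> * L2_inner (laplacian u) D - \<epsilon> * L2_inner dN D"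
    by (simp add: right_diff_distrib)
  moreover have "c * L2_inner e \<theta> = c * L2_inner u D - c * L2_inner uN D"
    unfolding e\<theta> by (simp add: right_diff_distrib L2_inner_commute)
  ultimately have "\<epsilon> * L2_inner div_e D = - c * L2_inner e \<theta>"
    using eq1[OF D_W, folded dN_def] fD by linarith
  then have orth: "L2_inner e \<theta> + \<epsilon> / c * L2_inner div_e D = 0"
    using c by (simp add: field_simps)
  have "\<eta> = (\<lambda>p. e p - \<theta> p)" by (auto simp: \<eta>_def e_def \<theta>_def)
  then have \<eta>: "L2_inner \<eta> \<eta> = L2_inner e e - 2 * L2_inner e \<theta> + L2_inner \<theta> \<theta>"
    using L2_inner_diff_self[OF L(8,1)] by simp
  have "L2_inner div_\<eta> div_\<eta> = L2_inner (\<lambda>p. div_e p - D p) (\<lambda>p. div_e p - D p)"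
  proof (rule L2_inner_self_cong_AE)
    show "AE p in lebesgue_on Omega. div_\<eta> p = div_e p - D p"
      using dN_AE by eventually_elim (simp add: div_\<eta>_def div_e_dN D_def)
  qed (use L LAP L2_cell_div in \<open>auto simp: div_\<eta>_def intro!: L2_diff L2_uminus\<close>)
  also have "\<dots> = L2_inner div_e div_e - 2 * L2_inner div_e D + L2_inner D D"
    by (rule L2_inner_diff_self[OF L(9,2)])
  finally have div_\<eta>: "L2_inner div_\<eta> div_\<eta> = \<dots>" .
  have "L2_inner \<eta> \<eta> + \<epsilon> / c * L2_inner div_\<eta> div_\<eta>
      = L2_inner e e + \<epsilon> / c * L2_inner div_e div_e - 2 * (L2_inner e \<theta> + \<epsilon> / c * L2_inner div_e D)
        + (L2_inner \<theta> \<theta> + \<epsilon> / c * L2_inner D D)"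
    unfolding \<eta> div_\<eta> by (simp add: algebra_simps)
  moreover have "0 \<le> L2_inner \<theta> \<theta> + \<epsilon> / c * L2_inner D D"
    using c \<epsilon> by (intro add_nonneg_nonneg mult_nonneg_nonneg L2_inner_self_nonneg) auto
  ultimately show "L2_inner e e + \<epsilon> / c * L2_inner div_e div_e \<le> L2_inner \<eta> \<eta> + \<epsilon> / c * L2_inner div_\<eta> div_\<eta>"
    using orth by simp

  \<comment> \<open>By the first equation \<open>g\<close> is the \<open>L_2\<close> projection of \<open>f\<close>; \<open>g'\<close> is a representative of it that is
    constant on each cell.\<close>
  define g where "g = (\<lambda>p. \<epsilon> * dN p + c * uN p)"
  define g' where "g' = (\<lambda>p. \<epsilon> * cell_div b1 b2 p + c * uN p)"
  define r where "r = (\<lambda>p. f p - g p)"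
  define s where "s = (\<lambda>p. fN p - g' p)"
  have g'W: "g' \<in> W_space l N" unfolding g'_def by (rule W_space_combine[OF cell_div_in_W_space uN])
  have sW: "s \<in> W_space l N"
    using W_space_combine[OF fN g'W, of 1 "-1"] by (simp add: s_def)
  have Lg: "L2 g" "L2 r" "L2 s" using L F sW unfolding g_def r_def
    by (auto intro!: L2_diff L2_add L2_mult simp: W_space_def)
  have rs: "L2_inner r s = 0"
  proof -
    have "L2_inner g s = \<epsilon> * L2_inner dN s + c * L2_inner uN s"
      unfolding g_def using L Lg by (subst L2_inner_add_left) (auto intro: L2_mult simp: L2_inner_mult_left)
    then show ?thesis
      unfolding r_def using eq1[OF sW, folded dN_def] F Lg by (simp add: L2_inner_diff_left)
  qed
  have "L2_inner (\<lambda>p. f p - fN p) (\<lambda>p. f p - fN p) = L2_inner (\<lambda>p. r p - s p) (\<lambda>p. r p - s p)"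
  proof (rule L2_inner_self_cong_AE)
    show "AE p in lebesgue_on Omega. f p - fN p = r p - s p"
      using dN_AE by eventually_elim (simp add: r_def s_def g_def g'_def)
  qed (use L Lg F in \<open>auto intro!: L2_diff\<close>)
  then have r_le: "L2_inner r r \<le> L2_inner (\<lambda>p. f p - fN p) (\<lambda>p. f p - fN p)"
    using L2_inner_diff_self[OF Lg(2,3)] rs L2_inner_self_nonneg[of s] by simp
  have "c\<^sup>2 * L2_inner (\<lambda>p. u p - uN p) (\<lambda>p. u p - uN p) = L2_inner (\<lambda>p. c * (u p - uN p)) (\<lambda>p. c * (u p - uN p))"
    by (simp add: L2_inner_mult_left L2_inner_mult_right power2_eq_square)
  also have "\<dots> = L2_inner (\<lambda>p. r p - \<epsilon> * div_e p) (\<lambda>p. r p - \<epsilon> * div_e p)"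
    by (rule L2_inner_cong_Omega; use u_eq in \<open>simp add: r_def g_def div_e_dN algebra_simps flip: u_eq\<close>)
  also have "\<dots> \<le> 2 * L2_inner r r + 2 * L2_inner (\<lambda>p. \<epsilon> * div_e p) (\<lambda>p. \<epsilon> * div_e p)"
    using L Lg by (intro L2_inner_diff_self_le L2_mult)
  also have "L2_inner (\<lambda>p. \<epsilon> * div_e p) (\<lambda>p. \<epsilon> * div_e p) = \<epsilon>\<^sup>2 * L2_inner div_e div_e"
    by (simp add: L2_inner_mult_left L2_inner_mult_right power2_eq_square)
  finally show "c\<^sup>2 * L2_inner (\<lambda>p. u p - uN p) (\<lambda>p. u p - uN p)
      \<le> 2 * L2_inner (\<lambda>p. f p - fN p) (\<lambda>p. f p - fN p) + 2 * \<epsilon>\<^sup>2 * L2_inner div_e div_e"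
    using r_le by simp
qed

end

section \<open>Interpolation of layers\<close>

lemma interpolation_error:
  fixes f f' f'' :: "real \<Rightarrow> real"
  assumes ab: "a < b" "{a..b} \<subseteq> {0..1}"
    and f: "\<And>x. x \<in> {a..b} \<Longrightarrow> (f has_real_derivative f' x) (at x within {0..1})"
    and f': "\<And>x. x \<in> {a..b} \<Longrightarrow> (f' has_real_derivative f'' x) (at x within {0..1})"
    and M1: "\<And>x. x \<in> {a..b} \<Longrightarrow> \<bar>f' x\<bar> \<le> M1" and M2: "\<And>x. x \<in> {a..b} \<Longrightarrow> \<bar>f'' x\<bar> \<le> M2"
    and x: "x \<in> {a..b}"
  shows "\<bar>f x - (f a + (f b - f a) / (b - a) * (x - a))\<bar> \<le> 2 * M1 * (b - a)"
    and "\<bar>f' x - (f b - f a) / (b - a)\<bar> \<le> M2 * (b - a)"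
proof -
  obtain \<xi> where \<xi>: "a < \<xi>" "\<xi> < b" "f b - f a = f' \<xi> * (b - a)"
    using MVT_within[OF ab f] .
  then have slope: "(f b - f a) / (b - a) = f' \<xi>" using ab by simp
  have \<xi>': "\<xi> \<in> {a..b}" using \<xi> by simp
  have M: "0 \<le> M1" "0 \<le> M2" using M1[OF x] M2[OF x] by linarith+
  have "\<bar>f x - f a\<bar> \<le> M1 * \<bar>x - a\<bar>"
    by (rule Lipschitz_within[OF f ab(2) M1]) (use ab x in auto)
  also have "\<dots> \<le> M1 * (b - a)" using x M by (intro mult_left_mono) auto
  finally have 1: "\<bar>f x - f a\<bar> \<le> M1 * (b - a)" .
  have "\<bar>f' \<xi> * (x - a)\<bar> \<le> M1 * (b - a)"
    unfolding abs_mult using x M M1[OF \<xi>'] by (intro mult_mono) auto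
  then show "\<bar>f x - (f a + (f b - f a) / (b - a) * (x - a))\<bar> \<le> 2 * M1 * (b - a)"
    using 1 unfolding slope by linarith
  have "\<bar>f' x - f' \<xi>\<bar> \<le> M2 * \<bar>x - \<xi>\<bar>"
    by (rule Lipschitz_within[OF f' ab(2) M2]) (use x \<xi>' in auto)
  also have "\<dots> \<le> M2 * (b - a)" using x \<xi>' M by (intro mult_left_mono) auto
  finally show "\<bar>f' x - (f b - f a) / (b - a)\<bar> \<le> M2 * (b - a)" unfolding slope .
qed

locale shishkin_layer = shishkin_mesh +
  fixes c \<epsilon> :: real
  assumes c: "c > 0" and \<epsilon>: "0 < \<epsilon>" "\<epsilon> \<le> 1" and l_eq: "l = shishkin_lam c \<epsilon> N"
begin

abbreviation r :: real where "r \<equiv> sqrt \<epsilon>"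
abbreviation s :: real where "s \<equiv> sqrt (c / \<epsilon>)"

definition \<delta> :: real where "\<delta> = ln (real N) / real N"

lemma r: "0 < r" "r \<le> 1" "r\<^sup>2 = \<epsilon>"
  using \<epsilon> by auto

lemma s_r: "s = sqrt c / r" by (simp add: real_sqrt_divide)

lemma s_pos: "0 < s" using c \<epsilon> by simp

lemma N_ge: "4 \<le> N" using N by (auto elim!: dvdE)

lemma ln_N: "1 \<le> ln (real N)" "ln (real N) \<le> real N"
proof -
  have "exp 1 \<le> (real N)" using exp_le N_ge by linarith
  then show "1 \<le> ln (real N)" using N by (subst ln_ge_iff) auto
  show "ln (real N) \<le> real N" using ln_le_minus_one[of "real N"] N by auto
qed

lemma \<delta>: "1 / N \<le> \<delta>" "0 < \<delta>" "\<delta> \<le> 1"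
proof -
  show "1 / N \<le> \<delta>" unfolding \<delta>_def using ln_N N by (intro divide_right_mono) auto
  show "0 < \<delta>" unfolding \<delta>_def using ln_N N by (intro divide_pos_pos) linarith+
  show "\<delta> \<le> 1" unfolding \<delta>_def using ln_N N by simp
qed

lemma fine_width: "4 * l / N = 8 / sqrt c * r * \<delta>"
  by (simp add: l_eq shishkin_lam_def \<delta>_def)

lemma s_fine_width: "s * (4 * l / N) \<le> 8"
proof -
  have "s * (4 * l / N) = 8 * \<delta>"
    unfolding fine_width s_r using r(1) c by simp
  then show ?thesis using \<delta> by simp
qed

lemma exp_transition: "exp (- l * s / 2) = 1 / N"
proof -
  have "l * s = 2 * ln (real N)"
    using r c by (simp add: s_r l_eq shishkin_lam_def field_simps)
  then have "exp (- l * s / 2) = exp (- ln (real N))" by simp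
  then show ?thesis using N by (simp add: exp_minus inverse_eq_divide)
qed

text \<open>The square root of the exponential bound of a layer at the left or right end. Of the two factors
  \<open>weight\<close> in that bound, one is kept for integration and the other one supplies a factor \<open>1 / N\<close>
  beyond the transition point.\<close>

definition weight :: "bool \<Rightarrow> real \<Rightarrow> real" where
  "weight right x = exp (- (if right then 1 - x else x) * s / 2)"

definition weights :: "real \<Rightarrow> real" where
  "weights x = weight False x + weight True x"

definition transition :: "bool \<Rightarrow> real" where
  "transition right = (if right then 1 - l else l)"

text \<open>The projection onto the side of the transition point where the layer is.\<close>

definition clip :: "bool \<Rightarrow> real \<Rightarrow> real" where
  "clip right x = (if right then max x (1 - l) else min x l)"

lemma weight_pos: "0 < weight b x" by (simp add: weight_def)

lemma weight_le_1: "x \<in> {0..1} \<Longrightarrow> weight b x \<le> 1"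
  using s_pos by (auto simp: weight_def)

lemma weight_le_weights: "weight b x \<le> weights x"
  using weight_pos[of True x] weight_pos[of False x] by (cases b) (auto simp: weights_def)

lemma weights_pos: "0 < weights x"
  using weight_pos weight_le_weights by (rule less_le_trans)

lemma weight_sq: "(weight b x)\<^sup>2 = exp (- (if b then 1 - x else x) * s)"
  by (simp add: weight_def power2_eq_square flip: exp_add)

lemma weight_sq_le: "x \<in> {0..1} \<Longrightarrow> (weight b x)\<^sup>2 \<le> weight b x"
  using weight_le_1[of x b] weight_pos[of b x] by (simp add: power2_eq_square mult_left_le)

lemma weight_transition: "weight b (transition b) = 1 / N"
  using exp_transition by (simp add: weight_def transition_def)

lemma weight_sq_middle:
  assumes "y \<in> {l..1 - l}"
  shows "(weight b y)\<^sup>2 \<le> (1 / N)\<^sup>2"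
proof -
  have "weight b y \<le> weight b (transition b)"
    using assms s_pos by (auto simp: weight_def transition_def intro!: mult_right_mono)
  then show ?thesis using weight_pos[of b y] by (intro power_mono) (auto simp: weight_transition)
qed

text \<open>Over the width of a fine interval the exponential changes by a bounded factor, so a supremum over
  the interval may be replaced by the value at any of its points.\<close>

lemma weight_sq_ratio:
  assumes "x \<in> {a..a + 4 * l / N}" "t \<in> {a..a + 4 * l / N}"
  shows "(weight b t)\<^sup>2 \<le> exp 8 * (weight b x)\<^sup>2"
proof -
  let ?d = "\<lambda>x. if b then 1 - x else x"
  have "s * (?d x - ?d t) \<le> s * (4 * l / N)"
    using s_pos assms by (intro mult_left_mono) auto
  then have "- ?d t * s \<le> 8 + - ?d x * s"
    using s_fine_width by (simp add: algebra_simps)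
  then show ?thesis unfolding weight_sq by (simp flip: exp_add)
qed

text \<open>For a layer at one end every mesh interval is either fine and on the layer side of the transition
  point, or entirely beyond it; the fine intervals at the opposite end belong to the second kind.\<close>

lemma fine_or_coarse:
  assumes i: "i < N"
  obtains (fine) "clip b (xs i) = xs i" "clip b (xs (Suc i)) = xs (Suc i)" "xs (Suc i) - xs i = 4 * l / N"
      "\<And>x. x \<in> {xs i..xs (Suc i)} \<Longrightarrow> 1 / N \<le> weight b x"
  | (coarse) "clip b (xs i) = transition b" "clip b (xs (Suc i)) = transition b"
      "\<And>x. x \<in> {xs i..xs (Suc i)} \<Longrightarrow> weight b x \<le> 1 / N"
proof -
  have mono: "weight b x \<le> weight b x'" if "if b then x \<le> x' else x' \<le> x" for x x'
    using that s_pos by (auto simp: weight_def intro!: mult_right_mono split: if_splits)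
  have i1: "xs i < xs (Suc i)" using xs_less_Suc[OF i] .
  show ?thesis
  proof (cases b)
    case False
    note w = weight_transition[of b, unfolded transition_def, simplified False if_False]
    show ?thesis
    proof (cases "i < N div 4")
      case True
      then have "xs (Suc i) \<le> l" using xs_le[of "Suc i" "N div 4"] xs_transition N by auto
      then show ?thesis
        using False w i1 mono[of l] xs_Suc_diff[OF i] True by (intro fine) (auto simp: clip_def)
    next
      case False': False
      then have "l \<le> xs i" using xs_le[of "N div 4" i] xs_transition i by auto
      then show ?thesis
        using False w i1 mono[of _ l] by (intro coarse) (auto simp: clip_def transition_def)
    qed
  next
    case True
    note w = weight_transition[of b, unfolded transition_def, simplified True if_True]
    show ?thesis
    proof (cases "3 * (N div 4) \<le> i")
      case T: True
      then have "1 - l \<le> xs i" using xs_le[of "3 * (N div 4)" i] xs_transition' i by auto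
      then show ?thesis
        using True w i1 mono[of "1 - l"] xs_Suc_diff[OF i] T by (intro fine) (auto simp: clip_def)
    next
      case False
      have "3 * (N div 4) \<le> N" using N by auto
      then have "xs (Suc i) \<le> 1 - l"
        using xs_le[of "Suc i" "3 * (N div 4)"] xs_transition' False by auto
      then show ?thesis
        using True w i1 mono[of _ "1 - l"] by (intro coarse) (auto simp: clip_def transition_def)
    qed
  qed
qed

subsection \<open>Oscillation along an edge\<close>

text \<open>Comparison with the value at the lower node only, because that is where the approximant takes the
  tangential variable.\<close>

definition osc :: "real \<Rightarrow> (real \<Rightarrow> real) \<Rightarrow> bool" where
  "osc M q \<longleftrightarrow> (\<forall>j<N. \<forall>y\<in>{xs j..xs (Suc j)}. \<bar>q y - q (xs j)\<bar> \<le> M * \<delta>)"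

lemma mesh_interval_subset: "j < N \<Longrightarrow> {xs j..xs (Suc j)} \<subseteq> {0..1}"
  using xs_01[of j] xs_01[of "Suc j"] by auto

text \<open>One constant for both kinds of oscillation below: \<open>2\<close> comes from the coarse width \<open>2 / N\<close> and from
  two small values, \<open>8 / sqrt c\<close> from the fine width.\<close>

definition \<kappa> :: real where "\<kappa> = 2 + 8 / sqrt c"

lemma \<kappa>: "2 \<le> \<kappa>" using c by (simp add: \<kappa>_def)

lemma osc_smooth:
  assumes q: "\<And>y. y \<in> {0..1} \<Longrightarrow> (q has_real_derivative q' y) (at y within {0..1})"
    and R: "\<And>y. y \<in> {0..1} \<Longrightarrow> \<bar>q' y\<bar> \<le> R"
  shows "osc (\<kappa> * R) q"
  unfolding osc_def
proof (intro allI impI ballI)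
  fix j y assume j: "j < N" and y: "y \<in> {xs j..xs (Suc j)}"
  have R0: "0 \<le> R" using R[of 0] by force
  have "\<bar>q y - q (xs j)\<bar> \<le> R * \<bar>y - xs j\<bar>"
    by (rule Lipschitz_within[OF q order_refl R]) (use mesh_interval_subset[OF j] y xs_01[of j] j in auto)
  also have "\<dots> \<le> R * (2 / N)"
    using xs_width_le[OF j] y R0 by (intro mult_left_mono) auto
  also have "\<dots> \<le> 2 * R * \<delta>"
    using mult_left_mono[OF \<delta>(1), of "2 * R"] R0 by (simp add: mult_ac)
  also have "\<dots> \<le> \<kappa> * R * \<delta>"
    using \<kappa> R0 \<delta> by (intro mult_right_mono) auto
  finally show "\<bar>q y - q (xs j)\<bar> \<le> \<kappa> * R * \<delta>" .
qed

text \<open>On the fine intervals the width compensates the large derivative; on the coarse ones the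
  function itself is at most \<open>R / N\<^sup>2\<close>.\<close>

lemma osc_layer:
  assumes q: "\<And>y. y \<in> {0..1} \<Longrightarrow> (q has_real_derivative q' y) (at y within {0..1})"
    and R: "0 \<le> R" "\<And>y. y \<in> {0..1} \<Longrightarrow> \<bar>q' y\<bar> \<le> R / r * (weight b y)\<^sup>2"
      "\<And>y. y \<in> {0..1} \<Longrightarrow> \<bar>q y\<bar> \<le> R * (weight b y)\<^sup>2"
  shows "osc (\<kappa> * R) q"
  unfolding osc_def \<kappa>_def
proof (intro allI impI ballI)
  fix j y assume j: "j < N" and y: "y \<in> {xs j..xs (Suc j)}"
  have y01: "y \<in> {0..1}" "xs j \<in> {0..1}" using mesh_interval_subset[OF j] y xs_less_Suc[OF j] by auto
  have Rc: "0 \<le> 8 / sqrt c * R * \<delta>" "0 \<le> 2 * R * \<delta>" using R c \<delta> by auto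
  show "\<bar>q y - q (xs j)\<bar> \<le> (2 + 8 / sqrt c) * R * \<delta>"
  proof (cases "j < N div 4 \<or> 3 * (N div 4) \<le> j")
    case True
    then have w: "xs (Suc j) - xs j = 8 / sqrt c * r * \<delta>"
      using xs_Suc_diff[OF j] fine_width by simp
    have "\<bar>q' y\<bar> \<le> R / r" if "y \<in> {0..1}" for y
    proof -
      have "R / r * (weight b y)\<^sup>2 \<le> R / r"
        using weight_sq_le[OF that, of b] weight_le_1[OF that, of b] R r
        by (intro mult_left_le) auto
      then show ?thesis using R(2)[OF that] by linarith
    qed
    then have "\<bar>q y - q (xs j)\<bar> \<le> R / r * \<bar>y - xs j\<bar>"
      using y01 by (intro Lipschitz_within[OF q order_refl])
    also have "\<dots> \<le> R / r * (8 / sqrt c * r * \<delta>)"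
      using w y R r by (intro mult_left_mono) auto
    also have "\<dots> = 8 / sqrt c * R * \<delta>" using r by simp
    finally show ?thesis using Rc by (simp add: distrib_right)
  next
    case False
    have "3 * (N div 4) \<le> N" using N by auto
    then have "l \<le> xs j" "xs (Suc j) \<le> 1 - l"
      using False xs_le[of "N div 4" j] xs_le[of "Suc j" "3 * (N div 4)"] xs_transition xs_transition' j by auto
    then have m: "y \<in> {l..1 - l}" "xs j \<in> {l..1 - l}" using y xs_less_Suc[OF j] by auto
    have "\<bar>q t\<bar> \<le> R * \<delta>" if "t \<in> {0..1}" "t \<in> {l..1 - l}" for t
    proof -
      have "(1 / real N)\<^sup>2 \<le> 1 / real N"
        using N by (simp add: power2_eq_square field_simps)
      then have "(weight b t)\<^sup>2 \<le> \<delta>" using weight_sq_middle[OF that(2), of b] \<delta>(1) by linarith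
      then have "R * (weight b t)\<^sup>2 \<le> R * \<delta>" using R by (intro mult_left_mono)
      then show ?thesis using R(3)[OF that(1)] by linarith
    qed
    then have "\<bar>q y\<bar> \<le> R * \<delta>" "\<bar>q (xs j)\<bar> \<le> R * \<delta>" using m y01 by auto
    then show ?thesis using Rc by (simp add: distrib_right)
  qed
qed

subsection \<open>Approximation of one flux component\<close>

definition slope :: "(real \<Rightarrow> real \<Rightarrow> real) \<Rightarrow> nat \<Rightarrow> nat \<Rightarrow> real" where
  "slope P i j = (P (xs (Suc i)) (xs j) - P (xs i) (xs j)) / (xs (Suc i) - xs i)"

text \<open>\<open>P\<close> carries the nodal values of the approximant, which is linear in the first variable and
  takes the second one at the lower node of its mesh interval. The two bounds are those whose
  \<open>L_2\<close> norms are \<open>O (\<delta> \<epsilon> powr (- 1 / 4))\<close> and \<open>O (\<delta> \<epsilon> powr (- 3 / 4))\<close>.\<close>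

definition approximates ::
  "real \<Rightarrow> (real \<Rightarrow> real \<Rightarrow> real) \<Rightarrow> (real \<Rightarrow> real \<Rightarrow> real) \<Rightarrow> (real \<Rightarrow> real \<Rightarrow> real) \<Rightarrow> bool" where
  "approximates K P p px \<longleftrightarrow> (\<forall>i<N. \<forall>j<N. \<forall>x\<in>{xs i..xs (Suc i)}. \<forall>y\<in>{xs j..xs (Suc j)}.
     \<bar>p x y - (P (xs i) (xs j) + slope P i j * (x - xs i))\<bar> \<le> K * \<delta> * (1 + weights x / r) \<and>
     \<bar>px x y - slope P i j\<bar> \<le> K * \<delta> * (1 / r + weights x / r\<^sup>2))"

lemma approximates_add:
  assumes "approximates K P p px" "approximates K' P' p' px'"
  shows "approximates (K + K') (\<lambda>x y. P x y + P' x y) (\<lambda>x y. p x y + p' x y) (\<lambda>x y. px x y + px' x y)"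
  unfolding approximates_def
proof (intro allI impI ballI)
  fix i j x y assume ij: "i < N" "j < N" and xy: "x \<in> {xs i..xs (Suc i)}" "y \<in> {xs j..xs (Suc j)}"
  let ?P = "\<lambda>x y. P x y + P' x y"
  have sl: "slope ?P i j = slope P i j + slope P' i j"
    by (simp add: slope_def add_divide_distrib[symmetric])
  have 1: "\<bar>p x y - (P (xs i) (xs j) + slope P i j * (x - xs i))\<bar> \<le> K * \<delta> * (1 + weights x / r)"
    "\<bar>px x y - slope P i j\<bar> \<le> K * \<delta> * (1 / r + weights x / r\<^sup>2)"
    using assms(1) ij xy unfolding approximates_def by blast+
  have 2: "\<bar>p' x y - (P' (xs i) (xs j) + slope P' i j * (x - xs i))\<bar> \<le> K' * \<delta> * (1 + weights x / r)"
    "\<bar>px' x y - slope P' i j\<bar> \<le> K' * \<delta> * (1 / r + weights x / r\<^sup>2)"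
    using assms(2) ij xy unfolding approximates_def by blast+
  have d: "(K + K') * \<delta> * t = K * \<delta> * t + K' * \<delta> * t" for t by (simp only: distrib_right)
  show "\<bar>p x y + p' x y - (?P (xs i) (xs j) + slope ?P i j * (x - xs i))\<bar> \<le> (K + K') * \<delta> * (1 + weights x / r) \<and>
     \<bar>px x y + px' x y - slope ?P i j\<bar> \<le> (K + K') * \<delta> * (1 / r + weights x / r\<^sup>2)"
    using 1 2 unfolding sl d distrib_right[of "slope P i j"] by linarith
qed

lemma approximates_smooth:
  assumes p: "\<And>x y. x \<in> {0..1} \<Longrightarrow> y \<in> {0..1} \<Longrightarrow> ((\<lambda>t. p t y) has_real_derivative px x y) (at x within {0..1})"
    and px: "\<And>x y. x \<in> {0..1} \<Longrightarrow> y \<in> {0..1} \<Longrightarrow> ((\<lambda>t. px t y) has_real_derivative pxx x y) (at x within {0..1})"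
    and K: "\<And>x y. x \<in> {0..1} \<Longrightarrow> y \<in> {0..1} \<Longrightarrow> \<bar>px x y\<bar> \<le> K"
      "\<And>x y. x \<in> {0..1} \<Longrightarrow> y \<in> {0..1} \<Longrightarrow> \<bar>pxx x y\<bar> \<le> K / r"
      "\<And>x. x \<in> {0..1} \<Longrightarrow> osc K (p x)" "\<And>x. x \<in> {0..1} \<Longrightarrow> osc (K / r) (px x)"
  shows "approximates (5 * K) p p px"
  unfolding approximates_def
proof (intro allI impI ballI)
  fix i j x y assume ij: "i < N" "j < N" and xy: "x \<in> {xs i..xs (Suc i)}" "y \<in> {xs j..xs (Suc j)}"
  have sub: "{xs i..xs (Suc i)} \<subseteq> {0..1}" using mesh_interval_subset ij(1) .
  have x01: "x \<in> {0..1}" and y01: "xs j \<in> {0..1}" using subsetD[OF sub xy(1)] xs_01[of j] ij by auto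
  have K0: "0 \<le> K" using K(1)[of 0 0] by force
  have h: "xs (Suc i) - xs i \<le> 2 * \<delta>" using xs_width_le[OF ij(1)] \<delta>(1) by linarith
  note I = interpolation_error[OF xs_less_Suc[OF ij(1)] sub, of "\<lambda>t. p t (xs j)" "\<lambda>t. px t (xs j)"
      "\<lambda>t. pxx t (xs j)" K "K / r" x, folded slope_def]
  have I1: "\<bar>p x (xs j) - (p (xs i) (xs j) + slope p i j * (x - xs i))\<bar> \<le> 2 * K * (xs (Suc i) - xs i)"
    by (rule I(1)) (simp_all add: p px K y01 xy(1) subsetD[OF sub] del: atLeastAtMost_iff)
  have I2: "\<bar>px x (xs j) - slope p i j\<bar> \<le> K / r * (xs (Suc i) - xs i)"
    by (rule I(2)) (simp_all add: p px K y01 xy(1) subsetD[OF sub] del: atLeastAtMost_iff)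
  have O: "\<bar>p x y - p x (xs j)\<bar> \<le> K * \<delta>" "\<bar>px x y - px x (xs j)\<bar> \<le> K / r * \<delta>"
    using K(3,4)[OF x01] ij xy unfolding osc_def by blast+
  have "2 * K * (xs (Suc i) - xs i) \<le> 2 * K * (2 * \<delta>)" "K / r * (xs (Suc i) - xs i) \<le> K / r * (2 * \<delta>)"
    using h K0 r by (intro mult_left_mono; simp)+
  then have A: "\<bar>p x y - (p (xs i) (xs j) + slope p i j * (x - xs i))\<bar> \<le> 5 * K * \<delta> * 1"
    "\<bar>px x y - slope p i j\<bar> \<le> 3 * (K / r * \<delta>)"
    using I1 I2 O by linarith+
  have "3 * (K / r * \<delta>) \<le> 5 * (K / r * \<delta>)"
    using K0 r \<delta> by (intro mult_right_mono mult_nonneg_nonneg divide_nonneg_pos) auto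
  then have A2: "\<bar>px x y - slope p i j\<bar> \<le> 5 * K * \<delta> * (1 / r)"
    using A(2) by simp
  have m: "5 * K * \<delta> * a \<le> 5 * K * \<delta> * (a + b)" if "0 \<le> b" for a b
    using K0 \<delta> that by (intro mult_left_mono) auto
  show "\<bar>p x y - (p (xs i) (xs j) + slope p i j * (x - xs i))\<bar> \<le> 5 * K * \<delta> * (1 + weights x / r) \<and>
     \<bar>px x y - slope p i j\<bar> \<le> 5 * K * \<delta> * (1 / r + weights x / r\<^sup>2)"
    using A(1) A2 m[of "weights x / r" 1] m[of "weights x / r\<^sup>2" "1 / r"] weights_pos[of x] r
    by (auto intro: order_trans)
qed

text \<open>Interpolating the layer itself would leave, in the first coarse interval, a residue of order
  \<open>1 / (r * N\<^sup>2)\<close> spread over the width \<open>1 / N\<close>, which is not small uniformly in \<open>\<epsilon>\<close>.  Subtracting the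
  value at the transition point and extending by \<open>0\<close> avoids this without changing the slope in
  the fine region.\<close>

lemma approximates_layer:
  assumes p: "\<And>x y. x \<in> {0..1} \<Longrightarrow> y \<in> {0..1} \<Longrightarrow> ((\<lambda>t. p t y) has_real_derivative px x y) (at x within {0..1})"
    and px: "\<And>x y. x \<in> {0..1} \<Longrightarrow> y \<in> {0..1} \<Longrightarrow> ((\<lambda>t. px t y) has_real_derivative pxx x y) (at x within {0..1})"
    and K0: "0 \<le> K" and K: "\<And>x y. x \<in> {0..1} \<Longrightarrow> y \<in> {0..1} \<Longrightarrow> \<bar>p x y\<bar> \<le> K / r * (weight b x)\<^sup>2"
      "\<And>x y. x \<in> {0..1} \<Longrightarrow> y \<in> {0..1} \<Longrightarrow> \<bar>px x y\<bar> \<le> K / r\<^sup>2 * (weight b x)\<^sup>2"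
      "\<And>x y. x \<in> {0..1} \<Longrightarrow> y \<in> {0..1} \<Longrightarrow> \<bar>pxx x y\<bar> \<le> K / r ^ 3 * (weight b x)\<^sup>2"
      "\<And>x. x \<in> {0..1} \<Longrightarrow> osc (K / r * (weight b x)\<^sup>2) (p x)"
      "\<And>x. x \<in> {0..1} \<Longrightarrow> osc (K / r\<^sup>2 * (weight b x)\<^sup>2) (px x)"
  shows "approximates ((5 + 16 * exp 8 / sqrt c) * K) (\<lambda>x y. p (clip b x) y - p (transition b) y) p px"
  unfolding approximates_def
proof (intro allI impI ballI)
  fix i j x y assume ij: "i < N" "j < N" and xy: "x \<in> {xs i..xs (Suc i)}" "y \<in> {xs j..xs (Suc j)}"
  let ?P = "\<lambda>x y. p (clip b x) y - p (transition b) y" and ?g = "weight b x"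
  define C where "C = 16 * exp 8 / sqrt c"
  have C0: "0 \<le> C" using c by (simp add: C_def)
  have sub: "{xs i..xs (Suc i)} \<subseteq> {0..1}" using mesh_interval_subset ij(1) .
  have x01: "x \<in> {0..1}" "y \<in> {0..1}" and y01: "xs j \<in> {0..1}"
    using subsetD[OF sub xy(1)] subsetD[OF mesh_interval_subset[OF ij(2)] xy(2)] xs_01[of j] ij by auto
  have g2: "?g\<^sup>2 \<le> ?g" "0 \<le> ?g" using weight_sq_le[OF x01(1)] weight_pos[of b x] by auto
  have Kr: "0 \<le> K / r" "0 \<le> K / r\<^sup>2" using K0 r by auto
  have goal: "\<bar>p x y - (?P (xs i) (xs j) + slope ?P i j * (x - xs i))\<bar> \<le> (5 + C) * (K / r * (\<delta> * ?g)) \<and>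
     \<bar>px x y - slope ?P i j\<bar> \<le> (5 + C) * (K / r\<^sup>2 * (\<delta> * ?g))"
    using ij(1)
  proof (cases rule: fine_or_coarse[where b = b, case_names fine coarse])
    case fine
    have t01: "transition b \<in> {0..1}" using l by (auto simp: transition_def)
    have ratio: "(weight b t)\<^sup>2 \<le> exp 8 * ?g\<^sup>2" if "t \<in> {xs i..xs (Suc i)}" for t
      using that xy fine(3) by (intro weight_sq_ratio[of _ "xs i"]) (simp_all add: diff_eq_eq add.commute)
    have sl: "slope ?P i j = slope p i j" using fine by (simp add: slope_def)
    note I = interpolation_error[OF xs_less_Suc[OF ij(1)] sub, of "\<lambda>t. p t (xs j)" "\<lambda>t. px t (xs j)"
        "\<lambda>t. pxx t (xs j)" "K / r\<^sup>2 * (exp 8 * ?g\<^sup>2)" "K / r ^ 3 * (exp 8 * ?g\<^sup>2)" x, folded slope_def, unfolded fine(3) fine_width]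
    have b1: "\<bar>px t (xs j)\<bar> \<le> K / r\<^sup>2 * (exp 8 * ?g\<^sup>2)" "\<bar>pxx t (xs j)\<bar> \<le> K / r ^ 3 * (exp 8 * ?g\<^sup>2)"
      if "t \<in> {xs i..xs (Suc i)}" for t
    proof -
      have "K / r\<^sup>2 * (weight b t)\<^sup>2 \<le> K / r\<^sup>2 * (exp 8 * ?g\<^sup>2)" "K / r ^ 3 * (weight b t)\<^sup>2 \<le> K / r ^ 3 * (exp 8 * ?g\<^sup>2)"
        using ratio[OF that] K0 r by (intro mult_left_mono; simp)+
      then show "\<bar>px t (xs j)\<bar> \<le> K / r\<^sup>2 * (exp 8 * ?g\<^sup>2)" "\<bar>pxx t (xs j)\<bar> \<le> K / r ^ 3 * (exp 8 * ?g\<^sup>2)"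
        using K(2,3)[OF subsetD[OF sub that] y01] by linarith+
    qed
    have scale1: "2 * (K / t\<^sup>2 * (a * g)) * (8 / q * t * d) = 16 * a / q * (K / t * (d * g))"
      and scale2: "K / t ^ 3 * (a * g) * (8 / q * t * d) = 16 * a / q / 2 * (K / t\<^sup>2 * (d * g))"
      if "t \<noteq> 0" for t a g q d :: real
      using that by (simp_all add: power2_eq_square power3_eq_cube mult_ac)
    have I1: "\<bar>p x (xs j) - (p (xs i) (xs j) + slope p i j * (x - xs i))\<bar>
        \<le> 2 * (K / r\<^sup>2 * (exp 8 * ?g\<^sup>2)) * (8 / sqrt c * r * \<delta>)"
      by (rule I(1)) (simp_all only: p px b1 y01 xy(1) subsetD[OF sub])
    also have "\<dots> = C * (K / r * (\<delta> * ?g\<^sup>2))"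
      unfolding C_def by (rule scale1) (use r(1) in simp)
    finally have I1: "\<bar>p x (xs j) - (p (xs i) (xs j) + slope p i j * (x - xs i))\<bar> \<le> C * (K / r * (\<delta> * ?g\<^sup>2))" .
    have I2: "\<bar>px x (xs j) - slope p i j\<bar> \<le> K / r ^ 3 * (exp 8 * ?g\<^sup>2) * (8 / sqrt c * r * \<delta>)"
      by (rule I(2)) (simp_all only: p px b1 y01 xy(1) subsetD[OF sub])
    also have "\<dots> = C / 2 * (K / r\<^sup>2 * (\<delta> * ?g\<^sup>2))"
      unfolding C_def by (rule scale2) (use r(1) in simp)
    finally have I2: "\<bar>px x (xs j) - slope p i j\<bar> \<le> C / 2 * (K / r\<^sup>2 * (\<delta> * ?g\<^sup>2))" .
    have O: "\<bar>p x y - p x (xs j)\<bar> \<le> K / r * (\<delta> * ?g\<^sup>2)" "\<bar>px x y - px x (xs j)\<bar> \<le> K / r\<^sup>2 * (\<delta> * ?g\<^sup>2)"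
      using K(4,5)[OF x01(1)] ij xy unfolding osc_def by (auto simp: mult.assoc mult.commute[of \<delta>])
    have "\<bar>p (transition b) (xs j)\<bar> \<le> K / r * (1 / N)\<^sup>2"
      using K(1)[OF t01 y01] by (simp add: weight_transition)
    also have "\<dots> \<le> K / r * (\<delta> * ?g)"
      unfolding power2_eq_square using Kr fine(4)[OF xy(1)] \<delta> by (intro mult_left_mono mult_mono) auto
    finally have T: "\<bar>p (transition b) (xs j)\<bar> \<le> K / r * (\<delta> * ?g)" .
    have up: "a * (\<delta> * ?g\<^sup>2) \<le> a * (\<delta> * ?g)" if "0 \<le> a" for a
      using that g2 \<delta> by (intro mult_left_mono) auto
    have "\<bar>p x y - (p (xs i) (xs j) - p (transition b) (xs j) + slope p i j * (x - xs i))\<bar>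
        \<le> C * (K / r * (\<delta> * ?g\<^sup>2)) + K / r * (\<delta> * ?g\<^sup>2) + K / r * (\<delta> * ?g)"
      using I1 O(1) T by linarith
    also have "\<dots> \<le> C * (K / r * (\<delta> * ?g)) + K / r * (\<delta> * ?g) + K / r * (\<delta> * ?g)"
      using C0 Kr by (intro add_mono order_refl up mult_left_mono[OF up]) auto
    also have "\<dots> \<le> (5 + C) * (K / r * (\<delta> * ?g))"
      using mult_nonneg_nonneg[OF Kr(1) mult_nonneg_nonneg[OF less_imp_le[OF \<delta>(2)] g2(2)]] unfolding distrib_right by linarith
    finally have 1: "\<bar>p x y - (p (xs i) (xs j) - p (transition b) (xs j) + slope p i j * (x - xs i))\<bar>
        \<le> (5 + C) * (K / r * (\<delta> * ?g))" .
    have "\<bar>px x y - slope p i j\<bar> \<le> C / 2 * (K / r\<^sup>2 * (\<delta> * ?g\<^sup>2)) + K / r\<^sup>2 * (\<delta> * ?g\<^sup>2)"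
      using I2 O(2) by linarith
    also have "\<dots> \<le> C / 2 * (K / r\<^sup>2 * (\<delta> * ?g)) + K / r\<^sup>2 * (\<delta> * ?g)"
      using C0 Kr by (intro add_mono order_refl up mult_left_mono[OF up]) auto
    also have "\<dots> \<le> (5 + C) * (K / r\<^sup>2 * (\<delta> * ?g))"
    proof -
      have n: "0 \<le> K / r\<^sup>2 * (\<delta> * ?g)" by (intro mult_nonneg_nonneg Kr less_imp_le[OF \<delta>(2)] g2(2))+
      have "C / 2 * (K / r\<^sup>2 * (\<delta> * ?g)) \<le> C * (K / r\<^sup>2 * (\<delta> * ?g))"
        by (rule mult_right_mono[OF _ n]) (use C0 in simp)
      then show ?thesis using n unfolding distrib_right by linarith
    qed
    finally show ?thesis using 1 fine(1) unfolding sl by simp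
  next
    case coarse
    have P0: "?P (xs i) (xs j) = 0" "slope ?P i j = 0" using coarse by (simp_all add: slope_def)
    have "?g\<^sup>2 \<le> \<delta> * ?g"
      unfolding power2_eq_square using coarse(3)[OF xy(1)] \<delta>(1) g2 by (intro mult_right_mono) auto
    then have "K / r * ?g\<^sup>2 \<le> K / r * (\<delta> * ?g)" "K / r\<^sup>2 * ?g\<^sup>2 \<le> K / r\<^sup>2 * (\<delta> * ?g)"
      using Kr by (intro mult_left_mono; simp)+
    then have "\<bar>p x y\<bar> \<le> K / r * (\<delta> * ?g)" "\<bar>px x y\<bar> \<le> K / r\<^sup>2 * (\<delta> * ?g)"
      using K(1,2)[OF x01] by linarith+
    moreover have up: "t \<le> (5 + C) * t" if "0 \<le> t" for t
      using mult_right_mono[of 1 "5 + C" t] C0 that by simp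
    have "0 \<le> K / r * (\<delta> * ?g)" "0 \<le> K / r\<^sup>2 * (\<delta> * ?g)"
      by (intro mult_nonneg_nonneg Kr less_imp_le[OF \<delta>(2)] g2(2))+
    note this[THEN up]
    ultimately show ?thesis unfolding P0 mult_zero_left add_0 diff_zero by linarith
  qed
  have m: "(5 + C) * (K / d * (\<delta> * ?g)) \<le> (5 + C) * K * \<delta> * (a + weights x / d)" if "0 \<le> a" "0 < d" for a d
  proof -
    have "(5 + C) * (K / d * (\<delta> * ?g)) = (5 + C) * K * \<delta> * (?g / d)" by simp
    also have "\<dots> \<le> (5 + C) * K * \<delta> * (a + weights x / d)"
    proof (rule mult_left_mono)
      have "?g / d \<le> weights x / d" using that weight_le_weights by (intro divide_right_mono) auto
      then show "?g / d \<le> a + weights x / d" using that by linarith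
    qed (use C0 K0 \<delta> in auto)
    finally show ?thesis .
  qed
  show "\<bar>p x y - (?P (xs i) (xs j) + slope ?P i j * (x - xs i))\<bar> \<le> (5 + 16 * exp 8 / sqrt c) * K * \<delta> * (1 + weights x / r) \<and>
     \<bar>px x y - slope ?P i j\<bar> \<le> (5 + 16 * exp 8 / sqrt c) * K * \<delta> * (1 / r + weights x / r\<^sup>2)"
    using goal m[of 1 r] m[of "1 / r" "r\<^sup>2"] r(1) unfolding C_def[symmetric] by auto
qed

end

context shishkin_layer
begin

subsection \<open>The pieces of the decomposition\<close>

text \<open>A flux component \<open>p\<close> in terms of its normal variable (first) and its tangential variable (second),
  with the derivatives that enter the error. Exchanging the arguments makes the vertical component an
  instance of the same notion.\<close>

definition component ::
  "(real \<Rightarrow> real \<Rightarrow> real) \<Rightarrow> (real \<Rightarrow> real \<Rightarrow> real) \<Rightarrow> (real \<Rightarrow> real \<Rightarrow> real) \<Rightarrow>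
   (real \<Rightarrow> real \<Rightarrow> real) \<Rightarrow> (real \<Rightarrow> real \<Rightarrow> real) \<Rightarrow> bool" where
  "component p px pxx py pxy \<longleftrightarrow> (\<forall>x\<in>{0..1}. \<forall>y\<in>{0..1}.
     ((\<lambda>t. p t y) has_real_derivative px x y) (at x within {0..1}) \<and>
     ((\<lambda>t. px t y) has_real_derivative pxx x y) (at x within {0..1}) \<and>
     ((\<lambda>t. p x t) has_real_derivative py x y) (at y within {0..1}) \<and>
     ((\<lambda>t. px x t) has_real_derivative pxy x y) (at y within {0..1}))"

lemma componentD:
  assumes "component p px pxx py pxy" "x \<in> {0..1}" "y \<in> {0..1}"
  shows "((\<lambda>t. p t y) has_real_derivative px x y) (at x within {0..1})"
    and "((\<lambda>t. px t y) has_real_derivative pxx x y) (at x within {0..1})"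
    and "(p x has_real_derivative py x y) (at y within {0..1})"
    and "(px x has_real_derivative pxy x y) (at y within {0..1})"
  using assms unfolding component_def by blast+

text \<open>The derivative bounds are stated for \<open>dx\<close> applied after \<open>dy\<close>, whereas the oscillation in \<open>y\<close> of
  \<open>dx g\<close> involves the opposite order; this is where the mixed derivatives have to commute.\<close>

lemma component_x:
  assumes "C_bar 4 g"
  shows "component (\<lambda>x y. pderivs 1 0 g (x, y)) (\<lambda>x y. pderivs 2 0 g (x, y)) (\<lambda>x y. pderivs 3 0 g (x, y))
    (\<lambda>x y. pderivs 1 1 g (x, y)) (\<lambda>x y. pderivs 2 1 g (x, y))"
proof -
  have g: "C_bar (Suc (Suc (Suc (Suc 0)))) g" using assms by (simp only: C_bar_4)
  note gx = C_bar_partials(1)[OF g]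
  note gxx = C_bar_partials(1)[OF gx]
  have g2: "C_bar 2 g" "C_bar 2 (dx g)"
    using C_bar_Suc_imp[OF C_bar_Suc_imp[OF g]] C_bar_Suc_imp[OF gx] by (simp_all only: numeral_2_eq_2)
  have 1: "dy (dx g) p = dx (dy g) p" if "p \<in> Omega_bar" for p
    using mixed_partials_commute[OF g2(1) that] by simp
  have 2: "dy (dx (dx g)) p = dx (dx (dy g)) p" if "p \<in> Omega_bar" for p
    using mixed_partials_commute[OF g2(2) that] dx_cong[OF 1 that] by simp
  show ?thesis
    unfolding component_def pderivs_def
    using C_bar_dx[OF gx] C_bar_dx[OF gxx] C_bar_dy[OF gx] C_bar_dy[OF gxx] 1 2
    by (simp add: numeral_eq_Suc del: C_bar.simps)
qed

lemma component_y:
  assumes "C_bar 4 g"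
  shows "component (\<lambda>x y. pderivs 0 1 g (y, x)) (\<lambda>x y. pderivs 0 2 g (y, x)) (\<lambda>x y. pderivs 0 3 g (y, x))
    (\<lambda>x y. pderivs 1 1 g (y, x)) (\<lambda>x y. pderivs 1 2 g (y, x))"
proof -
  have g: "C_bar (Suc (Suc (Suc (Suc 0)))) g" using assms by (simp only: C_bar_4)
  note gy = C_bar_partials(2)[OF g]
  note gyy = C_bar_partials(2)[OF gy]
  show ?thesis
    unfolding component_def pderivs_def
    using C_bar_dx[OF gy] C_bar_dx[OF gyy] C_bar_dy[OF gy] C_bar_dy[OF gyy]
    by (simp add: numeral_eq_Suc del: C_bar.simps)
qed

lemma osc_mono: "osc M q \<Longrightarrow> M \<le> M' \<Longrightarrow> osc M' q"
  unfolding osc_def using \<delta>(2) by (meson mult_right_mono less_imp_le order_trans)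

lemma approximates_mono:
  assumes "approximates K P p px" "K \<le> K'"
  shows "approximates K' P p px"
  unfolding approximates_def
proof (intro allI impI ballI)
  fix i j x y assume ij: "i < N" "j < N" and xy: "x \<in> {xs i..xs (Suc i)}" "y \<in> {xs j..xs (Suc j)}"
  have m: "K * \<delta> * t \<le> K' * \<delta> * t" if "0 \<le> t" for t
    using that assms(2) \<delta> by (intro mult_right_mono) auto
  have "0 \<le> 1 + weights x / r" "0 \<le> 1 / r + weights x / r\<^sup>2"
    using weights_pos[of x] r(1) by (auto intro!: add_nonneg_nonneg)
  from m[OF this(1)] m[OF this(2)] show "\<bar>p x y - (P (xs i) (xs j) + slope P i j * (x - xs i))\<bar> \<le> K' * \<delta> * (1 + weights x / r) \<and>
     \<bar>px x y - slope P i j\<bar> \<le> K' * \<delta> * (1 / r + weights x / r\<^sup>2)"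
    using assms(1) ij xy unfolding approximates_def by (meson order_trans)
qed

definition \<Lambda> :: real where "\<Lambda> = (5 + 16 * exp 8 / sqrt c) * \<kappa>"

lemma \<Lambda>: "5 * (\<kappa> * K) \<le> \<Lambda> * K" if "0 \<le> K"
proof -
  have "5 \<le> 5 + 16 * exp 8 / sqrt c" using c by simp
  then have "5 * (\<kappa> * K) \<le> (5 + 16 * exp 8 / sqrt c) * (\<kappa> * K)"
    using that \<kappa> by (intro mult_right_mono) auto
  then show ?thesis by (simp add: \<Lambda>_def mult.assoc)
qed

lemma le_\<kappa>: "t \<le> \<kappa> * t" if "0 \<le> t"
  using mult_right_mono[of 1 \<kappa> t] \<kappa> that by simp

lemma approximable_smooth:
  assumes D: "component p px pxx py pxy" and K: "0 \<le> K"
    "\<And>x y. x \<in> {0..1} \<Longrightarrow> y \<in> {0..1} \<Longrightarrow> \<bar>px x y\<bar> \<le> K \<and> \<bar>pxx x y\<bar> \<le> K / r \<and> \<bar>py x y\<bar> \<le> K \<and> \<bar>pxy x y\<bar> \<le> K / r"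
  shows "\<exists>P. approximates (\<Lambda> * K) P p px"
proof -
  have "approximates (5 * (\<kappa> * K)) p p px"
  proof (rule approximates_smooth[OF componentD(1,2)[OF D]])
    fix x y :: real assume x: "x \<in> {0..1}"
    show "osc (\<kappa> * K) (p x)" by (rule osc_smooth[OF componentD(3)[OF D x]]) (use K(2) x in auto)
    have "osc (\<kappa> * (K / r)) (px x)" by (rule osc_smooth[OF componentD(4)[OF D x]]) (use K(2) x in auto)
    then show "osc (\<kappa> * K / r) (px x)" by simp
    assume y: "y \<in> {0..1}"
    show "\<bar>px x y\<bar> \<le> \<kappa> * K" "\<bar>pxx x y\<bar> \<le> \<kappa> * K / r"
      using K(2)[OF x y] le_\<kappa>[of K] le_\<kappa>[of "K / r"] K(1) r(1) by auto
  qed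
  then show ?thesis using approximates_mono \<Lambda>[OF K(1)] by blast
qed

lemma approximable_tangential:
  assumes D: "component p px pxx py pxy" and K: "0 \<le> K"
    "\<And>x y. x \<in> {0..1} \<Longrightarrow> y \<in> {0..1} \<Longrightarrow> \<bar>p x y\<bar> \<le> K * (weight b y)\<^sup>2 \<and> \<bar>px x y\<bar> \<le> K * (weight b y)\<^sup>2 \<and>
      \<bar>pxx x y\<bar> \<le> K / r \<and> \<bar>py x y\<bar> \<le> K / r * (weight b y)\<^sup>2 \<and> \<bar>pxy x y\<bar> \<le> K / r * (weight b y)\<^sup>2"
  shows "\<exists>P. approximates (\<Lambda> * K) P p px"
proof -
  have Kr: "\<kappa> * K \<le> \<kappa> * K / r"
    using mult_left_mono[of r 1 "\<kappa> * K"] r K(1) \<kappa> by (simp add: field_simps)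
  have "approximates (5 * (\<kappa> * K)) p p px"
  proof (rule approximates_smooth[OF componentD(1,2)[OF D]])
    fix x y :: real assume x: "x \<in> {0..1}"
    show "osc (\<kappa> * K) (p x)"
      by (rule osc_layer[OF componentD(3)[OF D x] K(1)]) (use K(2) x in blast)+
    have "osc (\<kappa> * K) (px x)"
      by (rule osc_layer[OF componentD(4)[OF D x] K(1)]) (use K(2) x in blast)+
    then show "osc (\<kappa> * K / r) (px x)" using Kr by (rule osc_mono)
    assume y: "y \<in> {0..1}"
    have "(weight b y)\<^sup>2 \<le> 1" using weight_sq_le[OF y, of b] weight_le_1[OF y, of b] by linarith
    then have "K * (weight b y)\<^sup>2 \<le> K" using K(1) by (intro mult_left_le) auto
    then show "\<bar>px x y\<bar> \<le> \<kappa> * K" "\<bar>pxx x y\<bar> \<le> \<kappa> * K / r"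
      using K(2)[OF x y] le_\<kappa>[of K] le_\<kappa>[of "K / r"] K(1) r(1) by auto
  qed
  then show ?thesis using approximates_mono \<Lambda>[OF K(1)] by blast
qed

text \<open>Layers decaying in the normal direction; the two lemmas after it supply the oscillation hypotheses
  for sides and for corners.\<close>

lemma approximable_normal_aux:
  assumes D: "component p px pxx py pxy" and K: "0 \<le> K"
    "\<And>x y. x \<in> {0..1} \<Longrightarrow> y \<in> {0..1} \<Longrightarrow> \<bar>p x y\<bar> \<le> K / r * (weight b x)\<^sup>2 \<and> \<bar>px x y\<bar> \<le> K / r\<^sup>2 * (weight b x)\<^sup>2 \<and>
      \<bar>pxx x y\<bar> \<le> K / r ^ 3 * (weight b x)\<^sup>2"
    and O: "\<And>x. x \<in> {0..1} \<Longrightarrow> osc (\<kappa> * (K / r * (weight b x)\<^sup>2)) (p x)"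
      "\<And>x. x \<in> {0..1} \<Longrightarrow> osc (\<kappa> * (K / r\<^sup>2 * (weight b x)\<^sup>2)) (px x)"
  shows "\<exists>P. approximates (\<Lambda> * K) P p px"
proof -
  have up: "K / d * t \<le> \<kappa> * K / d * t" if "0 < d" "0 \<le> t" for d t
    using le_\<kappa>[of "K / d * t"] that K(1) by simp
  have "approximates ((5 + 16 * exp 8 / sqrt c) * (\<kappa> * K)) (\<lambda>x y. p (clip b x) y - p (transition b) y) p px"
  proof (rule approximates_layer[OF componentD(1,2)[OF D]])
    show "0 \<le> \<kappa> * K" using K(1) \<kappa> by simp
    fix x y :: real assume x: "x \<in> {0..1}"
    show "osc (\<kappa> * K / r * (weight b x)\<^sup>2) (p x)" "osc (\<kappa> * K / r\<^sup>2 * (weight b x)\<^sup>2) (px x)"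
      using O[OF x] by (simp_all add: mult.assoc)
    assume y: "y \<in> {0..1}"
    show "\<bar>p x y\<bar> \<le> \<kappa> * K / r * (weight b x)\<^sup>2" "\<bar>px x y\<bar> \<le> \<kappa> * K / r\<^sup>2 * (weight b x)\<^sup>2"
        "\<bar>pxx x y\<bar> \<le> \<kappa> * K / r ^ 3 * (weight b x)\<^sup>2"
      using K(2)[OF x y] up[OF r(1)] up[of "r\<^sup>2"] up[of "r ^ 3"] r(1)
      by (meson order_trans zero_le_power2 zero_less_power)+
  qed
  then show ?thesis unfolding \<Lambda>_def mult.assoc by blast
qed

lemma approximable_normal:
  assumes D: "component p px pxx py pxy" and K: "0 \<le> K"
    "\<And>x y. x \<in> {0..1} \<Longrightarrow> y \<in> {0..1} \<Longrightarrow> \<bar>p x y\<bar> \<le> K / r * (weight b x)\<^sup>2 \<and> \<bar>px x y\<bar> \<le> K / r\<^sup>2 * (weight b x)\<^sup>2 \<and>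
      \<bar>pxx x y\<bar> \<le> K / r ^ 3 * (weight b x)\<^sup>2 \<and> \<bar>py x y\<bar> \<le> K / r * (weight b x)\<^sup>2 \<and>
      \<bar>pxy x y\<bar> \<le> K / r\<^sup>2 * (weight b x)\<^sup>2"
  shows "\<exists>P. approximates (\<Lambda> * K) P p px"
proof (rule approximable_normal_aux[OF D K(1), where b = b])
  fix x :: real assume x: "x \<in> {0..1}"
  show "osc (\<kappa> * (K / r * (weight b x)\<^sup>2)) (p x)"
    by (rule osc_smooth[OF componentD(3)[OF D x]]) (use K(2) x in blast)+
  show "osc (\<kappa> * (K / r\<^sup>2 * (weight b x)\<^sup>2)) (px x)"
    by (rule osc_smooth[OF componentD(4)[OF D x]]) (use K(2) x in blast)+
qed (use K(2) in blast)

lemma approximable_corner: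
  assumes D: "component p px pxx py pxy" and K: "0 \<le> K"
    "\<And>x y. x \<in> {0..1} \<Longrightarrow> y \<in> {0..1} \<Longrightarrow>
      \<bar>p x y\<bar> \<le> K / r * ((weight b x)\<^sup>2 * (weight b' y)\<^sup>2) \<and>
      \<bar>px x y\<bar> \<le> K / r\<^sup>2 * ((weight b x)\<^sup>2 * (weight b' y)\<^sup>2) \<and>
      \<bar>pxx x y\<bar> \<le> K / r ^ 3 * ((weight b x)\<^sup>2 * (weight b' y)\<^sup>2) \<and>
      \<bar>py x y\<bar> \<le> K / r\<^sup>2 * ((weight b x)\<^sup>2 * (weight b' y)\<^sup>2) \<and>
      \<bar>pxy x y\<bar> \<le> K / r ^ 3 * ((weight b x)\<^sup>2 * (weight b' y)\<^sup>2)"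
  shows "\<exists>P. approximates (\<Lambda> * K) P p px"
proof (rule approximable_normal_aux[OF D K(1), where b = b])
  fix x :: real assume x: "x \<in> {0..1}"
  have n: "0 \<le> K / r * (weight b x)\<^sup>2" "0 \<le> K / r\<^sup>2 * (weight b x)\<^sup>2" using K(1) r(1) by auto
  have e: "K / r\<^sup>2 = K / r / r" "K / r ^ 3 = K / r\<^sup>2 / r"
    by (simp_all add: power2_eq_square power3_eq_cube)
  show "osc (\<kappa> * (K / r * (weight b x)\<^sup>2)) (p x)"
    by (rule osc_layer[OF componentD(3)[OF D x] n(1), where b = b'])
      (use K(2)[OF x] in \<open>simp_all add: e mult.assoc times_divide_eq_left\<close>)
  show "osc (\<kappa> * (K / r\<^sup>2 * (weight b x)\<^sup>2)) (px x)"
    by (rule osc_layer[OF componentD(4)[OF D x] n(2), where b = b'])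
      (use K(2)[OF x] in \<open>simp_all add: e mult.assoc times_divide_eq_left\<close>)
  fix y :: real assume y: "y \<in> {0..1}"
  have "(weight b' y)\<^sup>2 \<le> 1" using weight_sq_le[OF y, of b'] weight_le_1[OF y, of b'] by linarith
  then have "(weight b x)\<^sup>2 * (weight b' y)\<^sup>2 \<le> (weight b x)\<^sup>2" by (intro mult_left_le) auto
  then have "K / r * ((weight b x)\<^sup>2 * (weight b' y)\<^sup>2) \<le> K / r * (weight b x)\<^sup>2"
    "K / r\<^sup>2 * ((weight b x)\<^sup>2 * (weight b' y)\<^sup>2) \<le> K / r\<^sup>2 * (weight b x)\<^sup>2"
    "K / r ^ 3 * ((weight b x)\<^sup>2 * (weight b' y)\<^sup>2) \<le> K / r ^ 3 * (weight b x)\<^sup>2"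
    using K(1) r(1) by (intro mult_left_mono; simp)+
  then show "\<bar>p x y\<bar> \<le> K / r * (weight b x)\<^sup>2 \<and> \<bar>px x y\<bar> \<le> K / r\<^sup>2 * (weight b x)\<^sup>2 \<and>
      \<bar>pxx x y\<bar> \<le> K / r ^ 3 * (weight b x)\<^sup>2"
    using K(2)[OF x y] by linarith
qed

lemma powr_half: "\<epsilon> powr (- real n / 2) = 1 / r ^ n" "\<epsilon> powr (1 - real n / 2) = r\<^sup>2 / r ^ n"
proof -
  have "\<epsilon> powr (real n / 2) = r ^ n"
    using \<epsilon> by (simp add: powr_half_sqrt[symmetric] powr_powr flip: powr_realpow)
  then show "\<epsilon> powr (- real n / 2) = 1 / r ^ n" "\<epsilon> powr (1 - real n / 2) = r\<^sup>2 / r ^ n"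
    using \<epsilon> by (simp_all add: powr_minus_divide powr_diff)
qed

end

lemma dx_decomposition:
  assumes u: "\<And>p. p \<in> Omega_bar \<Longrightarrow> u p = S p + (\<Sum>k=1..4. w k p) + (\<Sum>k=1..4. z k p)"
    and S: "C_bar (Suc m) S" and wz: "\<And>k. k \<in> {1..4::nat} \<Longrightarrow> C_bar (Suc m) (w k) \<and> C_bar (Suc m) (z k)"
    and p: "p \<in> Omega_bar"
  shows "dx u p = dx S p + (\<Sum>k=1..4. dx (w k) p) + (\<Sum>k=1..4. dx (z k) p)"
proof -
  obtain x y where xy: "p = (x, y)" "x \<in> {0..1}" "y \<in> {0..1}" using p by auto
  have "((\<lambda>t. S (t, y) + (\<Sum>k=1..4. w k (t, y)) + (\<Sum>k=1..4. z k (t, y))) has_real_derivative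
      dx S (x, y) + (\<Sum>k=1..4. dx (w k) (x, y)) + (\<Sum>k=1..4. dx (z k) (x, y))) (at x within {0..1})"
    by (intro DERIV_add DERIV_sum C_bar_dx[OF S] C_bar_dx[of m] xy; use wz in blast)
  then have "((\<lambda>t. u (t, y)) has_real_derivative
      dx S (x, y) + (\<Sum>k=1..4. dx (w k) (x, y)) + (\<Sum>k=1..4. dx (z k) (x, y))) (at x within {0..1})"
    by (rule has_field_derivative_transform_within[where d = 1]) (use u xy in auto)
  then show ?thesis unfolding xy(1) by (rule dx_eqI[OF xy(2)])
qed

lemma dy_decomposition:
  assumes u: "\<And>p. p \<in> Omega_bar \<Longrightarrow> u p = S p + (\<Sum>k=1..4. w k p) + (\<Sum>k=1..4. z k p)"
    and S: "C_bar (Suc m) S" and wz: "\<And>k. k \<in> {1..4::nat} \<Longrightarrow> C_bar (Suc m) (w k) \<and> C_bar (Suc m) (z k)"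
    and p: "p \<in> Omega_bar"
  shows "dy u p = dy S p + (\<Sum>k=1..4. dy (w k) p) + (\<Sum>k=1..4. dy (z k) p)"
proof -
  obtain x y where xy: "p = (x, y)" "x \<in> {0..1}" "y \<in> {0..1}" using p by auto
  have "((\<lambda>t. S (x, t) + (\<Sum>k=1..4. w k (x, t)) + (\<Sum>k=1..4. z k (x, t))) has_real_derivative
      dy S (x, y) + (\<Sum>k=1..4. dy (w k) (x, y)) + (\<Sum>k=1..4. dy (z k) (x, y))) (at y within {0..1})"
    by (intro DERIV_add DERIV_sum C_bar_dy[OF S] C_bar_dy[of m] xy; use wz in blast)
  then have "((\<lambda>t. u (x, t)) has_real_derivative
      dy S (x, y) + (\<Sum>k=1..4. dy (w k) (x, y)) + (\<Sum>k=1..4. dy (z k) (x, y))) (at y within {0..1})"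
    by (rule has_field_derivative_transform_within[where d = 1]) (use u xy in auto)
  then show ?thesis unfolding xy(1) by (rule dy_eqI[OF xy(3)])
qed

context shishkin_layer
begin

lemma approximates_cong:
  assumes "approximates K P p px"
    and "\<And>x y. x \<in> {0..1} \<Longrightarrow> y \<in> {0..1} \<Longrightarrow> p x y = p' x y \<and> px x y = px' x y"
  shows "approximates K P p' px'"
  unfolding approximates_def
proof (intro allI impI ballI)
  fix i j x y assume ij: "i < N" "j < N" and xy: "x \<in> {xs i..xs (Suc i)}" "y \<in> {xs j..xs (Suc j)}"
  have "x \<in> {0..1}" "y \<in> {0..1}"
    using subsetD[OF mesh_interval_subset] ij xy by blast+
  note eq = assms(2)[OF this]
  show "\<bar>p' x y - (P (xs i) (xs j) + slope P i j * (x - xs i))\<bar> \<le> K * \<delta> * (1 + weights x / r) \<and>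
     \<bar>px' x y - slope P i j\<bar> \<le> K * \<delta> * (1 / r + weights x / r\<^sup>2)"
    using assms(1) ij xy eq unfolding approximates_def by metis
qed

lemma approximable_sum:
  fixes p px :: "'k \<Rightarrow> real \<Rightarrow> real \<Rightarrow> real"
  assumes "finite I" "\<And>k. k \<in> I \<Longrightarrow> \<exists>P. approximates K P (p k) (px k)"
  shows "\<exists>P. approximates (real (card I) * K) P (\<lambda>x y. \<Sum>k\<in>I. p k x y) (\<lambda>x y. \<Sum>k\<in>I. px k x y)"
  using assms
proof (induction I rule: finite_induct)
  case empty
  have "approximates 0 (\<lambda>_ _. 0) (\<lambda>_ _. 0) (\<lambda>_ _. 0)"
    by (simp add: approximates_def slope_def)
  then show ?case by auto
next
  case (insert k I)
  then obtain P P' where "approximates K P (p k) (px k)"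
    "approximates (real (card I) * K) P' (\<lambda>x y. \<Sum>k\<in>I. p k x y) (\<lambda>x y. \<Sum>k\<in>I. px k x y)"
    by (meson insertI1 insertI2)
  from approximates_add[OF this] show ?case
    using insert.hyps by (auto simp: distrib_right)
qed

lemma factor_le: "m \<le> 2 \<Longrightarrow> 1 + r\<^sup>2 / r ^ m \<le> 2" "1 + r\<^sup>2 / r ^ 3 \<le> 2 / r"
proof -
  have 1: "1 \<le> 1 / r" using r by simp
  have "r\<^sup>2 / r ^ 3 = 1 / r" using r(1) by (simp only: power2_eq_square power3_eq_cube) simp
  moreover have "2 / r = 1 / r + 1 / r" by simp
  ultimately show "1 + r\<^sup>2 / r ^ 3 \<le> 2 / r" using 1 by linarith
  assume "m \<le> 2"
  then have "m = 0 \<or> m = 1 \<or> m = 2" by linarith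
  then have "t\<^sup>2 / t ^ m \<le> 1" if "0 < t" "t \<le> 1" for t :: real
    using that by (elim disjE) (simp_all add: power2_eq_square mult_le_one)
  from this[OF r(1,2)] show "1 + r\<^sup>2 / r ^ m \<le> 2" by linarith
qed

definition approximable :: "real \<Rightarrow> (real \<times> real \<Rightarrow> real) \<Rightarrow> bool" where
  "approximable K g \<longleftrightarrow>
     (\<exists>P. approximates K P (\<lambda>x y. pderivs 1 0 g (x, y)) (\<lambda>x y. pderivs 2 0 g (x, y))) \<and>
     (\<exists>P. approximates K P (\<lambda>x y. pderivs 0 1 g (y, x)) (\<lambda>x y. pderivs 0 2 g (y, x)))"

lemma smooth_piece:
  assumes C: "0 \<le> C" and g: "C_bar 4 g"
    and bd: "\<And>x y m n. x \<in> {0..1} \<Longrightarrow> y \<in> {0..1} \<Longrightarrow> m + n \<le> 4 \<Longrightarrow>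
      \<bar>pderivs m n g (x, y)\<bar> \<le> C * (1 + \<epsilon> powr (1 - real (m + n) / 2))"
  shows "approximable (\<Lambda> * (2 * C)) g"
proof -
  have 2: "\<bar>pderivs m n g (x, y)\<bar> \<le> 2 * C" if "x \<in> {0..1}" "y \<in> {0..1}" "m + n = 2" for x y m n
    using bd[OF that(1,2), of m n] that(3) mult_left_mono[OF factor_le(1)[of 2] C] unfolding powr_half by simp
  have 3: "\<bar>pderivs m n g (x, y)\<bar> \<le> 2 * C / r" if "x \<in> {0..1}" "y \<in> {0..1}" "m + n = 3" for x y m n
    using bd[OF that(1,2), of m n] that(3) mult_left_mono[OF factor_le(2) C] unfolding powr_half by (simp add: mult.commute)
  show ?thesis
    unfolding approximable_def
    by (intro conjI approximable_smooth[OF component_x[OF g]] approximable_smooth[OF component_y[OF g]])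
      (use C 2 3 in auto)
qed

text \<open>The flux component parallel to the side of a layer is harmless: it has no factor \<open>1 / r\<close> and varies
  rapidly only in its tangential variable. The factors in the bounds are the values of \<open>side_factor\<close>.\<close>

lemma side_piece_tangential:
  assumes C: "0 \<le> C" and D: "component p px pxx py pxy"
    and bd: "\<And>x y. x \<in> {0..1} \<Longrightarrow> y \<in> {0..1} \<Longrightarrow>
      \<bar>p x y\<bar> \<le> C * ((1 + r\<^sup>2 / r ^ 1) * (1 / r ^ 0)) * (weight b y)\<^sup>2 \<and>
      \<bar>px x y\<bar> \<le> C * ((1 + r\<^sup>2 / r ^ 2) * (1 / r ^ 0)) * (weight b y)\<^sup>2 \<and>
      \<bar>pxx x y\<bar> \<le> C * ((1 + r\<^sup>2 / r ^ 3) * (1 / r ^ 0)) * (weight b y)\<^sup>2 \<and>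
      \<bar>py x y\<bar> \<le> C * ((1 + r\<^sup>2 / r ^ 1) * (1 / r ^ 1)) * (weight b y)\<^sup>2 \<and>
      \<bar>pxy x y\<bar> \<le> C * ((1 + r\<^sup>2 / r ^ 2) * (1 / r ^ 1)) * (weight b y)\<^sup>2"
  shows "\<exists>P. approximates (\<Lambda> * (2 * C)) P p px"
proof (rule approximable_tangential[OF D, where b = b])
  fix x y :: real assume xy: "x \<in> {0..1}" "y \<in> {0..1}"
  have up: "C * ((1 + r\<^sup>2 / r ^ m) * (1 / r ^ n)) * (weight b y)\<^sup>2 \<le> 2 * C / r ^ n * (weight b y)\<^sup>2" if "m \<le> 2" for m n
  proof -
    have "C * ((1 + r\<^sup>2 / r ^ m) * (1 / r ^ n)) \<le> C * (2 * (1 / r ^ n))"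
      using factor_le(1)[OF that] C r(1) by (intro mult_left_mono mult_right_mono) auto
    then show ?thesis by (intro mult_right_mono) (auto simp: mult.commute)
  qed
  have "(weight b y)\<^sup>2 \<le> 1" using weight_sq_le[OF xy(2), of b] weight_le_1[OF xy(2), of b] by linarith
  then have "C * ((1 + r\<^sup>2 / r ^ 3) * (1 / r ^ 0)) * (weight b y)\<^sup>2 \<le> C * ((1 + r\<^sup>2 / r ^ 3) * (1 / r ^ 0))"
    using C r(1) by (intro mult_left_le) auto
  also have "\<dots> \<le> 2 * C / r" using mult_left_mono[OF factor_le(2) C] by (simp add: mult.commute)
  finally have 3: "C * ((1 + r\<^sup>2 / r ^ 3) * (1 / r ^ 0)) * (weight b y)\<^sup>2 \<le> 2 * C / r" .
  show "\<bar>p x y\<bar> \<le> 2 * C * (weight b y)\<^sup>2 \<and> \<bar>px x y\<bar> \<le> 2 * C * (weight b y)\<^sup>2 \<and>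
      \<bar>pxx x y\<bar> \<le> 2 * C / r \<and> \<bar>py x y\<bar> \<le> 2 * C / r * (weight b y)\<^sup>2 \<and> \<bar>pxy x y\<bar> \<le> 2 * C / r * (weight b y)\<^sup>2"
    using bd[OF xy] up[of 1 0] up[of 2 0] up[of 1 1] up[of 2 1] 3
    unfolding power_0 power_one_right div_by_1 by linarith
qed (use C in simp)

lemma side_piece_normal:
  assumes C: "0 \<le> C" and D: "component p px pxx py pxy"
    and bd: "\<And>x y. x \<in> {0..1} \<Longrightarrow> y \<in> {0..1} \<Longrightarrow>
      \<bar>p x y\<bar> \<le> C * ((1 + r\<^sup>2 / r ^ 0) * (1 / r ^ 1)) * (weight b x)\<^sup>2 \<and>
      \<bar>px x y\<bar> \<le> C * ((1 + r\<^sup>2 / r ^ 0) * (1 / r ^ 2)) * (weight b x)\<^sup>2 \<and>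
      \<bar>pxx x y\<bar> \<le> C * ((1 + r\<^sup>2 / r ^ 0) * (1 / r ^ 3)) * (weight b x)\<^sup>2 \<and>
      \<bar>py x y\<bar> \<le> C * ((1 + r\<^sup>2 / r ^ 1) * (1 / r ^ 1)) * (weight b x)\<^sup>2 \<and>
      \<bar>pxy x y\<bar> \<le> C * ((1 + r\<^sup>2 / r ^ 1) * (1 / r ^ 2)) * (weight b x)\<^sup>2"
  shows "\<exists>P. approximates (\<Lambda> * (2 * C)) P p px"
proof (rule approximable_normal[OF D, where b = b])
  fix x y :: real assume xy: "x \<in> {0..1}" "y \<in> {0..1}"
  have up: "C * ((1 + r\<^sup>2 / r ^ m) * (1 / r ^ n)) * (weight b x)\<^sup>2 \<le> 2 * C / r ^ n * (weight b x)\<^sup>2" if "m \<le> 2" for m n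
  proof -
    have "C * ((1 + r\<^sup>2 / r ^ m) * (1 / r ^ n)) \<le> C * (2 * (1 / r ^ n))"
      using factor_le(1)[OF that] C r(1) by (intro mult_left_mono mult_right_mono) auto
    then show ?thesis by (intro mult_right_mono) (auto simp: mult.commute)
  qed
  show "\<bar>p x y\<bar> \<le> 2 * C / r * (weight b x)\<^sup>2 \<and> \<bar>px x y\<bar> \<le> 2 * C / r\<^sup>2 * (weight b x)\<^sup>2 \<and>
      \<bar>pxx x y\<bar> \<le> 2 * C / r ^ 3 * (weight b x)\<^sup>2 \<and> \<bar>py x y\<bar> \<le> 2 * C / r * (weight b x)\<^sup>2 \<and>
      \<bar>pxy x y\<bar> \<le> 2 * C / r\<^sup>2 * (weight b x)\<^sup>2"
    using bd[OF xy] up[of 0 1] up[of 0 2] up[of 0 3] up[of 1 1] up[of 1 2]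
    unfolding power_one_right by linarith
qed (use C in simp)

lemma side_piece:
  assumes C: "0 \<le> C" and g: "C_bar 4 g" and k: "k \<in> {1..4}"
    and bd: "\<And>x y m n. x \<in> {0..1} \<Longrightarrow> y \<in> {0..1} \<Longrightarrow> m + n \<le> 4 \<Longrightarrow>
      \<bar>pderivs m n g (x, y)\<bar> \<le> C * side_factor k \<epsilon> m n * exp (- side_dist k x y * s)"
  shows "approximable (\<Lambda> * (2 * C)) g"
proof -
  have sf: "side_factor k \<epsilon> m n = (if k = 1 \<or> k = 3 then (1 + r\<^sup>2 / r ^ m) * (1 / r ^ n)
      else (1 + r\<^sup>2 / r ^ n) * (1 / r ^ m))" for m n
    unfolding side_factor_def powr_half ..
  show ?thesis
  proof (cases "k = 1 \<or> k = 3")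
    case True
    have b: "\<bar>pderivs m n g (x, y)\<bar> \<le> C * ((1 + r\<^sup>2 / r ^ m) * (1 / r ^ n)) * (weight (k = 3) y)\<^sup>2"
      if "x \<in> {0..1}" "y \<in> {0..1}" "m + n \<le> 4" for x y m n
      using bd[OF that, unfolded sf] True by (auto simp: weight_sq side_dist_def)
    show ?thesis
      unfolding approximable_def
      by (intro conjI side_piece_tangential[OF C component_x[OF g], of "k = 3"]
          side_piece_normal[OF C component_y[OF g], of "k = 3"]; rule b; simp)
  next
    case False
    then have k: "k = 2 \<or> k = 4" using k by fastforce
    have b: "\<bar>pderivs m n g (x, y)\<bar> \<le> C * ((1 + r\<^sup>2 / r ^ n) * (1 / r ^ m)) * (weight (k = 2) x)\<^sup>2"
      if "x \<in> {0..1}" "y \<in> {0..1}" "m + n \<le> 4" for x y m n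
      using bd[OF that, unfolded sf] k by (auto simp: weight_sq side_dist_def)
    show ?thesis
      unfolding approximable_def
      by (intro conjI side_piece_normal[OF C component_x[OF g], of "k = 2"]
          side_piece_tangential[OF C component_y[OF g], of "k = 2"]; rule b; simp)
  qed
qed

lemma corner_piece:
  assumes C: "0 \<le> C" and g: "C_bar 4 g" and k: "k \<in> {1..4}"
    and bd: "\<And>x y m n. x \<in> {0..1} \<Longrightarrow> y \<in> {0..1} \<Longrightarrow> m + n \<le> 4 \<Longrightarrow>
      \<bar>pderivs m n g (x, y)\<bar> \<le> C * \<epsilon> powr (- real (m + n) / 2) * exp (- corner_dist k x y * s)"
  shows "approximable (\<Lambda> * (2 * C)) g"
proof -
  define b1 b2 where "b1 = (k = 2 \<or> k = 3)" "b2 = (k = 3 \<or> k = 4)"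
  have "exp (- corner_dist k x y * s) = (weight b1 x)\<^sup>2 * (weight b2 y)\<^sup>2" for x y
  proof -
    consider "k = 1" | "k = 2" | "k = 3" | "k = 4" using k by fastforce
    then show ?thesis
      by cases (simp_all add: b1_b2_def corner_dist_def weight_sq algebra_simps flip: exp_add)
  qed
  then have b: "\<bar>pderivs m n g (x, y)\<bar> \<le> C / r ^ (m + n) * ((weight b1 x)\<^sup>2 * (weight b2 y)\<^sup>2)"
    if "x \<in> {0..1}" "y \<in> {0..1}" "m + n \<le> 4" for x y m n
    using bd[OF that] unfolding powr_half by simp
  have up: "C / d * t \<le> 2 * C / d * t" if "0 < d" "0 \<le> t" for d t
    using C that by (intro mult_right_mono divide_right_mono) auto
  have b': "\<bar>pderivs m n g (x, y)\<bar> \<le> 2 * C / r ^ q * ((weight b1 x)\<^sup>2 * (weight b2 y)\<^sup>2)"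
    if "x \<in> {0..1}" "y \<in> {0..1}" "m + n = q" "q \<le> 4" for x y m n q
    using b[OF that(1,2), of m n] up[of "r ^ q" "(weight b1 x)\<^sup>2 * (weight b2 y)\<^sup>2"] r(1) that(3,4)
    by (auto intro: order_trans)
  have b1: "\<bar>pderivs m n g (x, y)\<bar> \<le> 2 * C / r * ((weight b1 x)\<^sup>2 * (weight b2 y)\<^sup>2)"
    if "x \<in> {0..1}" "y \<in> {0..1}" "m + n = 1" for x y m n
    using b'[OF that] by simp
  show ?thesis
    unfolding approximable_def
  proof (intro conjI)
    show "\<exists>P. approximates (\<Lambda> * (2 * C)) P (\<lambda>x y. pderivs 1 0 g (x, y)) (\<lambda>x y. pderivs 2 0 g (x, y))"
    proof (rule approximable_corner[OF component_x[OF g], of _ b1 b2])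
      show "0 \<le> 2 * C" using C by simp
    qed (intro conjI b1 b'; simp)
    show "\<exists>P. approximates (\<Lambda> * (2 * C)) P (\<lambda>x y. pderivs 0 1 g (y, x)) (\<lambda>x y. pderivs 0 2 g (y, x))"
    proof (rule approximable_corner[OF component_y[OF g], of _ b2 b1])
      show "0 \<le> 2 * C" using C by simp
    qed (unfold mult.commute[of "(weight b2 _)\<^sup>2"], intro conjI b1 b'; simp)
  qed
qed

lemma approximable_solution:
  assumes C: "0 \<le> C" and u: "layer_decomposition C c \<epsilon> u"
  shows "\<exists>P. approximates (18 * \<Lambda> * C) P (\<lambda>x y. dx u (x, y)) (\<lambda>x y. dx (dx u) (x, y))"
    and "\<exists>P. approximates (18 * \<Lambda> * C) P (\<lambda>x y. dy u (y, x)) (\<lambda>x y. dy (dy u) (y, x))"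
proof -
  obtain S w z where dec: "\<And>p. p \<in> Omega_bar \<Longrightarrow> u p = S p + (\<Sum>k=1..4. w k p) + (\<Sum>k=1..4. z k p)"
    and S4: "C_bar 4 S" and wz4: "\<And>k. k \<in> {1..4::nat} \<Longrightarrow> C_bar 4 (w k) \<and> C_bar 4 (z k)"
    and bd: "\<And>x y m n. x \<in> {0..1} \<Longrightarrow> y \<in> {0..1} \<Longrightarrow> m + n \<le> 4 \<Longrightarrow>
           \<bar>pderivs m n S (x, y)\<bar> \<le> C * (1 + \<epsilon> powr (1 - real (m + n) / 2)) \<and>
           (\<forall>k\<in>{1..4}.
              \<bar>pderivs m n (w k) (x, y)\<bar>
                \<le> C * side_factor k \<epsilon> m n * exp (- side_dist k x y * sqrt (c / \<epsilon>)) \<and>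
              \<bar>pderivs m n (z k) (x, y)\<bar>
                \<le> C * \<epsilon> powr (- real (m + n) / 2) * exp (- corner_dist k x y * sqrt (c / \<epsilon>)))"
    using u unfolding layer_decomposition_def by metis
  have S: "C_bar (Suc 0) S" "C_bar (Suc 0) (dx S)" "C_bar (Suc 0) (dy S)"
    by (rule C_bar_4_imp[OF S4])+
  have wz: "C_bar (Suc 0) (w k) \<and> C_bar (Suc 0) (z k)" "C_bar (Suc 0) (dx (w k)) \<and> C_bar (Suc 0) (dx (z k))"
    "C_bar (Suc 0) (dy (w k)) \<and> C_bar (Suc 0) (dy (z k))" if "k \<in> {1..4}" for k
    using C_bar_4_imp[of "w k"] C_bar_4_imp[of "z k"] wz4[OF that] by (simp_all del: C_bar.simps)
  have pieces: "approximable (\<Lambda> * (2 * C)) S"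
    "k \<in> {1..4} \<Longrightarrow> approximable (\<Lambda> * (2 * C)) (w k)" "k \<in> {1..4} \<Longrightarrow> approximable (\<Lambda> * (2 * C)) (z k)" for k
    by (rule smooth_piece[OF C S4] side_piece[OF C] corner_piece[OF C]; use bd wz4 in blast)+
  note ux = dx_decomposition[OF dec S(1) wz(1)]
  note uxx = dx_decomposition[OF ux S(2) wz(2)]
  note uy = dy_decomposition[OF dec S(1) wz(1)]
  note uyy = dy_decomposition[OF uy S(3) wz(3)]
  have comb: "\<exists>P. approximates (18 * \<Lambda> * C) P p' px'"
    if a: "\<exists>P. approximates (\<Lambda> * (2 * C)) P p px"
      "\<And>k. k \<in> {1..4} \<Longrightarrow> \<exists>P. approximates (\<Lambda> * (2 * C)) P (pw k) (pwx k)"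
      "\<And>k. k \<in> {1..4} \<Longrightarrow> \<exists>P. approximates (\<Lambda> * (2 * C)) P (pz k) (pzx k)"
      and eq: "\<And>x y. x \<in> {0..1} \<Longrightarrow> y \<in> {0..1} \<Longrightarrow> p x y + (\<Sum>k=1..4. pw k x y) + (\<Sum>k=1..4. pz k x y) = p' x y \<and>
        px x y + (\<Sum>k=1..4. pwx k x y) + (\<Sum>k=1..4. pzx k x y) = px' x y"
    for p px p' px' :: "real \<Rightarrow> real \<Rightarrow> real" and pw pwx pz pzx :: "nat \<Rightarrow> real \<Rightarrow> real \<Rightarrow> real"
  proof -
    obtain P where P: "approximates (\<Lambda> * (2 * C)) P p px" using a(1) by blast
    obtain Pw where Pw: "approximates (real (card {1..4::nat}) * (\<Lambda> * (2 * C))) Pw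
        (\<lambda>x y. \<Sum>k=1..4. pw k x y) (\<lambda>x y. \<Sum>k=1..4. pwx k x y)"
      using approximable_sum[of "{1..4::nat}" "\<Lambda> * (2 * C)" pw pwx, OF finite_atLeastAtMost a(2)] by blast
    obtain Pz where Pz: "approximates (real (card {1..4::nat}) * (\<Lambda> * (2 * C))) Pz
        (\<lambda>x y. \<Sum>k=1..4. pz k x y) (\<lambda>x y. \<Sum>k=1..4. pzx k x y)"
      using approximable_sum[of "{1..4::nat}" "\<Lambda> * (2 * C)" pz pzx, OF finite_atLeastAtMost a(3)] by blast
    have K: "\<Lambda> * (2 * C) + real (card {1..4::nat}) * (\<Lambda> * (2 * C)) + real (card {1..4::nat}) * (\<Lambda> * (2 * C))
        = 18 * \<Lambda> * C" by simp
    show ?thesis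
      using approximates_cong[OF approximates_add[OF approximates_add[OF P Pw] Pz] eq] unfolding K by blast
  qed
  show "\<exists>P. approximates (18 * \<Lambda> * C) P (\<lambda>x y. dx u (x, y)) (\<lambda>x y. dx (dx u) (x, y))"
  proof (rule comb[OF pieces[unfolded approximable_def, THEN conjunct1]])
    fix x y :: real assume "x \<in> {0..1}" "y \<in> {0..1}"
    then have "(x, y) \<in> Omega_bar" by simp
    then show "pderivs 1 0 S (x, y) + (\<Sum>k=1..4. pderivs 1 0 (w k) (x, y)) + (\<Sum>k=1..4. pderivs 1 0 (z k) (x, y)) = dx u (x, y) \<and>
      pderivs 2 0 S (x, y) + (\<Sum>k=1..4. pderivs 2 0 (w k) (x, y)) + (\<Sum>k=1..4. pderivs 2 0 (z k) (x, y)) = dx (dx u) (x, y)"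
      using ux uxx by (simp add: pderivs_def numeral_2_eq_2 del: sum.cl_ivl_Suc)
  qed
  show "\<exists>P. approximates (18 * \<Lambda> * C) P (\<lambda>x y. dy u (y, x)) (\<lambda>x y. dy (dy u) (y, x))"
  proof (rule comb[OF pieces[unfolded approximable_def, THEN conjunct2]])
    fix x y :: real assume "x \<in> {0..1}" "y \<in> {0..1}"
    then have "(y, x) \<in> Omega_bar" by simp
    then show "pderivs 0 1 S (y, x) + (\<Sum>k=1..4. pderivs 0 1 (w k) (y, x)) + (\<Sum>k=1..4. pderivs 0 1 (z k) (y, x)) = dy u (y, x) \<and>
      pderivs 0 2 S (y, x) + (\<Sum>k=1..4. pderivs 0 2 (w k) (y, x)) + (\<Sum>k=1..4. pderivs 0 2 (z k) (y, x)) = dy (dy u) (y, x)"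
      using uy uyy by (simp add: pderivs_def numeral_2_eq_2 del: sum.cl_ivl_Suc)
  qed
qed

end

section \<open>The error estimate\<close>

lemma integral_layer_le:
  fixes a :: real
  assumes a: "0 < a"
  shows "integral {0..1} (\<lambda>t. exp (- (if b then 1 - t else t) * a)) \<le> 1 / a"
proof -
  define F where "F t = (if b then 1 else - 1) * exp (- (if b then 1 - t else t) * a) / a" for t
  have "((\<lambda>t. exp (- (if b then 1 - t else t) * a)) has_integral F 1 - F 0) {0..1}"
  proof (rule fundamental_theorem_of_calculus)
    fix t :: real
    have "(F has_real_derivative exp (- (if b then 1 - t else t) * a)) (at t within {0..1})"
      unfolding F_def using a by (cases b) (auto intro!: derivative_eq_intros)
    then show "(F has_vector_derivative exp (- (if b then 1 - t else t) * a)) (at t within {0..1})"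
      by (simp add: has_real_derivative_iff_has_vector_derivative)
  qed simp
  then have "integral {0..1} (\<lambda>t. exp (- (if b then 1 - t else t) * a)) = F 1 - F 0"
    by (rule integral_unique)
  also have "\<dots> \<le> 1 / a" using a by (auto simp: F_def field_simps)
  finally show ?thesis .
qed

context shishkin_layer
begin

text \<open>The square of the pointwise bound in \<open>approximates\<close>, up to the factor \<open>(K * \<delta>)\<^sup>2\<close>, summed over the
  two components; for the divergence only an additional factor \<open>2 / r\<^sup>2\<close> appears.\<close>

definition error_weight :: "real \<times> real \<Rightarrow> real" where
  "error_weight p = (1 + weights (fst p) / r)\<^sup>2 + (1 + weights (snd p) / r)\<^sup>2"

lemma integral_weight_sq: "integral {0..1} (\<lambda>t. (weight b t)\<^sup>2) \<le> r / sqrt c"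
  using integral_layer_le[OF s_pos, of b] unfolding weight_sq by (simp add: s_r)

lemma weights_sq_le: "(1 + weights x / r)\<^sup>2 \<le> 2 + 4 / r\<^sup>2 * ((weight False x)\<^sup>2 + (weight True x)\<^sup>2)"
proof -
  have sq: "(a + b)\<^sup>2 \<le> 2 * a\<^sup>2 + 2 * b\<^sup>2" for a b :: real
    using zero_le_power2[of "a - b"] by (simp add: power2_eq_square algebra_simps)
  have "(1 + weights x / r)\<^sup>2 \<le> 2 + 2 * ((weights x)\<^sup>2 / r\<^sup>2)"
    using sq[of 1 "weights x / r"] by (simp add: power_divide)
  also have "\<dots> \<le> 2 + 2 * ((2 * (weight False x)\<^sup>2 + 2 * (weight True x)\<^sup>2) / r\<^sup>2)"
    unfolding weights_def
    by (intro add_left_mono mult_left_mono divide_right_mono sq) auto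
  finally show ?thesis by (simp add: algebra_simps add_divide_distrib)
qed

lemma continuous_weight: "continuous_on A (weight b)"
  unfolding weight_def by (cases b; simp; intro continuous_intros; simp)

lemma continuous_error_weight: "continuous_on A error_weight"
  unfolding error_weight_def weights_def
  by (intro continuous_intros continuous_on_compose2[OF continuous_weight[of UNIV]]) (use r(1) in auto)

text \<open>The weights enter with \<open>1 / r\<^sup>2\<close>, but the layers have width \<open>r\<close>; hence only \<open>1 / r\<close> remains, which
  the balancing factor \<open>\<epsilon> powr (1 / 4)\<close> of the norm removes.\<close>

lemma integral_error_weight:
  "integral\<^sup>L (lebesgue_on Omega) error_weight \<le> (4 + 16 / sqrt c) / r"
proof -
  define E where "E t = (weight False t)\<^sup>2 + (weight True t)\<^sup>2" for t
  define J where "J = integral {0..1} E"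
  have contE: "continuous_on A E" for A
    unfolding E_def by (intro continuous_intros continuous_weight)
  have J: "(E has_integral J) {0..1}"
    unfolding J_def by (intro integrable_integral integrable_continuous_interval contE)
  have J_le: "J \<le> 2 * (r / sqrt c)"
  proof -
    have "J = integral {0..1} (\<lambda>t. (weight False t)\<^sup>2) + integral {0..1} (\<lambda>t. (weight True t)\<^sup>2)"
      unfolding J_def E_def
      by (intro integral_add integrable_continuous_interval continuous_on_power continuous_weight)
    then show ?thesis using integral_weight_sq[of False] integral_weight_sq[of True] by simp
  qed
  let ?k = "4 / r\<^sup>2"
  let ?F = "\<lambda>p. 4 + ?k * (E (fst p) + E (snd p))"
  have contF: "continuous_on A ?F" for A
    by (intro continuous_intros continuous_on_compose2[OF contE[of UNIV]]) auto
  have intF: "integrable (lebesgue_on Omega) ?F" "integrable (lebesgue_on Omega) error_weight"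
    by (intro L2_imp_integrable continuous_imp_L2 contF continuous_error_weight)+
  have "integral\<^sup>L (lebesgue_on Omega) error_weight \<le> integral\<^sup>L (lebesgue_on Omega) ?F"
  proof (rule integral_mono[OF intF(2,1)])
    fix p :: "real \<times> real"
    show "error_weight p \<le> ?F p"
      using weights_sq_le[of "fst p"] weights_sq_le[of "snd p"]
      unfolding error_weight_def E_def distrib_left by linarith
  qed
  also have "\<dots> = integral Omega ?F"
    by (rule lebesgue_integral_eq_integral[OF intF(1) Omega_sets])
  also have "\<dots> = integral (cbox (0, 0) (1, 1)) ?F"
    unfolding Omega_box by (rule integral_open_interval)
  also have "\<dots> = integral {0..1} (\<lambda>x. integral {0..1} (\<lambda>y. ?F (x, y)))"
    using integral_prod_continuous[OF contF, of "0 :: real" "0 :: real" 1 1] by (simp add: cbox_interval)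
  also have "\<dots> = integral {0..1} (\<lambda>x. 4 + ?k * (E x + J))"
  proof (rule integral_cong)
    fix x :: real
    have "((\<lambda>y. 4 + ?k * E x + ?k * E y) has_integral (4 + ?k * E x) + ?k * J) {0..1}"
      using has_integral_add[OF has_integral_const_real[of "4 + ?k * E x" 0 1] has_integral_mult_right[OF J, of ?k]]
      by simp
    then show "integral {0..1} (\<lambda>y. ?F (x, y)) = 4 + ?k * (E x + J)"
      by (simp add: integral_unique distrib_left add.assoc)
  qed
  also have "\<dots> = 4 + ?k * (J + J)"
  proof -
    have "((\<lambda>x. 4 + ?k * J + ?k * E x) has_integral (4 + ?k * J) + ?k * J) {0..1}"
      using has_integral_add[OF has_integral_const_real[of "4 + ?k * J" 0 1] has_integral_mult_right[OF J, of ?k]]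
      by simp
    moreover have "(\<lambda>x. 4 + ?k * J + ?k * E x) = (\<lambda>x. 4 + ?k * (E x + J))"
      by (simp add: fun_eq_iff algebra_simps add_divide_distrib)
    ultimately have "integral {0..1} (\<lambda>x. 4 + ?k * (E x + J)) = 4 + ?k * J + ?k * J"
      by (metis integral_unique)
    then show ?thesis by (simp only: distrib_left add.assoc)
  qed
  also have "\<dots> \<le> 4 + ?k * (2 * (r / sqrt c) + 2 * (r / sqrt c))"
    using J_le by (intro add_left_mono mult_left_mono add_mono) auto
  also have "\<dots> = 4 + 16 / sqrt c / r"
    using r(1) by (simp add: power2_eq_square del: real_sqrt_mult_self)
  also have "\<dots> \<le> 4 / r + 16 / sqrt c / r"
    using r(1,2) by (simp add: field_simps)
  finally show ?thesis by (simp only: add_divide_distrib)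
qed

lemma L2_inner_self_le:
  fixes g :: "real \<times> real \<Rightarrow> 'a::euclidean_space"
  assumes g: "L2 g" and M: "\<And>i j p. i < N \<Longrightarrow> j < N \<Longrightarrow> p \<in> cell i j \<Longrightarrow> (norm (g p))\<^sup>2 \<le> M * h p"
    and h: "integrable (lebesgue_on Omega) h"
  shows "L2_inner g g \<le> M * integral\<^sup>L (lebesgue_on Omega) h"
proof -
  have "L2_inner g g \<le> integral\<^sup>L (lebesgue_on Omega) (\<lambda>p. M * h p)"
    unfolding L2_inner_def
  proof (rule integral_mono_AE)
    show "AE p in lebesgue_on Omega. g p \<bullet> g p \<le> M * h p"
      using AE_cell by eventually_elim (use M in \<open>auto simp: power2_norm_eq_inner\<close>)
  qed (use h L2_integrable_inner[OF g g] in auto)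
  then show ?thesis by simp
qed

text \<open>The two components are interpolated independently; continuity of the normal component holds
  because on each mesh line both neighbouring cells use the same nodal value.\<close>

lemma flux_approximation:
  assumes K: "0 \<le> K"
    and x: "approximates K P (\<lambda>x y. dx u (x, y)) (\<lambda>x y. dx (dx u) (x, y))"
    and y: "approximates K Q (\<lambda>x y. dy u (y, x)) (\<lambda>x y. dy (dy u) (y, x))"
    and u: "C_bar 2 u"
  obtains v A1 B1 A2 B2 where "rt_field v A1 B1 A2 B2" "normal_continuous A1 B1 A2 B2"
    and "L2_inner (\<lambda>p. - grad u p - v p) (\<lambda>p. - grad u p - v p)
      \<le> (K * \<delta>)\<^sup>2 * integral\<^sup>L (lebesgue_on Omega) error_weight"
    and "L2_inner (\<lambda>p. - laplacian u p - cell_div B1 B2 p) (\<lambda>p. - laplacian u p - cell_div B1 B2 p)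
      \<le> 2 / r\<^sup>2 * (K * \<delta>)\<^sup>2 * integral\<^sup>L (lebesgue_on Omega) error_weight"
proof -
  define A1 B1 A2 B2 where "A1 = (\<lambda>i j. - (P (xs i) (xs j) - slope P i j * xs i))"
    and "B1 = (\<lambda>i j. - slope P i j)" and "A2 = (\<lambda>i j. - (Q (xs j) (xs i) - slope Q j i * xs j))"
    and "B2 = (\<lambda>i j. - slope Q j i)"
  note defs = this
  define v where "v = piecewise (\<lambda>i j p. (A1 i j + B1 i j * fst p, A2 i j + B2 i j * snd p))"
  have v: "rt_field v A1 B1 A2 B2"
    unfolding rt_field_def
  proof (intro conjI allI impI ballI)
    show "L2 v" unfolding v_def by (intro L2_piecewise continuous_intros)
    fix i j p assume "i < N" "j < N" "p \<in> cell i j"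
    from piecewise_cell[OF this(3,1,2), of "\<lambda>i j p. (A1 i j + B1 i j * fst p, A2 i j + B2 i j * snd p)"]
    show "case p of (x, y) \<Rightarrow> v (x, y) = (A1 i j + B1 i j * x, A2 i j + B2 i j * y)"
      unfolding v_def by (cases p) simp
  qed
  have nc: "normal_continuous A1 B1 A2 B2"
  proof -
    have right_end: "P (xs i) t + (P (xs (Suc i)) t - P (xs i) t) / (xs (Suc i) - xs i) * (xs (Suc i) - xs i) = P (xs (Suc i)) t"
      if "i < N" for P :: "real \<Rightarrow> real \<Rightarrow> real" and i t
      using xs_less_Suc[OF that] by simp
    have 1: "A1 i j + B1 i j * xs (Suc i) = - P (xs (Suc i)) (xs j)" if "i < N" for i j
    proof -
      have "A1 i j + B1 i j * xs (Suc i) = - (P (xs i) (xs j) + slope P i j * (xs (Suc i) - xs i))"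
        by (simp add: defs algebra_simps)
      then show ?thesis unfolding slope_def right_end[OF that] .
    qed
    have 2: "A2 i j + B2 i j * xs (Suc j) = - Q (xs (Suc j)) (xs i)" if "j < N" for i j
    proof -
      have "A2 i j + B2 i j * xs (Suc j) = - (Q (xs j) (xs i) + slope Q j i * (xs (Suc j) - xs j))"
        by (simp add: defs algebra_simps)
      then show ?thesis unfolding slope_def right_end[OF that] .
    qed
    have 3: "A1 i j + B1 i j * xs i = - P (xs i) (xs j)" "A2 i j + B2 i j * xs j = - Q (xs j) (xs i)" for i j
      by (simp_all add: defs)
    show ?thesis unfolding normal_continuous_def by (simp add: 1 2 3)
  qed
  have u1: "C_bar (Suc 0) u" "C_bar (Suc 0) (dx u)" "C_bar (Suc 0) (dy u)"
    using u by (auto simp: numeral_2_eq_2)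
  have LAP: "L2 (laplacian u)"
    unfolding laplacian_def using u1 by (auto intro!: continuous_imp_L2 continuous_on_add)
  have Lv: "L2 v" using v by (simp add: rt_field_def)
  have EW: "integrable (lebesgue_on Omega) error_weight"
    by (intro L2_imp_integrable continuous_imp_L2 continuous_error_weight)
  have est: "\<bar>dx u (x, y) + (A1 i j + B1 i j * x)\<bar> \<le> K * \<delta> * (1 + weights x / r)"
    "\<bar>dy u (x, y) + (A2 i j + B2 i j * y)\<bar> \<le> K * \<delta> * (1 + weights y / r)"
    "\<bar>dx (dx u) (x, y) + B1 i j\<bar> \<le> K * \<delta> / r * (1 + weights x / r)"
    "\<bar>dy (dy u) (x, y) + B2 i j\<bar> \<le> K * \<delta> / r * (1 + weights y / r)"
    if ij: "i < N" "j < N" and p: "(x, y) \<in> cell i j" for i j x y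
  proof -
    have xy: "x \<in> {xs i..xs (Suc i)}" "y \<in> {xs j..xs (Suc j)}" using p by (auto simp: cell_mem)
    have e: "K * \<delta> * (1 / r + t / r\<^sup>2) = K * \<delta> / r * (1 + t / r)" for t
      by (simp add: power2_eq_square algebra_simps add_divide_distrib del: real_sqrt_mult_self)
    have e': "a - (b + t * (x - z)) = a + (- (b - t * z) + - t * x)" for a b t z x :: real
      by (simp add: algebra_simps)
    show "\<bar>dx u (x, y) + (A1 i j + B1 i j * x)\<bar> \<le> K * \<delta> * (1 + weights x / r)"
      "\<bar>dx (dx u) (x, y) + B1 i j\<bar> \<le> K * \<delta> / r * (1 + weights x / r)"
      using assms(2)[unfolded approximates_def, rule_format, OF ij xy] unfolding e e' defs by simp_all
    show "\<bar>dy u (x, y) + (A2 i j + B2 i j * y)\<bar> \<le> K * \<delta> * (1 + weights y / r)"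
      "\<bar>dy (dy u) (x, y) + B2 i j\<bar> \<le> K * \<delta> / r * (1 + weights y / r)"
      using assms(3)[unfolded approximates_def, rule_format, OF ij(2,1) xy(2,1)] unfolding e e' defs by simp_all
  qed
  have sq: "a\<^sup>2 \<le> b\<^sup>2" if "\<bar>a\<bar> \<le> b" for a b :: real
    using that by (metis abs_ge_zero power2_abs power_mono)
  have scale1: "(k * a)\<^sup>2 + (k * b)\<^sup>2 = k\<^sup>2 * (a\<^sup>2 + b\<^sup>2)"
    and scale2: "2 * ((k / t * a)\<^sup>2 + (k / t * b)\<^sup>2) = 2 / t\<^sup>2 * k\<^sup>2 * (a\<^sup>2 + b\<^sup>2)" for a b k t :: real
    by (simp_all only: power_mult_distrib power_divide) (simp_all add: algebra_simps add_divide_distrib)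
  show ?thesis
  proof (rule that[OF v nc])
    show "L2_inner (\<lambda>p. - grad u p - v p) (\<lambda>p. - grad u p - v p)
      \<le> (K * \<delta>)\<^sup>2 * integral\<^sup>L (lebesgue_on Omega) error_weight"
    proof (rule L2_inner_self_le[OF _ _ EW])
      show "L2 (\<lambda>p. - grad u p - v p)"
        by (intro L2_diff L2_uminus Lv C_bar_L2(2)[OF u1(1)])
      fix i j p assume ij: "i < N" "j < N" and p: "p \<in> cell i j"
      obtain x y where xy: "p = (x, y)" by force
      note E = est(1,2)[OF ij p[unfolded xy]]
      have vp: "v p = (A1 i j + B1 i j * x, A2 i j + B2 i j * y)"
        using rt_fieldD[OF v ij p] by (simp add: xy)
      have "(norm (- grad u p - v p))\<^sup>2 = (dx u (x, y) + (A1 i j + B1 i j * x))\<^sup>2 + (dy u (x, y) + (A2 i j + B2 i j * y))\<^sup>2"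
      proof -
        have "- grad u p - v p = (- (dx u (x, y) + (A1 i j + B1 i j * x)), - (dy u (x, y) + (A2 i j + B2 i j * y)))"
          unfolding vp by (simp add: grad_def xy)
        then show ?thesis by (simp only: norm_Pair real_sqrt_pow2 sum_power2_ge_zero real_norm_def power2_abs power2_minus)
      qed
      also have "\<dots> \<le> (K * \<delta> * (1 + weights x / r))\<^sup>2 + (K * \<delta> * (1 + weights y / r))\<^sup>2"
        by (intro add_mono sq E)
      also have "\<dots> = (K * \<delta>)\<^sup>2 * error_weight p"
        by (simp only: error_weight_def xy fst_conv snd_conv scale1)
      finally show "(norm (- grad u p - v p))\<^sup>2 \<le> (K * \<delta>)\<^sup>2 * error_weight p" .
    qed
    show "L2_inner (\<lambda>p. - laplacian u p - cell_div B1 B2 p) (\<lambda>p. - laplacian u p - cell_div B1 B2 p)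
      \<le> 2 / r\<^sup>2 * (K * \<delta>)\<^sup>2 * integral\<^sup>L (lebesgue_on Omega) error_weight"
    proof (rule L2_inner_self_le[OF _ _ EW])
      show "L2 (\<lambda>p. - laplacian u p - cell_div B1 B2 p)"
        by (intro L2_diff L2_uminus LAP L2_cell_div)
      fix i j p assume ij: "i < N" "j < N" and p: "p \<in> cell i j"
      obtain x y where xy: "p = (x, y)" by force
      note E = est(3,4)[OF ij p[unfolded xy]]
      have dp: "cell_div B1 B2 p = B1 i j + B2 i j"
        by (rule piecewise_cell[OF p ij])
      have two: "(a + b)\<^sup>2 \<le> 2 * (a\<^sup>2 + b\<^sup>2)" for a b :: real
        using zero_le_power2[of "a - b"] by (simp add: power2_eq_square algebra_simps)
      have "(norm (- laplacian u p - cell_div B1 B2 p))\<^sup>2 = ((dx (dx u) (x, y) + B1 i j) + (dy (dy u) (x, y) + B2 i j))\<^sup>2"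
        unfolding dp by (simp add: laplacian_def xy power2_eq_square algebra_simps)
      also have "\<dots> \<le> 2 * ((K * \<delta> / r * (1 + weights x / r))\<^sup>2 + (K * \<delta> / r * (1 + weights y / r))\<^sup>2)"
        by (intro order_trans[OF two] mult_left_mono add_mono sq E) auto
      also have "\<dots> = 2 / r\<^sup>2 * (K * \<delta>)\<^sup>2 * error_weight p"
        by (simp only: error_weight_def xy fst_conv snd_conv scale2)
      finally show "(norm (- laplacian u p - cell_div B1 B2 p))\<^sup>2 \<le> 2 / r\<^sup>2 * (K * \<delta>)\<^sup>2 * error_weight p" .
    qed
  qed
qed

lemma piecewise_constant_approximation:
  assumes f: "C_bar (Suc 0) f"
    and L: "\<And>p. p \<in> Omega_bar \<Longrightarrow> \<bar>dx f p\<bar> \<le> L \<and> \<bar>dy f p\<bar> \<le> L"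
  obtains fN where "fN \<in> W_space l N" "L2_inner (\<lambda>p. f p - fN p) (\<lambda>p. f p - fN p) \<le> (4 * L * \<delta>)\<^sup>2"
proof
  let ?fN = "piecewise (\<lambda>i j _. f (xs i, xs j))"
  have L0: "0 \<le> L" using L[of "(0, 0)"] by force
  have L2N: "L2 ?fN" by (intro L2_piecewise continuous_intros)
  then show "?fN \<in> W_space l N"
    using piecewise_cell[where F = "\<lambda>i j _. f (xs i, xs j)"] unfolding W_space_def by blast
  have one: "integrable (lebesgue_on Omega) (\<lambda>_. 1 :: real)"
    by (intro L2_imp_integrable continuous_imp_L2 continuous_intros)
  have "integral\<^sup>L (lebesgue_on Omega) (\<lambda>_. 1 :: real) = integral Omega (\<lambda>_. 1)"
    by (rule lebesgue_integral_eq_integral[OF one Omega_sets])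
  also have "\<dots> = integral (cbox (0, 0) (1, 1)) (\<lambda>_ :: real \<times> real. 1)"
    unfolding Omega_box by (rule integral_open_interval)
  also have "\<dots> = 1" by (simp add: content_Pair)
  finally have m: "integral\<^sup>L (lebesgue_on Omega) (\<lambda>_. 1 :: real) = 1" .
  have "L2_inner (\<lambda>p. f p - ?fN p) (\<lambda>p. f p - ?fN p) \<le> (4 * L * \<delta>)\<^sup>2 * integral\<^sup>L (lebesgue_on Omega) (\<lambda>_. 1)"
  proof (rule L2_inner_self_le)
    show "L2 (\<lambda>p. f p - ?fN p)"
      by (intro L2_diff L2N C_bar_L2(1)[OF f])
    show "integrable (lebesgue_on Omega) (\<lambda>_. 1 :: real)" by (rule one)
    fix i j p assume ij: "i < N" "j < N" and p: "p \<in> cell i j"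
    obtain x y where xy: "p = (x, y)" by force
    have I: "x \<in> {xs i..xs (Suc i)}" "y \<in> {xs j..xs (Suc j)}" using p by (auto simp: xy cell_mem)
    note sub = mesh_interval_subset[OF ij(1)] mesh_interval_subset[OF ij(2)]
    have x01: "x \<in> {0..1}" "y \<in> {0..1}" "xs i \<in> {0..1}" "xs j \<in> {0..1}"
      using subsetD[OF sub(1) I(1)] subsetD[OF sub(2) I(2)] xs_01[of i] xs_01[of j] ij by auto
    have "\<bar>f (x, y) - f (xs i, y)\<bar> \<le> L * \<bar>x - xs i\<bar>"
      by (rule Lipschitz_within[OF C_bar_dx[OF f _ x01(2)] order_refl]) (use L x01 in auto)
    also have "\<dots> \<le> L * (2 * \<delta>)"
      using I(1) xs_width_le[OF ij(1)] \<delta>(1) L0 by (intro mult_left_mono) auto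
    finally have 1: "\<bar>f (x, y) - f (xs i, y)\<bar> \<le> L * (2 * \<delta>)" .
    have "\<bar>f (xs i, y) - f (xs i, xs j)\<bar> \<le> L * \<bar>y - xs j\<bar>"
      by (rule Lipschitz_within[OF C_bar_dy[OF f x01(3)] order_refl]) (use L x01 in auto)
    also have "\<dots> \<le> L * (2 * \<delta>)"
      using I(2) xs_width_le[OF ij(2)] \<delta>(1) L0 by (intro mult_left_mono) auto
    finally have "\<bar>f (x, y) - f (xs i, xs j)\<bar> \<le> 4 * L * \<delta>" using 1 by simp
    then have "\<bar>f p - ?fN p\<bar> \<le> 4 * L * \<delta>"
      unfolding piecewise_cell[OF p ij] unfolding xy .
    then show "(norm (f p - ?fN p))\<^sup>2 \<le> (4 * L * \<delta>)\<^sup>2 * 1"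
      by (metis mult.right_neutral norm_ge_zero power_mono real_norm_def)
  qed
  then show "L2_inner (\<lambda>p. f p - ?fN p) (\<lambda>p. f p - ?fN p) \<le> (4 * L * \<delta>)\<^sup>2"
    unfolding m by simp
qed

text \<open>All constants are explicit and free of \<open>\<epsilon>\<close> and \<open>N\<close>; this is what makes the final estimate uniform.\<close>

lemma error_estimate:
  assumes C: "0 \<le> C" and f: "C_bar 2 f"
    and L: "\<And>p. p \<in> Omega_bar \<Longrightarrow> \<bar>dx f p\<bar> \<le> L \<and> \<bar>dy f p\<bar> \<le> L"
    and u: "bvp_solution c f \<epsilon> u" and dec: "layer_decomposition C c \<epsilon> u"
    and fem: "mixed_fem_solution c f \<epsilon> N uN qN"
  defines "Q \<equiv> (18 * \<Lambda> * C)\<^sup>2 * (4 + 16 / sqrt c) * (1 + 2 / c)"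
  shows "\<epsilon> powr (1 / 4) * L2_norm (\<lambda>p. - grad u p - qN p) + L2_norm (\<lambda>p. u p - uN p)
    \<le> (sqrt Q + sqrt ((32 * L\<^sup>2 + 2 * c * Q) / c\<^sup>2)) * \<delta>"
proof -
  define K where "K = 18 * \<Lambda> * C"
  define H where "H = integral\<^sup>L (lebesgue_on Omega) error_weight"
  have "0 \<le> \<Lambda>" using \<kappa> c by (simp add: \<Lambda>_def)
  then have K: "0 \<le> K" using C by (simp add: K_def)
  have u2: "C_bar 2 u" using u by (simp add: bvp_solution_def)
  have f1: "C_bar (Suc 0) f" using f by (auto simp: numeral_2_eq_2)
  obtain P P' where "approximates K P (\<lambda>x y. dx u (x, y)) (\<lambda>x y. dx (dx u) (x, y))"
      "approximates K P' (\<lambda>x y. dy u (y, x)) (\<lambda>x y. dy (dy u) (y, x))"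
    using approximable_solution[OF C dec] unfolding K_def by blast
  from flux_approximation[OF K this u2] obtain v A1 B1 A2 B2
    where v: "rt_field v A1 B1 A2 B2" "normal_continuous A1 B1 A2 B2"
      and \<eta>: "L2_inner (\<lambda>p. - grad u p - v p) (\<lambda>p. - grad u p - v p) \<le> (K * \<delta>)\<^sup>2 * H"
      and div_\<eta>: "L2_inner (\<lambda>p. - laplacian u p - cell_div B1 B2 p) (\<lambda>p. - laplacian u p - cell_div B1 B2 p)
        \<le> 2 / r\<^sup>2 * (K * \<delta>)\<^sup>2 * H"
    unfolding H_def by blast
  obtain fN where fN: "fN \<in> W_space l N" "L2_inner (\<lambda>p. f p - fN p) (\<lambda>p. f p - fN p) \<le> (4 * L * \<delta>)\<^sup>2"
    using piecewise_constant_approximation[OF f1 L] .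
  define e where "e = L2_inner (\<lambda>p. - grad u p - qN p) (\<lambda>p. - grad u p - qN p)"
  define d where "d = L2_inner (\<lambda>p. - laplacian u p - weak_div qN p) (\<lambda>p. - laplacian u p - weak_div qN p)"
  define w where "w = L2_inner (\<lambda>p. u p - uN p) (\<lambda>p. u p - uN p)"
  note fem' = fem[unfolded mixed_fem_solution_def, folded l_eq]
  note quasi = mixed_fem_quasi_optimal[OF c \<epsilon>(1) f u _ _ _ _ v fN(1), of uN qN, folded e_def d_def w_def]
  have q1: "e + \<epsilon> / c * d \<le> L2_inner (\<lambda>p. - grad u p - v p) (\<lambda>p. - grad u p - v p) + \<epsilon> / c *
      L2_inner (\<lambda>p. - laplacian u p - cell_div B1 B2 p) (\<lambda>p. - laplacian u p - cell_div B1 B2 p)"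
    by (rule quasi(1)) (use fem' in blast)+
  have q2: "c\<^sup>2 * w \<le> 2 * L2_inner (\<lambda>p. f p - fN p) (\<lambda>p. f p - fN p) + 2 * \<epsilon>\<^sup>2 * d"
    by (rule quasi(2)) (use fem' in blast)+
  have pos: "0 \<le> e" "0 \<le> d" "0 \<le> w" unfolding e_def d_def w_def by (rule L2_inner_self_nonneg)+
  have ec: "0 \<le> \<epsilon> / c" using \<epsilon> c by simp
  have "e + \<epsilon> / c * d \<le> (K * \<delta>)\<^sup>2 * H + \<epsilon> / c * (2 / r\<^sup>2 * (K * \<delta>)\<^sup>2 * H)"
    using q1 \<eta> mult_left_mono[OF div_\<eta> ec] by linarith
  also have "\<dots> = (K * \<delta>)\<^sup>2 * (1 + 2 / c) * H"
    using \<epsilon> by (simp add: algebra_simps)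
  also have "\<dots> \<le> (K * \<delta>)\<^sup>2 * (1 + 2 / c) * ((4 + 16 / sqrt c) / r)"
    using integral_error_weight c unfolding H_def by (intro mult_left_mono mult_nonneg_nonneg) auto
  also have "\<dots> = Q * \<delta>\<^sup>2 / r"
    by (simp add: Q_def K_def power_mult_distrib)
  finally have main: "e + \<epsilon> / c * d \<le> Q * \<delta>\<^sup>2 / r" .
  have Q: "0 \<le> Q" using c by (simp add: Q_def)
  have "e \<le> Q * \<delta>\<^sup>2 / r" using main mult_nonneg_nonneg[OF ec pos(2)] by linarith
  then have "r * e \<le> Q * \<delta>\<^sup>2" using r(1) by (simp add: field_simps)
  then have "sqrt (r * e) \<le> sqrt (Q * \<delta>\<^sup>2)" by (rule real_sqrt_le_mono)
  moreover have "sqrt (r * e) = \<epsilon> powr (1 / 4) * sqrt e"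
  proof -
    have "sqrt r = \<epsilon> powr (1 / 4)"
      using \<epsilon> by (simp add: powr_half_sqrt[symmetric] powr_powr)
    then show ?thesis by (simp add: real_sqrt_mult)
  qed
  moreover have "sqrt (Q * \<delta>\<^sup>2) = sqrt Q * \<delta>" using \<delta> by (simp add: real_sqrt_mult)
  ultimately have 1: "\<epsilon> powr (1 / 4) * sqrt e \<le> sqrt Q * \<delta>" by simp
  have "\<epsilon> / c * d \<le> Q * \<delta>\<^sup>2 / r" using main pos by linarith
  then have "c * \<epsilon> * (\<epsilon> / c * d) \<le> c * \<epsilon> * (Q * \<delta>\<^sup>2 / r)"
    using c \<epsilon> by (intro mult_left_mono) auto
  moreover have "c * \<epsilon> * (\<epsilon> / c * d) = \<epsilon>\<^sup>2 * d" using c by (simp add: power2_eq_square)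
  moreover have "c * \<epsilon> * (Q * \<delta>\<^sup>2 / r) = r * (c * Q * \<delta>\<^sup>2)"
  proof -
    have "\<epsilon> / r = r" by (rule real_div_sqrt) (use \<epsilon> in simp)
    then show ?thesis by (metis (no_types, opaque_lifting) mult.assoc mult.commute times_divide_eq_right)
  qed
  moreover have "r * (c * Q * \<delta>\<^sup>2) \<le> 1 * (c * Q * \<delta>\<^sup>2)"
    using r c Q by (intro mult_right_mono) auto
  ultimately have "\<epsilon>\<^sup>2 * d \<le> c * Q * \<delta>\<^sup>2" by linarith
  then have "c\<^sup>2 * w \<le> 2 * (4 * L * \<delta>)\<^sup>2 + 2 * (c * Q * \<delta>\<^sup>2)"
    using q2 fN(2) by linarith
  also have "\<dots> = (32 * L\<^sup>2 + 2 * c * Q) * \<delta>\<^sup>2" by (simp add: power_mult_distrib algebra_simps)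
  finally have "w \<le> (32 * L\<^sup>2 + 2 * c * Q) / c\<^sup>2 * \<delta>\<^sup>2" using c by (simp add: field_simps)
  then have "sqrt w \<le> sqrt ((32 * L\<^sup>2 + 2 * c * Q) / c\<^sup>2 * \<delta>\<^sup>2)" by (rule real_sqrt_le_mono)
  also have "\<dots> = sqrt ((32 * L\<^sup>2 + 2 * c * Q) / c\<^sup>2) * \<delta>" using \<delta> by (simp only: real_sqrt_mult) simp
  finally show ?thesis
    using 1 unfolding L2_norm_def e_def[symmetric] w_def[symmetric] by (simp add: distrib_right)
qed

end

lemma layer_decomposition_nonneg:
  assumes "layer_decomposition C c \<epsilon> u"
  shows "0 \<le> C"
proof -
  obtain S where "\<forall>x\<in>{0..1}. \<forall>y\<in>{0..1}. \<forall>m n. m + n \<le> 4 \<longrightarrow>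
      \<bar>pderivs m n S (x, y)\<bar> \<le> C * (1 + \<epsilon> powr (1 - real (m + n) / 2))"
    using assms unfolding layer_decomposition_def by blast
  then have "\<bar>pderivs 0 0 S (0, 0)\<bar> \<le> C * (1 + \<epsilon> powr (1 - real (0 + 0) / 2))"
    by (metis atLeastAtMost_iff le0 order_refl zero_le_one add_0)
  then have "0 \<le> C * (1 + \<epsilon> powr (1 - real (0 + 0) / 2))" by linarith
  then show ?thesis
    by (smt (verit) powr_ge_zero zero_le_mult_iff)
qed

theorem mainTheorem6:
  fixes c \<epsilon>0 :: real
    and f :: "real \<times> real \<Rightarrow> real"
    and u :: "real \<Rightarrow> real \<times> real \<Rightarrow> real"
  assumes "c > 0" and "0 < \<epsilon>0" and "\<epsilon>0 \<le> 1"
    and "C_bar 2 f"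
    and "\<And>\<epsilon>. 0 < \<epsilon> \<Longrightarrow> \<epsilon> \<le> \<epsilon>0 \<Longrightarrow> bvp_solution c f \<epsilon> (u \<epsilon>)"
    and "\<exists>C. \<forall>\<epsilon>. 0 < \<epsilon> \<and> \<epsilon> \<le> \<epsilon>0 \<longrightarrow> layer_decomposition C c \<epsilon> (u \<epsilon>)"
  shows "\<exists>C. \<forall>\<epsilon> N uN qN.
      0 < \<epsilon> \<and> \<epsilon> \<le> \<epsilon>0 \<and> 0 < N \<and> 4 dvd N \<and> shishkin_lam c \<epsilon> N \<le> 1 / 4 \<and>
      mixed_fem_solution c f \<epsilon> N uN qN \<longrightarrow>
      \<epsilon> powr (1 / 4) * L2_norm (\<lambda>p. - grad (u \<epsilon>) p - qN p) + L2_norm (\<lambda>p. u \<epsilon> p - uN p)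
        \<le> C * (ln (real N) / real N)"
proof -
  obtain C where dec: "\<And>\<epsilon>. 0 < \<epsilon> \<Longrightarrow> \<epsilon> \<le> \<epsilon>0 \<Longrightarrow> layer_decomposition C c \<epsilon> (u \<epsilon>)"
    using assms(6) by blast
  have C: "0 \<le> C"
    by (rule layer_decomposition_nonneg[OF dec[OF assms(2) order_refl]])
  have "continuous_on Omega_bar (dx f)" "continuous_on Omega_bar (dy f)"
    using assms(4) by (auto simp: numeral_2_eq_2)
  then obtain La Lb where "\<And>p. p \<in> Omega_bar \<Longrightarrow> norm (dx f p) \<le> La" "\<And>p. p \<in> Omega_bar \<Longrightarrow> norm (dy f p) \<le> Lb"
    by (metis continuous_imp_bounded_Omega)
  then have L: "\<bar>dx f p\<bar> \<le> max La Lb \<and> \<bar>dy f p\<bar> \<le> max La Lb" if "p \<in> Omega_bar" for p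
    using that by (metis le_max_iff_disj real_norm_def)
  define M where "M = (5 + 16 * exp 8 / sqrt c) * (2 + 8 / sqrt c)"
  define Q where "Q = (18 * M * C)\<^sup>2 * (4 + 16 / sqrt c) * (1 + 2 / c)"
  show ?thesis
  proof (intro exI allI impI, elim conjE)
    fix \<epsilon> N uN qN
    assume eps: "0 < \<epsilon>" "\<epsilon> \<le> \<epsilon>0" and N: "0 < N" "4 dvd N" and l: "shishkin_lam c \<epsilon> N \<le> 1 / 4"
      and fem: "mixed_fem_solution c f \<epsilon> N uN qN"
    have "4 \<le> N" using N by (auto elim!: dvdE)
    then have "0 < shishkin_lam c \<epsilon> N"
      using eps assms(1) by (simp add: shishkin_lam_def)
    then interpret shishkin_layer "shishkin_lam c \<epsilon> N" N c \<epsilon>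
      by unfold_locales (use l N eps assms in auto)
    show "\<epsilon> powr (1 / 4) * L2_norm (\<lambda>p. - grad (u \<epsilon>) p - qN p) + L2_norm (\<lambda>p. u \<epsilon> p - uN p)
        \<le> (sqrt Q + sqrt ((32 * (max La Lb)\<^sup>2 + 2 * c * Q) / c\<^sup>2)) * (ln (real N) / real N)"
      using error_estimate[OF C assms(4) L assms(5)[OF eps] dec[OF eps] fem]
      unfolding \<delta>_def Q_def M_def \<Lambda>_def \<kappa>_def by blast
  qed
qed

end
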